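(* Every unital simple TAI $C^*$-algebra $A$ has the following Fundamental Comparability property: if $p,q\in A$ are two projections with $\tau(p)<\tau(q)$ for all tracial states $\tau$ on $A$, then $p\preceq q$.
   Context: $\mathcal I$ denotes the class of all unital $C^*$-algebras of the form $\bigoplus_{i=1}^n B_i$ (finite direct sum), where each $B_i\cong M_k$ or $B_i\cong M_k(C([0,1]))$ for some integer $k$. For projections, $p\preceq q$ means $p$ is Murray–von Neumann equivalent to a projection in $qAq$; $[p]$ is the equivalence class of $p$; for $a\in A_+$, $p\preceq a$ means $p\preceq q$ for some projection $q\in\overline{aAa}$. An element is full if the closed ideal it generates is $A$. $x\in_\varepsilon S$ means there is $y\in S$ with $\|x-y\|<\varepsilon$. A unital $C^*$-algebra $A$ is tracially AI (TAI) if for any finite subset $\mathcal F\subset A$ containing a nonzero element $b$, any $\varepsilon>0$, any integer $n>0$ and any full element $a\in A_+$, there exist a nonzero projection $p\in A$ and a $C^*$-subalgebra $I\subset A$ with $I\in\mathcal I$ and $1_I=p$ such that (1) $\|xp-px\|<\varepsilon$ for all $x\in\mathcal F$; (2) $pxp\in_\varepsilon I$ for all $x\in\mathcal F$ and $\|pbp\|\ge\|b\|-\varepsilon$; (3) $n[1-p]\le[p]$ and $1-p\preceq a$. *)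

theory Defs
  imports
    "HOL-Analysis.Elementary_Topology"
    "HOL-Library.FuncSet"
    "HOL-Library.Nonpos_Ints"
    "Jordan_Normal_Form.Schur_Decomposition"
begin

section \<open>Unital C*-algebras\<close>

text \<open>Since \<^class>\<open>real_normed_algebra_1\<close> requires \<open>0 \<noteq> 1\<close>, the zero algebra is excluded.\<close>

class unital_cstar_algebra = real_normed_algebra_1 + banach +
  fixes scaleC :: "complex \<Rightarrow> 'a \<Rightarrow> 'a" (infixr \<open>*\<^sub>C\<close> 75)
    and star :: "'a \<Rightarrow> 'a"
  assumes scaleR_scaleC: "scaleR r x = complex_of_real r *\<^sub>C x"
    and scaleC_add_right: "c *\<^sub>C (x + y) = c *\<^sub>C x + c *\<^sub>C y"
    and scaleC_add_left: "(c + d) *\<^sub>C x = c *\<^sub>C x + d *\<^sub>C x"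
    and scaleC_scaleC: "c *\<^sub>C d *\<^sub>C x = (c * d) *\<^sub>C x"
    and mult_scaleC_left: "(c *\<^sub>C x) * y = c *\<^sub>C (x * y)"
    and mult_scaleC_right: "x * (c *\<^sub>C y) = c *\<^sub>C (x * y)"
    and norm_scaleC: "norm (c *\<^sub>C x) = cmod c * norm x"
    and star_add: "star (x + y) = star x + star y"
    and star_scaleC: "star (c *\<^sub>C x) = cnj c *\<^sub>C star x"
    and star_mult: "star (x * y) = star y * star x"
    and star_star: "star (star x) = x"
    and cstar_identity: "norm (star x * x) = (norm x)\<^sup>2"

definition cstar_spectrum :: "'a::unital_cstar_algebra \<Rightarrow> complex set" where
  "cstar_spectrum x = {c. \<not> (\<exists>y. (x - c *\<^sub>C 1) * y = 1 \<and> y * (x - c *\<^sub>C 1) = 1)}"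

definition positive_elt :: "'a::unital_cstar_algebra \<Rightarrow> bool" where
  "positive_elt a \<longleftrightarrow> star a = a \<and> cstar_spectrum a \<subseteq> \<real>\<^sub>\<ge>\<^sub>0"

definition projection :: "'a::unital_cstar_algebra \<Rightarrow> bool" where
  "projection p \<longleftrightarrow> star p = p \<and> p * p = p"

definition complex_subspace :: "'a::unital_cstar_algebra set \<Rightarrow> bool" where
  "complex_subspace S \<longleftrightarrow>
     0 \<in> S \<and> (\<forall>x\<in>S. \<forall>y\<in>S. x + y \<in> S) \<and> (\<forall>c. \<forall>x\<in>S. c *\<^sub>C x \<in> S)"

definition closed_ideal :: "'a::unital_cstar_algebra set \<Rightarrow> bool" where
  "closed_ideal J \<longleftrightarrow>
     complex_subspace J \<and> closed J \<and> (\<forall>a. \<forall>x\<in>J. a * x \<in> J \<and> x * a \<in> J)"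

definition full_elt :: "'a::unital_cstar_algebra \<Rightarrow> bool" where
  "full_elt a \<longleftrightarrow> \<Inter> {J. closed_ideal J \<and> a \<in> J} = UNIV"

text \<open>A C*-subalgebra need not contain the unit of the ambient algebra.\<close>

definition cstar_subalgebra :: "'a::unital_cstar_algebra set \<Rightarrow> bool" where
  "cstar_subalgebra B \<longleftrightarrow>
     complex_subspace B \<and> closed B \<and> (\<forall>x\<in>B. \<forall>y\<in>B. x * y \<in> B) \<and> (\<forall>x\<in>B. star x \<in> B)"

definition is_unit_of :: "'a::unital_cstar_algebra \<Rightarrow> 'a set \<Rightarrow> bool" where
  "is_unit_of p B \<longleftrightarrow> p \<in> B \<and> (\<forall>x\<in>B. p * x = x \<and> x * p = x)"

definition tracial_state :: "('a::unital_cstar_algebra \<Rightarrow> complex) \<Rightarrow> bool" where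
  "tracial_state \<tau> \<longleftrightarrow>
     (\<forall>x y. \<tau> (x + y) = \<tau> x + \<tau> y) \<and> (\<forall>c x. \<tau> (c *\<^sub>C x) = c * \<tau> x) \<and>
     (\<forall>a. positive_elt a \<longrightarrow> \<tau> a \<in> \<real>\<^sub>\<ge>\<^sub>0) \<and> \<tau> 1 = 1 \<and>
     (\<forall>x y. \<tau> (x * y) = \<tau> (y * x))"

section \<open>Comparison of projections\<close>

definition mvn_equiv :: "'a::unital_cstar_algebra \<Rightarrow> 'a \<Rightarrow> bool" where
  "mvn_equiv p q \<longleftrightarrow> (\<exists>v. star v * v = p \<and> v * star v = q)"

definition corner :: "'a::unital_cstar_algebra \<Rightarrow> 'a set" where
  "corner q = {q * x * q | x. True}"

definition proj_le :: "'a::unital_cstar_algebra \<Rightarrow> 'a \<Rightarrow> bool" where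
  "proj_le p q \<longleftrightarrow> (\<exists>r\<in>corner q. projection r \<and> mvn_equiv p r)"

definition proj_le_elt :: "'a::unital_cstar_algebra \<Rightarrow> 'a \<Rightarrow> bool" where
  "proj_le_elt p a \<longleftrightarrow> (\<exists>q\<in>closure {a * x * a | x. True}. projection q \<and> proj_le p q)"

text \<open>\<open>n[p] \<le> [q]\<close>: \<open>q\<close> dominates \<open>n\<close> mutually orthogonal copies of \<open>p\<close>.\<close>

definition multiple_le :: "nat \<Rightarrow> 'a::unital_cstar_algebra \<Rightarrow> 'a \<Rightarrow> bool" where
  "multiple_le n p q \<longleftrightarrow>
     (\<exists>r :: nat \<Rightarrow> 'a.
        (\<forall>i<n. projection (r i) \<and> r i \<in> corner q \<and> mvn_equiv p (r i)) \<and>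
        (\<forall>i<n. \<forall>j<n. i \<noteq> j \<longrightarrow> r i * r j = 0))"

section \<open>The class of interval algebras\<close>

definition interval_matrices :: "nat \<Rightarrow> (real \<Rightarrow> complex mat) set" where
  "interval_matrices k =
     {f \<in> {0..1} \<rightarrow>\<^sub>E carrier_mat k k.
        \<forall>i<k. \<forall>j<k. continuous_on {0..1} (\<lambda>t. f t $$ (i, j))}"

text \<open>\<open>\<phi>\<close> is a *-isomorphism of \<open>B\<close> onto the *-algebra with carrier \<open>C\<close> and the given addition,
  multiplication, scalar multiplication and involution.  Between C*-algebras such a map is
  automatically isometric.\<close>

definition star_isomorphism ::
  "('a::unital_cstar_algebra \<Rightarrow> 'b) \<Rightarrow> 'a set \<Rightarrow> 'b set \<Rightarrow> ('b \<Rightarrow> 'b \<Rightarrow> 'b) \<Rightarrow> ('b \<Rightarrow> 'b \<Rightarrow> 'b) \<Rightarrow>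
    (complex \<Rightarrow> 'b \<Rightarrow> 'b) \<Rightarrow> ('b \<Rightarrow> 'b) \<Rightarrow> bool" where
  "star_isomorphism \<phi> B C pls tms scl adj \<longleftrightarrow>
     bij_betw \<phi> B C \<and>
     (\<forall>x\<in>B. \<forall>y\<in>B. \<phi> (x + y) = pls (\<phi> x) (\<phi> y) \<and> \<phi> (x * y) = tms (\<phi> x) (\<phi> y)) \<and>
     (\<forall>c. \<forall>x\<in>B. \<phi> (c *\<^sub>C x) = scl c (\<phi> x)) \<and>
     (\<forall>x\<in>B. \<phi> (star x) = adj (\<phi> x))"

definition iso_matrices :: "'a::unital_cstar_algebra set \<Rightarrow> nat \<Rightarrow> bool" where
  "iso_matrices B k \<longleftrightarrow>
     (\<exists>\<phi>. star_isomorphism \<phi> B (carrier_mat k k) (+) (*) (\<cdot>\<^sub>m) mat_adjoint)"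

definition iso_interval_matrices :: "'a::unital_cstar_algebra set \<Rightarrow> nat \<Rightarrow> bool" where
  "iso_interval_matrices B k \<longleftrightarrow>
     (\<exists>\<phi>. star_isomorphism \<phi> B (interval_matrices k)
        (\<lambda>f g. \<lambda>t\<in>{0..1}. f t + g t) (\<lambda>f g. \<lambda>t\<in>{0..1}. f t * g t)
        (\<lambda>c f. \<lambda>t\<in>{0..1}. c \<cdot>\<^sub>m f t) (\<lambda>f. \<lambda>t\<in>{0..1}. mat_adjoint (f t)))"

text \<open>Direct sums are internal.  Uniqueness of the summands need not be demanded:
  if \<open>x\<close> lies in two mutually orthogonal C*-subalgebras, then \<open>star x * x = 0\<close>.\<close>

definition direct_sum_of :: "'a::unital_cstar_algebra set \<Rightarrow> nat \<Rightarrow> (nat \<Rightarrow> 'a set) \<Rightarrow> bool" where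
  "direct_sum_of D n B \<longleftrightarrow>
     (\<forall>i<n. cstar_subalgebra (B i)) \<and>
     (\<forall>i<n. \<forall>j<n. i \<noteq> j \<longrightarrow> (\<forall>x\<in>B i. \<forall>y\<in>B j. x * y = 0)) \<and>
     D = {\<Sum>i<n. b i | b. \<forall>i<n. b i \<in> B i}"

definition interval_algebra :: "'a::unital_cstar_algebra set \<Rightarrow> bool" where
  "interval_algebra D \<longleftrightarrow>
     cstar_subalgebra D \<and>
     (\<exists>n\<ge>1. \<exists>B. direct_sum_of D n B \<and>
        (\<forall>i<n. \<exists>k\<ge>1. iso_matrices (B i) k \<or> iso_interval_matrices (B i) k))"

section \<open>Simple and tracially AI algebras\<close>

definition simple_cstar :: "'a::unital_cstar_algebra itself \<Rightarrow> bool" where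
  "simple_cstar _ \<longleftrightarrow> (\<forall>J :: 'a set. closed_ideal J \<longrightarrow> J = {0} \<or> J = UNIV)"

definition tracially_AI :: "'a::unital_cstar_algebra itself \<Rightarrow> bool" where
  "tracially_AI _ \<longleftrightarrow>
     (\<forall>(F :: 'a set) b (\<epsilon> :: real) (n :: nat) a.
        finite F \<and> b \<in> F \<and> b \<noteq> 0 \<and> \<epsilon> > 0 \<and> n > 0 \<and> positive_elt a \<and> full_elt a \<longrightarrow>
        (\<exists>p D.
           projection p \<and> p \<noteq> 0 \<and> interval_algebra D \<and> is_unit_of p D \<and>
           (\<forall>x\<in>F. norm (x * p - p * x) < \<epsilon>) \<and>
           (\<forall>x\<in>F. \<exists>y\<in>D. norm (p * x * p - y) < \<epsilon>) \<and> norm (p * b * p) \<ge> norm b - \<epsilon> \<and>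
           multiple_le n (1 - p) p \<and> proj_le_elt (1 - p) a))"

text \<open>Traces of projections are real, so comparing real parts compares the values.\<close>

definition fundamental_comparability :: "'a::unital_cstar_algebra itself \<Rightarrow> bool" where
  "fundamental_comparability _ \<longleftrightarrow>
     (\<forall>p q :: 'a. projection p \<and> projection q \<and>
        (\<forall>\<tau>. tracial_state \<tau> \<longrightarrow> Re (\<tau> p) < Re (\<tau> q)) \<longrightarrow> proj_le p q)"

end

theory Submission
  imports Defs "HOL-Analysis.Function_Topology" "HOL-Analysis.Topology_Euclidean_Space"
begin

text \<open>Suppose that \<open>p\<close> is not subequivalent to \<open>q\<close>.  Then some tracial state \<open>\<tau>\<close> satisfies
  \<open>\<tau> q \<le> \<tau> p\<close>.  The tracial states form a weak-* compact set, so it suffices to find, for every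
  \<open>n > 0\<close>, a tracial state with \<open>\<tau> q \<le> \<tau> p + 1 / n\<close> (\<open>almost_violating_trace\<close>).

  Traces come from the interval algebras \<open>D\<close> that approximate the algebra, with unit \<open>e\<close>.  In \<open>D\<close> the order
  of projections is decided by finitely many normalized traces (\<open>interval_algebra_comparison\<close>): in
  \<open>M\<^sub>k(C([0,1]))\<close> every projection is homotopic to a constant one, and constant projections are compared by
  their rank.  If \<open>p\<^sub>1\<close> and \<open>q\<^sub>1\<close> are projections of \<open>D\<close> near \<open>e p e\<close> and \<open>e q e\<close>, and \<open>p\<^sub>1\<close> is not
  subequivalent to \<open>q\<^sub>1\<close>, then a trace \<open>\<sigma>\<close> of \<open>D\<close> has \<open>\<sigma> q\<^sub>1 < \<sigma> p\<^sub>1\<close>.  The map sending \<open>x\<close> to the value of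
  \<open>\<sigma>\<close> near \<open>e x e\<close> is almost a trace on the whole algebra, and a limit of such maps is the wanted tracial
  state (\<open>tracial_state_from_corners\<close>).

  It remains to see that \<open>p\<^sub>1 \<preceq> q\<^sub>1\<close> would give \<open>p \<preceq> q\<close>.  As \<open>p\<close> is nearly the sum of \<open>p\<^sub>1\<close> and a part
  under \<open>1 - e\<close>, this needs room for \<open>1 - e\<close> under \<open>q\<close>, orthogonal to what represents \<open>q\<^sub>1\<close>.  There are two
  cases.  If \<open>q\<close> dominates a nonzero projection \<open>q\<^sub>0\<close> with \<open>n\<close> orthogonal copies in the algebra, then \<open>q\<^sub>0\<close> is set
  aside: the approximation is chosen with \<open>1 - e \<preceq> q\<^sub>0\<close>, and \<open>p\<close> is compared with \<open>q - q\<^sub>0\<close>, which costs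
  \<open>\<tau> q\<^sub>0 \<le> 1 / n\<close>.  If there is no such \<open>q\<^sub>0\<close>, then an approximation with \<open>n[1 - e] \<le> [e]\<close> and \<open>1 - e \<preceq> q\<close>
  has \<open>e = 1\<close>, because \<open>1 - e\<close> is equivalent to a projection under \<open>q\<close> with \<open>n\<close> orthogonal copies.

  Two facts about C*-algebras carry the analysis.  Elements near the unit have square roots, obtained as fixed
  points of a contraction (\<open>inverse_sqrt_near_one\<close>); this turns approximate projections and partial isometries
  into exact ones.  The norm of a self-adjoint element is its spectral radius (\<open>norm_le_spectral_radius\<close>); this
  makes limits of traces positive and makes the isomorphism of \<open>M\<^sub>k(C([0,1]))\<close> with a block of \<open>D\<close>
  continuous.\<close>

section \<open>Arithmetic in C*-algebras\<close>

lemma scaleC_zero_left [simp]: "0 *\<^sub>C (x::'a::unital_cstar_algebra) = 0"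
  using scaleC_add_left[of 0 0 x] by simp

lemma scaleC_zero_right [simp]: "c *\<^sub>C (0::'a::unital_cstar_algebra) = 0"
  using scaleC_add_right[of c 0 "0::'a"] by simp

lemma scaleC_one [simp]: "1 *\<^sub>C (x::'a::unital_cstar_algebra) = x"
  using scaleR_scaleC[of 1 x] by simp

lemma scaleC_minus_left: "(- c) *\<^sub>C (x::'a::unital_cstar_algebra) = - (c *\<^sub>C x)"
  using scaleC_add_left[of c "-c" x] by (simp add: minus_unique)

lemma scaleC_minus_right: "c *\<^sub>C (- (x::'a::unital_cstar_algebra)) = - (c *\<^sub>C x)"
  using scaleC_add_right[of c x "-x"] by (simp add: minus_unique)

lemma scaleC_diff_right: "c *\<^sub>C ((x::'a::unital_cstar_algebra) - y) = c *\<^sub>C x - c *\<^sub>C y"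
  using scaleC_add_right[of c x "-y"] by (simp add: scaleC_minus_right)

lemma scaleC_diff_left: "(c - d) *\<^sub>C (x::'a::unital_cstar_algebra) = c *\<^sub>C x - d *\<^sub>C x"
  using scaleC_add_left[of c "-d" x] by (simp add: scaleC_minus_left)

lemma scaleC_power: "(c *\<^sub>C (x::'a::unital_cstar_algebra)) ^ n = c ^ n *\<^sub>C x ^ n"
  by (induction n) (simp_all add: mult_scaleC_left mult_scaleC_right scaleC_scaleC mult.commute)

lemma star_zero [simp]: "star (0::'a::unital_cstar_algebra) = 0"
  using star_add[of 0 "0::'a"] by simp

lemma star_one [simp]: "star (1::'a::unital_cstar_algebra) = 1"
  by (metis mult.left_neutral star_mult star_star mult.right_neutral)

lemma star_minus: "star (- (x::'a::unital_cstar_algebra)) = - star x"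
  using star_add[of x "-x"] by (simp add: minus_unique)

lemma star_diff: "star ((x::'a::unital_cstar_algebra) - y) = star x - star y"
  using star_add[of x "-y"] by (simp add: star_minus)

lemma star_scaleR: "star (r *\<^sub>R (x::'a::unital_cstar_algebra)) = r *\<^sub>R star x"
  by (simp add: scaleR_scaleC star_scaleC)

lemma star_sum: "star (sum (f :: _ \<Rightarrow> 'a::unital_cstar_algebra) A) = (\<Sum>i\<in>A. star (f i))"
  by (induction A rule: infinite_finite_induct) (simp_all add: star_add)

lemma star_power: "star ((x::'a::unital_cstar_algebra) ^ n) = star x ^ n"
  by (induction n) (simp_all add: star_mult power_commutes)

lemma norm_star_le: "norm (x::'a::unital_cstar_algebra) \<le> norm (star x)"
proof (cases "x = 0")
  case False
  have "norm x * norm x \<le> norm (star x) * norm x"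
    using cstar_identity[of x] norm_mult_ineq[of "star x" x] by (simp add: power2_eq_square)
  then show ?thesis using False by (simp add: mult_le_cancel_right)
qed simp

lemma norm_star [simp]: "norm (star (x::'a::unital_cstar_algebra)) = norm x"
  using norm_star_le[of x] norm_star_le[of "star x"] by (simp add: star_star)

lemma star_mult_self_eq_0: "star (x::'a::unital_cstar_algebra) * x = 0 \<Longrightarrow> x = 0"
  using cstar_identity[of x] by simp

lemma continuous_star: "continuous_on S (star :: 'a::unital_cstar_algebra \<Rightarrow> 'a)"
proof (rule continuous_on_iff[THEN iffD2], intro ballI allI impI)
  fix x :: 'a and e :: real assume "e > 0"
  then show "\<exists>d>0. \<forall>x'\<in>S. dist x' x < d \<longrightarrow> dist (star x') (star x) < e"
    by (intro exI[of _ e]) (simp add: dist_norm star_diff[symmetric])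
qed

lemma projection_one_minus: "projection (p::'a::unital_cstar_algebra) \<Longrightarrow> projection (1 - p)"
  by (simp add: projection_def star_diff algebra_simps)

lemma norm_isometry_le:
  assumes "norm (star v * (v::'a::unital_cstar_algebra)) \<le> 1"
  shows "norm v \<le> 1"
  using assms abs_square_le_1[of "norm v"] by (simp add: cstar_identity)

lemma norm_projection_le: 
  assumes "projection (p::'a::unital_cstar_algebra)"
  shows "norm p \<le> 1"
proof -
  have "norm p * norm p = 1 * norm p" 
    using cstar_identity[of p] assms by (simp add: projection_def power2_eq_square)
  then show ?thesis by (metis mult_cancel_right norm_zero zero_le_one order_refl)
qed

lemma norm_mult_le_right: "norm y \<le> 1 \<Longrightarrow> norm (x * (y::'a::unital_cstar_algebra)) \<le> norm x"
  by (metis mult.right_neutral mult_left_mono norm_ge_zero norm_mult_ineq order_trans)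

lemma norm_mult_le_left: "norm x \<le> 1 \<Longrightarrow> norm (x * (y::'a::unital_cstar_algebra)) \<le> norm y"
  by (metis mult.left_neutral mult_right_mono norm_ge_zero norm_mult_ineq order_trans)

lemma left_right_inverse_unique:
  "y * x = (1::'a::unital_cstar_algebra) \<Longrightarrow> x * z = 1 \<Longrightarrow> y = z"
  by (metis mult.assoc mult.left_neutral mult.right_neutral)

section \<open>Inverses and square roots near the unit\<close>

lemma cstar_subalgebraD:
  assumes "cstar_subalgebra (B::'a::unital_cstar_algebra set)"
  shows "0 \<in> B" "\<And>x y. x \<in> B \<Longrightarrow> y \<in> B \<Longrightarrow> x + y \<in> B" "\<And>c x. x \<in> B \<Longrightarrow> c *\<^sub>C x \<in> B"
    "closed B" "\<And>x y. x \<in> B \<Longrightarrow> y \<in> B \<Longrightarrow> x * y \<in> B" "\<And>x. x \<in> B \<Longrightarrow> star x \<in> B"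
    "\<And>r x. x \<in> B \<Longrightarrow> r *\<^sub>R x \<in> B" "\<And>x y. x \<in> B \<Longrightarrow> y \<in> B \<Longrightarrow> x - y \<in> B"
proof -
  show 1: "0 \<in> B" "\<And>x y. x \<in> B \<Longrightarrow> y \<in> B \<Longrightarrow> x + y \<in> B" "\<And>c x. x \<in> B \<Longrightarrow> c *\<^sub>C x \<in> B"
    "closed B" "\<And>x y. x \<in> B \<Longrightarrow> y \<in> B \<Longrightarrow> x * y \<in> B" "\<And>x. x \<in> B \<Longrightarrow> star x \<in> B"
    using assms by (auto simp: cstar_subalgebra_def complex_subspace_def)
  show "\<And>r x. x \<in> B \<Longrightarrow> r *\<^sub>R x \<in> B" by (simp add: scaleR_scaleC 1)
  show "x - y \<in> B" if "x \<in> B" "y \<in> B" for x y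
    using 1(2)[OF that(1) 1(3)[OF that(2), of "-1"]] by (simp add: scaleC_minus_left)
qed

text \<open>The unit of the ambient algebra need not lie in \<open>B\<close>, so only \<open>k = h + h\<^sup>2 + \<dots>\<close> can be asked to lie
  there.  It is the fixed point of \<open>k \<mapsto> h + h k\<close>, and the fixed point of \<open>k \<mapsto> h + k h\<close> is the same element
  since one-sided inverses agree.\<close>

lemma neumann:
  fixes h :: "'a::unital_cstar_algebra"
  assumes B: "cstar_subalgebra B" and h: "h \<in> B" "norm h < 1"
  obtains k where "k \<in> B" "(1 - h) * (1 + k) = 1" "(1 + k) * (1 - h) = 1"
    "norm k * (1 - norm h) \<le> norm h"
proof -
  note BD = cstar_subalgebraD[OF B]
  have comp: "complete B" using BD(4) by (simp add: complete_eq_closed)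
  have "\<exists>!k. k \<in> B \<and> h + h * k = k"
  proof (rule Banach_fix[OF comp _ norm_ge_zero h(2)])
    show "B \<noteq> {}" using h by auto
    show "(\<lambda>k. h + h * k) ` B \<subseteq> B" using BD h by auto
    show "dist (h + h * x) (h + h * y) \<le> norm h * dist x y" if "x \<in> B" "y \<in> B" for x y
      by (metis add_diff_cancel_left dist_norm norm_mult_ineq right_diff_distrib)
  qed
  then obtain k where k: "k \<in> B" "h + h * k = k" by blast
  have "\<exists>!k. k \<in> B \<and> h + k * h = k"
  proof (rule Banach_fix[OF comp _ norm_ge_zero h(2)])
    show "B \<noteq> {}" using h by auto
    show "(\<lambda>k. h + k * h) ` B \<subseteq> B" using BD h by auto
    show "dist (h + x * h) (h + y * h) \<le> norm h * dist x y" if "x \<in> B" "y \<in> B" for x y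
      by (metis add_diff_cancel_left dist_norm norm_mult_ineq left_diff_distrib mult.commute)
  qed
  then obtain l where l: "l \<in> B" "h + l * h = l" by blast
  have 1: "(1 - h) * (1 + k) = 1" using k(2) by (simp add: algebra_simps)
  have 2: "(1 + l) * (1 - h) = 1" using l(2) by (simp add: algebra_simps)
  have "1 + l = 1 + k" by (rule left_right_inverse_unique[OF 2 1])
  moreover have "norm k \<le> norm h + norm h * norm k"
    by (metis k(2) norm_triangle_le add_left_mono norm_mult_ineq)
  ultimately show ?thesis using that[OF k(1) 1] 2 by (simp add: algebra_simps)
qed

lemma cstar_subalgebra_UNIV: "cstar_subalgebra (UNIV::'a::unital_cstar_algebra set)"
  by (simp add: cstar_subalgebra_def complex_subspace_def)

text \<open>Here \<open>1 + k\<close> is the inverse square root of \<open>1 - u\<close>.  The equation \<open>(1 - h)\<^sup>2 = 1 - u\<close> says that \<open>h\<close> is a fixed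
  point of \<open>h \<mapsto> (u + h\<^sup>2) / 2\<close>, a contraction of the ball of radius \<open>1/2\<close>.  It preserves the closed set of
  self-adjoint elements of \<open>B\<close> that commute with \<open>w\<close>, so \<open>h\<close> inherits these properties.  Near \<open>h = 0\<close> the
  equation is \<open>h \<approx> u / 2\<close>, which bounds \<open>k\<close> by \<open>u\<close>.\<close>

lemma inverse_sqrt_near_one:
  fixes u :: "'a::unital_cstar_algebra"
  assumes B: "cstar_subalgebra B" and u: "u \<in> B" "star u = u" "norm u \<le> 3/4" and w: "u * w = w * u"
  obtains k where "k \<in> B" "star k = k" "k * w = w * k" "norm k \<le> 2 * norm u"
    "(1 + k) * (1 + k) * (1 - u) = 1"
proof -
  note BD = cstar_subalgebraD[OF B]
  define S where "S = {h \<in> B. star h = h \<and> h * w = w * h \<and> norm h \<le> 1/2}"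
  have "closed S"
    unfolding S_def
    by (intro closed_Collect_conj closed_Collect_eq closed_Collect_le continuous_intros continuous_star)
      (use BD(4) in simp)
  then have comp: "complete S" by (simp add: complete_eq_closed)
  define f where "f h = (1/2) *\<^sub>R (u + h * h)" for h
  have "\<exists>!h. h \<in> S \<and> f h = h"
  proof (rule Banach_fix[OF comp, of "1/2"])
    have "0 \<in> S" by (simp add: S_def BD)
    then show "S \<noteq> {}" by auto
    show "f ` S \<subseteq> S"
    proof
      fix y assume "y \<in> f ` S"
      then obtain h where h: "h \<in> B" "star h = h" "h * w = w * h" "norm h \<le> 1/2" and y: "y = f h"
        by (auto simp: S_def)
      have hh: "norm (h * h) \<le> 1/4"
        using norm_mult_ineq[of h h] mult_mono[OF h(4) h(4)] by simp
      have "norm y \<le> 1/2"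
        unfolding y f_def using norm_triangle_ineq[of u "h*h"] hh u(3) by simp
      moreover have "h * h * w = w * (h * h)" by (metis h(3) mult.assoc)
      ultimately show "y \<in> S"
        using h u w by (simp add: S_def y f_def BD star_scaleR star_add star_mult algebra_simps)
    qed
    show "dist (f x) (f y) \<le> 1/2 * dist x y" if "x \<in> S" "y \<in> S" for x y
    proof -
      have n: "norm x \<le> 1/2" "norm y \<le> 1/2" using that by (auto simp: S_def)
      have "f x - f y = (1/2) *\<^sub>R (x * (x - y) + (x - y) * y)"
        by (simp add: f_def algebra_simps)
      also have "norm \<dots> \<le> 1/2 * (norm x * norm (x - y) + norm (x - y) * norm y)"
        using norm_triangle_mono[OF norm_mult_ineq[of x "x-y"] norm_mult_ineq[of "x-y" y]] by simp
      also have "\<dots> \<le> 1/2 * (1/2 * norm (x - y) + norm (x - y) * (1/2))"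
        using n by (intro mult_left_mono add_mono mult_right_mono) auto
      finally show ?thesis by (simp add: dist_norm)
    qed
  qed auto
  then obtain h where hS: "h \<in> S" and fh: "f h = h" by blast
  then have h: "h \<in> B" "star h = h" "h * w = w * h" "norm h \<le> 1/2" by (auto simp: S_def)
  have "2 *\<^sub>R h = u + h * h" using arg_cong[OF fh, of "\<lambda>x. 2 *\<^sub>R x"] by (simp add: f_def)
  then have sq: "(1 - h) * (1 - h) = 1 - u" by (simp add: algebra_simps scaleR_2)
  have hh: "norm (h * h) \<le> 1/2 * norm h"
    using norm_mult_ineq[of h h] mult_right_mono[OF h(4) norm_ge_zero[of h]] by simp
  have "norm (f h) = 1/2 * norm (u + h * h)" by (simp add: f_def)
  then have "norm h \<le> 1/2 * (norm u + norm (h * h))"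
    using norm_triangle_ineq[of u "h*h"] fh by simp
  then have hu: "norm h \<le> 2/3 * norm u" using hh by simp
  obtain k where k: "k \<in> B" "(1 - h) * (1 + k) = 1" "(1 + k) * (1 - h) = 1"
    "norm k * (1 - norm h) \<le> norm h"
    using neumann[OF B h(1)] h(4) by force
  have "norm k * (1/2) \<le> norm k * (1 - norm h)" using h(4) by (intro mult_left_mono) auto
  then have nk: "norm k \<le> 2 * norm u" using k(4) hu norm_ge_zero[of u] by linarith
  have "(1 + star k) * (1 - h) = 1"
    using arg_cong[OF k(2), of star] by (simp add: star_mult star_add star_diff h(2))
  then have "1 + star k = 1 + k" by (rule left_right_inverse_unique[OF _ k(2)])
  then have sk: "star k = k" by simp
  have hw: "(1 - h) * w = w * (1 - h)" by (simp add: algebra_simps h(3))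
  have "w * (1 + k) = ((1 + k) * (1 - h)) * w * (1 + k)" by (simp add: k(3))
  also have "\<dots> = (1 + k) * ((1 - h) * w) * (1 + k)" by (simp only: mult.assoc)
  also have "\<dots> = (1 + k) * w * ((1 - h) * (1 + k))" unfolding hw by (simp only: mult.assoc)
  finally have "w * (1 + k) = (1 + k) * w" by (simp add: k(2))
  then have kw: "k * w = w * k" by (simp add: algebra_simps)
  have "(1 + k) * (1 + k) * ((1 - h) * (1 - h)) = (1 + k) * ((1 + k) * (1 - h)) * (1 - h)"
    by (simp only: mult.assoc)
  then have "(1 + k) * (1 + k) * (1 - u) = 1" by (simp add: k(3) sq)
  with k(1) sk kw nk show ?thesis using that by blast
qed

section \<open>Norm and spectrum of self-adjoint elements\<close>

text \<open>The C*-identity controls squares of self-adjoint elements, hence the powers reached by repeated squaring.\<close>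

lemma norm_selfadjoint_power:
  fixes h :: "'a::unital_cstar_algebra"
  assumes "star h = h"
  shows "norm (h ^ (2 ^ m)) = norm h ^ (2 ^ m)"
proof (induction m)
  case (Suc m)
  have "norm (h ^ (2 ^ Suc m)) = norm (star (h ^ (2^m)) * h ^ (2^m))"
    by (simp add: star_power assms power_add[symmetric] mult_2)
  also have "\<dots> = (norm h ^ (2^m))\<^sup>2" by (simp add: cstar_identity Suc)
  finally show ?case by (simp add: power_mult[symmetric] mult.commute)
qed simp

text \<open>The resolvent identity \<open>f \<mu> - f \<nu> = (\<mu> - \<nu>) f(\<mu>) h f(\<nu>)\<close> reduces everything to boundedness of the resolvent on
  the compact disc.\<close>

lemma resolvent_lipschitz:
  fixes h :: "'a::unital_cstar_algebra"
  assumes inv: "\<And>\<mu>. cmod \<mu> \<le> R \<Longrightarrow> \<exists>y. (1 - \<mu> *\<^sub>C h) * y = 1 \<and> y * (1 - \<mu> *\<^sub>C h) = 1"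
  obtains f M where
    "\<And>\<mu>. cmod \<mu> \<le> R \<Longrightarrow> (1 - \<mu> *\<^sub>C h) * f \<mu> = 1 \<and> f \<mu> * (1 - \<mu> *\<^sub>C h) = 1"
    "\<And>\<mu> \<nu>. cmod \<mu> \<le> R \<Longrightarrow> cmod \<nu> \<le> R \<Longrightarrow> norm (f \<mu> - f \<nu>) \<le> M * cmod (\<mu> - \<nu>)" "M \<ge> 0"
proof -
  obtain f where f: "\<And>\<mu>. cmod \<mu> \<le> R \<Longrightarrow> (1 - \<mu> *\<^sub>C h) * f \<mu> = 1"
    "\<And>\<mu>. cmod \<mu> \<le> R \<Longrightarrow> f \<mu> * (1 - \<mu> *\<^sub>C h) = 1"
    using inv by metis
  have res: "f \<mu> - f \<nu> = (\<mu> - \<nu>) *\<^sub>C (f \<mu> * h * f \<nu>)" if "cmod \<mu> \<le> R" "cmod \<nu> \<le> R" for \<mu> \<nu>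
  proof -
    have "(\<mu> - \<nu>) *\<^sub>C (f \<mu> * h * f \<nu>) = f \<mu> * ((\<mu> - \<nu>) *\<^sub>C h) * f \<nu>"
      by (simp add: mult_scaleC_left mult_scaleC_right)
    also have "\<dots> = f \<mu> * ((1 - \<nu> *\<^sub>C h) - (1 - \<mu> *\<^sub>C h)) * f \<nu>" by (simp add: scaleC_diff_left)
    also have "\<dots> = f \<mu> * ((1 - \<nu> *\<^sub>C h) * f \<nu>) - (f \<mu> * (1 - \<mu> *\<^sub>C h)) * f \<nu>"
      by (simp only: right_diff_distrib left_diff_distrib mult.assoc)
    finally show ?thesis using f that by simp
  qed
  have nres: "norm (f \<mu> - f \<nu>) \<le> cmod (\<mu> - \<nu>) * (norm (f \<mu>) * norm h * norm (f \<nu>))"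
    if "cmod \<mu> \<le> R" "cmod \<nu> \<le> R" for \<mu> \<nu>
    unfolding res[OF that] norm_scaleC
    by (intro mult_left_mono order_trans[OF norm_mult_ineq] mult_right_mono norm_mult_ineq) auto
  \<comment> \<open>The resolvent is bounded near each point, hence continuous, hence bounded on the disc.\<close>
  have "continuous_on (cball 0 R) f"
  proof (rule continuous_on_iff[THEN iffD2], intro ballI allI impI)
    fix \<nu> :: complex and e :: real assume \<nu>: "\<nu> \<in> cball 0 R" and e: "e > 0"
    then have \<nu>R: "cmod \<nu> \<le> R" by simp
    define K where "K = norm h * norm (f \<nu>) + 1"
    have K: "K \<ge> 1" "norm h * norm (f \<nu>) \<le> K" by (simp_all add: K_def)
    define d where "d = min (1/(2*K)) (e / (2 * K * (norm (f \<nu>) + 1)))"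
    have "d > 0" using e K by (auto simp: d_def intro!: divide_pos_pos mult_pos_pos add_nonneg_pos)
    moreover have "dist (f \<mu>) (f \<nu>) < e" if \<mu>: "\<mu> \<in> cball 0 R" "dist \<mu> \<nu> < d" for \<mu>
    proof -
      have \<mu>R: "cmod \<mu> \<le> R" using \<mu> by simp
      let ?c = "cmod (\<mu> - \<nu>)"
      have "?c < 1/(2*K)" using \<mu>(2) by (simp add: d_def dist_norm)
      then have c1: "?c * K \<le> 1/2" using K by (simp add: field_simps)
      have "?c < e / (2 * K * (norm (f \<nu>) + 1))" using \<mu>(2) by (simp add: d_def dist_norm)
      moreover have "2 * K * (norm (f \<nu>) + 1) > 0" using K by (simp add: add_nonneg_pos)
      ultimately have c2: "?c * (2 * K * (norm (f \<nu>) + 1)) < e" by (simp add: pos_less_divide_eq)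
      have "norm (f \<mu> - f \<nu>) \<le> norm (f \<mu>) * (?c * (norm h * norm (f \<nu>)))"
        using nres[OF \<mu>R \<nu>R] by (simp add: mult_ac)
      also have "\<dots> \<le> norm (f \<mu>) * (?c * K)" using K by (intro mult_left_mono) auto
      finally have 1: "norm (f \<mu> - f \<nu>) \<le> norm (f \<mu>) * (?c * K)" .
      also have "\<dots> \<le> norm (f \<mu>) * (1/2)" using c1 by (intro mult_left_mono) auto
      finally have "norm (f \<mu>) \<le> 2 * norm (f \<nu>)"
        using norm_triangle_sub[of "f \<mu>" "f \<nu>"] by linarith
      then have "norm (f \<mu>) * (?c * K) \<le> (2 * norm (f \<nu>)) * (?c * K)"
        using K by (intro mult_right_mono) auto
      also have "\<dots> \<le> ?c * (2 * K * (norm (f \<nu>) + 1))" using K by (simp add: algebra_simps)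
      finally show ?thesis using 1 c2 by (simp add: dist_norm)
    qed
    ultimately show "\<exists>d>0. \<forall>x'\<in>cball 0 R. dist x' \<nu> < d \<longrightarrow> dist (f x') (f \<nu>) < e" by blast
  qed
  then have "bounded (f ` cball 0 R)" by (intro compact_imp_bounded compact_continuous_image) auto
  then obtain K where "\<forall>y\<in>f ` cball 0 R. norm y \<le> K" unfolding bounded_iff by blast
  then have K: "norm (f \<mu>) \<le> K" if "cmod \<mu> \<le> R" for \<mu> using that by simp
  have "norm (f \<mu> - f \<nu>) \<le> (\<bar>K\<bar> * norm h * \<bar>K\<bar>) * cmod (\<mu> - \<nu>)"
    if "cmod \<mu> \<le> R" "cmod \<nu> \<le> R" for \<mu> \<nu>
  proof -
    have "norm (f \<mu>) * norm h * norm (f \<nu>) \<le> \<bar>K\<bar> * norm h * \<bar>K\<bar>"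
      using K[OF that(1)] K[OF that(2)] by (intro mult_mono) auto
    then have "cmod (\<mu> - \<nu>) * (norm (f \<mu>) * norm h * norm (f \<nu>)) \<le> cmod (\<mu> - \<nu>) * (\<bar>K\<bar> * norm h * \<bar>K\<bar>)"
      by (intro mult_left_mono) auto
    then show ?thesis using nres[OF that] by (simp add: mult_ac)
  qed
  then show ?thesis using that[of f "\<bar>K\<bar> * norm h * \<bar>K\<bar>"] f by auto
qed

text \<open>For \<open>N = 2 ^ m\<close> the inverse of \<open>1 - z ^ N\<close> is the average of the inverses of \<open>1 - \<omega> z\<close> over the \<open>N\<close>-th roots
  of unity \<open>\<omega>\<close>, and averaging over rotations of the disc does not increase a Lipschitz constant.  The point is that
  \<open>M\<close> does not depend on \<open>m\<close>.  The average is built by doubling, from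
  \<open>(1 - z\<^sup>2)\<^sup>-\<^sup>1 = ((1 - z)\<^sup>-\<^sup>1 + (1 + z)\<^sup>-\<^sup>1) / 2\<close>.\<close>

lemma resolvent_powers_lipschitz:
  fixes h :: "'a::unital_cstar_algebra"
  assumes inv: "\<And>\<mu>. cmod \<mu> \<le> R \<Longrightarrow> \<exists>y. (1 - \<mu> *\<^sub>C h) * y = 1 \<and> y * (1 - \<mu> *\<^sub>C h) = 1"
  obtains M where "M \<ge> 0" "\<And>m. \<exists>g. \<forall>\<mu>. cmod \<mu> \<le> R \<longrightarrow>
    (1 - (\<mu> *\<^sub>C h) ^ (2^m)) * g \<mu> = 1 \<and> (\<forall>\<nu>. cmod \<nu> \<le> R \<longrightarrow> norm (g \<mu> - g \<nu>) \<le> M * cmod (\<mu> - \<nu>))"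
proof -
  from resolvent_lipschitz[OF inv] obtain f M where fM:
    "\<And>\<mu>. cmod \<mu> \<le> R \<Longrightarrow> (1 - \<mu> *\<^sub>C h) * f \<mu> = 1 \<and> f \<mu> * (1 - \<mu> *\<^sub>C h) = 1"
    "\<And>\<mu> \<nu>. cmod \<mu> \<le> R \<Longrightarrow> cmod \<nu> \<le> R \<Longrightarrow> norm (f \<mu> - f \<nu>) \<le> M * cmod (\<mu> - \<nu>)" "M \<ge> 0"
    by metis
  have "\<exists>g. \<forall>\<mu>. cmod \<mu> \<le> R \<longrightarrow>
    (1 - (\<mu> *\<^sub>C h) ^ (2^m)) * g \<mu> = 1 \<and> (\<forall>\<nu>. cmod \<nu> \<le> R \<longrightarrow> norm (g \<mu> - g \<nu>) \<le> M * cmod (\<mu> - \<nu>))" for m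
  proof (induction m)
    case 0
    then show ?case using fM by (intro exI[of _ f]) auto
  next
    case (Suc m)
    then obtain g where g: "\<And>\<mu>. cmod \<mu> \<le> R \<Longrightarrow> (1 - (\<mu> *\<^sub>C h) ^ (2^m)) * g \<mu> = 1"
      "\<And>\<mu> \<nu>. cmod \<mu> \<le> R \<Longrightarrow> cmod \<nu> \<le> R \<Longrightarrow> norm (g \<mu> - g \<nu>) \<le> M * cmod (\<mu> - \<nu>)" by metis
    \<comment> \<open>Rotating by \<open>\<zeta>\<close> changes the sign of the power, which supplies the inverse of \<open>1 + z\<close>.\<close>
    define \<zeta> where "\<zeta> = cis (pi / 2^m)"
    have \<zeta>: "\<zeta> ^ (2^m) = -1" "cmod \<zeta> = 1"
      by (simp_all add: \<zeta>_def Complex.DeMoivre cis_pi)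
    define g' where "g' \<mu> = (1/2) *\<^sub>R (g \<mu> + g (\<zeta> * \<mu>))" for \<mu>
    have "(1 - (\<mu> *\<^sub>C h) ^ (2^Suc m)) * g' \<mu> = 1" if "cmod \<mu> \<le> R" for \<mu>
    proof -
      define z where "z = (\<mu> *\<^sub>C h) ^ (2^m)"
      have "((\<zeta> * \<mu>) *\<^sub>C h) ^ (2^m) = - z"
        by (simp add: scaleC_power power_mult_distrib \<zeta> z_def scaleC_minus_left)
      then have b: "(1 + z) * g (\<zeta> * \<mu>) = 1"
        using g(1)[of "\<zeta> * \<mu>"] that by (simp add: norm_mult \<zeta>)
      have a: "(1 - z) * g \<mu> = 1" using g(1)[OF that] by (simp add: z_def)
      have "(\<mu> *\<^sub>C h) ^ (2^Suc m) = z * z" by (simp add: z_def power_add[symmetric] mult_2)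
      then have "(1 - (\<mu> *\<^sub>C h) ^ (2^Suc m)) * g' \<mu> =
          (1/2) *\<^sub>R ((1 + z) * ((1 - z) * g \<mu>) + (1 - z) * ((1 + z) * g (\<zeta> * \<mu>)))"
        by (simp add: g'_def algebra_simps)
      then show ?thesis by (simp add: a b scaleR_2[symmetric])
    qed
    moreover have "norm (g' \<mu> - g' \<nu>) \<le> M * cmod (\<mu> - \<nu>)" if "cmod \<mu> \<le> R" "cmod \<nu> \<le> R" for \<mu> \<nu>
    proof -
      have "norm (g (\<zeta> * \<mu>) - g (\<zeta> * \<nu>)) \<le> M * cmod (\<zeta> * \<mu> - \<zeta> * \<nu>)"
        using that by (intro g) (auto simp: norm_mult \<zeta>)
      also have "cmod (\<zeta> * \<mu> - \<zeta> * \<nu>) = cmod (\<mu> - \<nu>)"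
        by (simp add: right_diff_distrib[symmetric] norm_mult \<zeta>)
      finally have 1: "norm (g (\<zeta> * \<mu>) - g (\<zeta> * \<nu>)) \<le> M * cmod (\<mu> - \<nu>)" .
      have "g' \<mu> - g' \<nu> = (1/2) *\<^sub>R ((g \<mu> - g \<nu>) + (g (\<zeta> * \<mu>) - g (\<zeta> * \<nu>)))"
        by (simp add: g'_def algebra_simps)
      then show ?thesis
        using norm_triangle_ineq[of "g \<mu> - g \<nu>" "g (\<zeta> * \<mu>) - g (\<zeta> * \<nu>)"] 1 g(2)[OF that] by simp
    qed
    ultimately show ?case by blast
  qed
  with fM(3) show ?thesis using that by blast
qed

text \<open>This is Rickart's proof.  Suppose that \<open>1 - \<mu> h\<close> is invertible on a disc of radius larger than \<open>1 / \<parallel>h\<parallel>\<close>.  Inside the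
  circle of radius \<open>1 / \<parallel>h\<parallel>\<close> the powers \<open>(\<mu> h) ^ N\<close> tend to zero, so the inverses of \<open>1 - (\<mu> h) ^ N\<close> are near
  \<open>1\<close>.  By the uniform Lipschitz bound they stay near \<open>1\<close> a little outside, so the powers there are bounded; but for
  self-adjoint \<open>h\<close> their norms grow like \<open>(1 + \<delta>) ^ N\<close>.\<close>

lemma norm_le_spectral_radius:
  fixes h :: "'a::unital_cstar_algebra"
  assumes sa: "star h = h" and \<rho>: "\<rho> \<ge> 0"
    and inv: "\<And>c. cmod c > \<rho> \<Longrightarrow> \<exists>y. (h - c *\<^sub>C 1) * y = 1 \<and> y * (h - c *\<^sub>C 1) = 1"
  shows "norm h \<le> \<rho>"
proof (rule ccontr)
  define H where "H = norm h"
  assume "\<not> norm h \<le> \<rho>"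
  then have H: "H > \<rho>" "H > 0" using \<rho> by (auto simp: H_def)
  define R where "R = 2 / (\<rho> + H)"
  have R: "R > 0" "R * H > 1" using H \<rho> by (auto simp: R_def field_simps)
  have "\<exists>y. (1 - \<mu> *\<^sub>C h) * y = 1 \<and> y * (1 - \<mu> *\<^sub>C h) = 1" if \<mu>: "cmod \<mu> \<le> R" for \<mu>
  proof (cases "\<mu> = 0")
    case False
    have "cmod (1/\<mu>) \<ge> 1 / R" using \<mu> False by (simp add: norm_divide frac_le)
    moreover have "1 / R > \<rho>" using H by (simp add: R_def)
    ultimately obtain y where y: "(h - (1/\<mu>) *\<^sub>C 1) * y = 1" "y * (h - (1/\<mu>) *\<^sub>C 1) = 1"
      using inv[of "1/\<mu>"] by auto
    have e: "1 - \<mu> *\<^sub>C h = (-\<mu>) *\<^sub>C (h - (1/\<mu>) *\<^sub>C 1)"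
      using False by (simp add: scaleC_minus_left scaleC_diff_right scaleC_scaleC)
    show ?thesis unfolding e
      using y False by (intro exI[of _ "(-1/\<mu>) *\<^sub>C y"]) (simp add: mult_scaleC_left mult_scaleC_right scaleC_scaleC)
  qed (auto intro!: exI[of _ 1])
  from resolvent_powers_lipschitz[OF this] obtain M where M: "M \<ge> 0" and ex: "\<And>m. \<exists>g. \<forall>\<mu>. cmod \<mu> \<le> R \<longrightarrow>
    (1 - (\<mu> *\<^sub>C h) ^ (2^m)) * g \<mu> = 1 \<and> (\<forall>\<nu>. cmod \<nu> \<le> R \<longrightarrow> norm (g \<mu> - g \<nu>) \<le> M * cmod (\<mu> - \<nu>))"
    by metis
  \<comment> \<open>Compare the points just inside and just outside the circle of radius \<open>1 / H\<close>.\<close>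
  define \<delta> where "\<delta> = min (R * H - 1) (min (1/2) (1 / (8 * (M / H + 1))))"
  have MH: "M / H + 1 > 0" using M H by (simp add: add_nonneg_pos)
  have "\<delta> > 0" using R MH by (simp add: \<delta>_def)
  moreover have "\<delta> \<le> 1/2" unfolding \<delta>_def by (intro min.coboundedI2 min.cobounded1)
  moreover have "\<delta> \<le> R * H - 1" unfolding \<delta>_def by (rule min.cobounded1)
  ultimately have \<delta>: "\<delta> > 0" "\<delta> \<le> 1/2" "\<delta> \<le> R * H - 1" by auto
  have "\<delta> \<le> 1 / (8 * (M / H + 1))" unfolding \<delta>_def by (intro min.coboundedI2 order_refl)
  then have "\<delta> * (8 * (M / H + 1)) \<le> 1" using MH by (simp add: pos_le_divide_eq)
  then have "8 * (M * (\<delta> / H)) + 8 * \<delta> \<le> 1" by (simp add: algebra_simps)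
  then have \<delta>M: "M * (2 * \<delta> / H) \<le> 1/4" using \<delta> by simp
  obtain m1 where m1: "(1 - \<delta>) ^ m1 < 1/8" using real_arch_pow_inv[of "1/8" "1-\<delta>"] \<delta> by auto
  obtain m2 where m2: "3 < (1 + \<delta>) ^ m2" using real_arch_pow[of "1+\<delta>" 3] \<delta> by auto
  define m where "m = m1 + m2"
  have "m1 \<le> m" "m2 \<le> m" by (simp_all add: m_def)
  with less_exp[of m] have m: "m1 \<le> 2 ^ m" "m2 \<le> 2 ^ m" by linarith+
  have "(1 - \<delta>) ^ (2^m) \<le> (1 - \<delta>) ^ m1" using \<delta> by (intro power_decreasing m) auto
  with m1 have p1: "(1 - \<delta>) ^ (2^m) \<le> 1/8" by linarith
  have "(1 + \<delta>) ^ m2 \<le> (1 + \<delta>) ^ (2^m)" using \<delta> by (intro power_increasing m) auto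
  with m2 have p2: "(1 + \<delta>) ^ (2^m) > 3" by linarith
  define \<mu> \<nu> where "\<mu> = complex_of_real ((1 - \<delta>) / H)" and "\<nu> = complex_of_real ((1 + \<delta>) / H)"
  have c: "cmod \<mu> = (1 - \<delta>) / H" "cmod \<nu> = (1 + \<delta>) / H"
    unfolding \<mu>_def \<nu>_def norm_of_real using \<delta> H by auto
  have "(1 + \<delta>) / H \<le> R" using \<delta> H by (simp add: field_simps)
  moreover have "(1 - \<delta>) / H \<le> (1 + \<delta>) / H" using \<delta> H by (simp add: divide_right_mono)
  ultimately have cR: "cmod \<mu> \<le> R" "cmod \<nu> \<le> R" using c by auto
  have "\<nu> - \<mu> = complex_of_real (2 * \<delta> / H)"
    by (simp add: \<mu>_def \<nu>_def diff_divide_distrib[symmetric] flip: of_real_diff of_real_divide)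
  then have "cmod (\<nu> - \<mu>) = \<bar>2 * \<delta> / H\<bar>" by (simp only: norm_of_real)
  then have d: "cmod (\<nu> - \<mu>) = 2 * \<delta> / H" using \<delta> H by simp
  obtain g where g: "\<And>\<mu>. cmod \<mu> \<le> R \<Longrightarrow> (1 - (\<mu> *\<^sub>C h) ^ (2^m)) * g \<mu> = 1"
      "\<And>\<mu> \<nu>. cmod \<mu> \<le> R \<Longrightarrow> cmod \<nu> \<le> R \<Longrightarrow> norm (g \<mu> - g \<nu>) \<le> M * cmod (\<mu> - \<nu>)"
    using ex[of m] by metis
  define z z' where "z = (\<mu> *\<^sub>C h) ^ (2^m)" and "z' = (\<nu> *\<^sub>C h) ^ (2^m)"
  have nz: "norm z = (1 - \<delta>) ^ (2^m)" "norm z' = (1 + \<delta>) ^ (2^m)"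
    using H by (simp_all add: z_def z'_def scaleC_power norm_scaleC norm_power norm_selfadjoint_power[OF sa]
        c power_mult_distrib[symmetric] H_def[symmetric])
  have "g \<mu> - 1 = z * g \<mu>" using g(1)[OF cR(1)] by (simp add: z_def algebra_simps)
  then have "norm (g \<mu> - 1) \<le> norm z * norm (g \<mu>)" by (simp add: norm_mult_ineq)
  also have "\<dots> \<le> 1/8 * (1 + norm (g \<mu> - 1))"
    using nz p1 norm_triangle_sub[of "g \<mu>" 1] by (intro mult_mono) auto
  finally have "norm (g \<mu> - 1) \<le> 1/4" by simp
  moreover have "norm (g \<nu> - g \<mu>) \<le> 1/4" using g(2)[OF cR(2,1)] \<delta>M d by simp
  ultimately have a: "norm (1 - g \<nu>) \<le> 1/2"
    using norm_triangle_ineq[of "g \<nu> - g \<mu>" "g \<mu> - 1"] by (simp add: norm_minus_commute)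
  have "1 - z' = 1 + (1 - z') * (1 - g \<nu>)" using g(1)[OF cR(2)] by (simp add: z'_def algebra_simps)
  then have "norm (1 - z') \<le> 1 + norm ((1 - z') * (1 - g \<nu>))"
    using norm_triangle_ineq[of 1 "(1 - z') * (1 - g \<nu>)"] by (metis norm_one)
  also have "\<dots> \<le> 1 + norm (1 - z') * (1/2)"
    using norm_mult_ineq[of "1 - z'" "1 - g \<nu>"] mult_left_mono[OF a norm_ge_zero[of "1-z'"]] by linarith
  finally have "norm (1 - z') \<le> 2" by simp
  then have "norm z' \<le> 3" using norm_triangle_sub[of z' 1] by (simp add: norm_minus_commute)
  then show False using nz p2 by simp
qed


lemma invertible_outside_norm_disc:
  fixes a :: "'a::unital_cstar_algebra"
  assumes "norm a < cmod c"
  shows "\<exists>y. (a - c *\<^sub>C 1) * y = 1 \<and> y * (a - c *\<^sub>C 1) = 1"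
proof -
  have c: "c \<noteq> 0" using assms by auto
  then have "norm ((1/c) *\<^sub>C a) < 1"
    using assms by (simp add: norm_scaleC norm_divide)
  then obtain k where k: "(1 - (1/c) *\<^sub>C a) * (1 + k) = 1" "(1 + k) * (1 - (1/c) *\<^sub>C a) = 1"
    using neumann[OF cstar_subalgebra_UNIV, of "(1/c) *\<^sub>C a"] by auto
  have e: "a - c *\<^sub>C 1 = (-c) *\<^sub>C (1 - (1/c) *\<^sub>C a)"
    using c by (simp add: scaleC_minus_left scaleC_diff_right scaleC_scaleC)
  show ?thesis unfolding e
    using k c by (intro exI[of _ "(-1/c) *\<^sub>C (1 + k)"])
      (simp only: mult_scaleC_left mult_scaleC_right scaleC_scaleC, simp)
qed

section \<open>Tracial states as limits of approximate traces\<close>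

text \<open>Positivity follows from \<open>\<tau> 1 = 1\<close> and the norm bound.  Testing the bound on \<open>a + i s\<close> for all real
  \<open>s\<close> makes \<open>\<tau> a\<close> real.  As the spectrum of \<open>a\<close> lies between \<open>0\<close> and \<open>\<parallel>a\<parallel>\<close>, the element \<open>\<parallel>a\<parallel> - a\<close> has norm at
  most \<open>\<parallel>a\<parallel>\<close>; testing on it gives \<open>\<parallel>a\<parallel> - \<tau> a \<le> \<parallel>a\<parallel>\<close>.\<close>

lemma contractive_functional_nonneg:
  fixes \<tau> :: "'a::unital_cstar_algebra \<Rightarrow> complex"
  assumes add: "\<And>x y. \<tau> (x + y) = \<tau> x + \<tau> y" and scal: "\<And>c x. \<tau> (c *\<^sub>C x) = c * \<tau> x"
    and bnd: "\<And>x. cmod (\<tau> x) \<le> norm x" and one: "\<tau> 1 = 1" and a: "positive_elt a"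
  shows "\<tau> a \<in> \<real>\<^sub>\<ge>\<^sub>0"
proof -
  have sa: "star a = a" and spec: "cstar_spectrum a \<subseteq> \<real>\<^sub>\<ge>\<^sub>0"
    using a by (auto simp: positive_elt_def)
  define K where "K = (norm a)\<^sup>2"
  have im: "2 * Im (\<tau> a) * s \<le> K" for s :: real
  proof -
    define x where "x = a + (\<i> * of_real s) *\<^sub>C 1"
    have "(a + c *\<^sub>C 1) * (a + t *\<^sub>C 1) = a * a + t *\<^sub>C a + (c *\<^sub>C a + (c * t) *\<^sub>C 1)" for c t
      by (simp add: distrib_left distrib_right mult_scaleC_left mult_scaleC_right scaleC_scaleC scaleC_add_right add_ac mult.commute[of t])
    from this[of "cnj (\<i> * of_real s)" "\<i> * of_real s"]
    have "star x * x = a * a + (of_real (s\<^sup>2)) *\<^sub>C 1"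
      by (simp add: x_def star_add star_scaleC sa scaleC_minus_left power2_eq_square mult_ac)
    then have "(norm x)\<^sup>2 = norm (a * a + (of_real (s\<^sup>2)) *\<^sub>C 1)" by (metis cstar_identity)
    also have "\<dots> \<le> norm (a * a) + s\<^sup>2"
      using norm_triangle_ineq[of "a * a" "of_real (s\<^sup>2) *\<^sub>C 1"]
      unfolding norm_scaleC norm_of_real by simp
    also have "norm (a * a) = K" using cstar_identity[of a] by (simp add: sa K_def)
    finally have nx: "(norm x)\<^sup>2 \<le> K + s\<^sup>2" .
    have "\<tau> x = \<tau> a + \<i> * of_real s" by (simp add: x_def add scal one)
    then have "(cmod (\<tau> x))\<^sup>2 = (Re (\<tau> a))\<^sup>2 + (Im (\<tau> a) + s)\<^sup>2" by (simp add: cmod_power2)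
    moreover have "(cmod (\<tau> x))\<^sup>2 \<le> (norm x)\<^sup>2" by (intro power_mono bnd) auto
    ultimately have "(Re (\<tau> a))\<^sup>2 + (Im (\<tau> a))\<^sup>2 + 2 * Im (\<tau> a) * s \<le> K"
      using nx by (simp add: power2_sum)
    then show ?thesis using zero_le_power2[of "Re (\<tau> a)"] zero_le_power2[of "Im (\<tau> a)"] by linarith
  qed
  have "Im (\<tau> a) = 0"
    using im[of "(K + 1) / (2 * Im (\<tau> a))"] by (cases "Im (\<tau> a) = 0") auto
  moreover have "Re (\<tau> a) \<ge> 0"
  proof -
    define s where "s = norm a"
    define h where "h = of_real s *\<^sub>C 1 - a"
    have "norm h \<le> s"
    proof (rule norm_le_spectral_radius)
      show "star h = h" by (simp add: h_def star_diff star_scaleC sa)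
      show "s \<ge> 0" by (simp add: s_def)
      fix c assume c: "cmod c > s"
      define d where "d = of_real s - c"
      have "\<exists>y. (a - d *\<^sub>C 1) * y = 1 \<and> y * (a - d *\<^sub>C 1) = 1"
      proof (rule ccontr)
        assume n: "\<not> ?thesis"
        then have "d \<in> cstar_spectrum a" by (simp add: cstar_spectrum_def)
        with spec have d0: "Re d \<ge> 0" "Im d = 0" by (auto simp: complex_nonneg_Reals_iff)
        then have "c = of_real (s - Re d)" by (simp add: d_def complex_eq_iff)
        then have "cmod c = \<bar>s - Re d\<bar>" by (metis norm_of_real real_norm_def)
        then have "Re d > s" using c d0(1) by linarith
        then have "cmod d > norm a" using complex_Re_le_cmod[of d] by (simp add: s_def)
        from invertible_outside_norm_disc[OF this] n show False by simp
      qed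
      then obtain y where y: "(a - d *\<^sub>C 1) * y = 1" "y * (a - d *\<^sub>C 1) = 1" by blast
      have "h - c *\<^sub>C 1 = - (a - d *\<^sub>C 1)" by (simp add: h_def d_def scaleC_diff_left)
      then show "\<exists>y. (h - c *\<^sub>C 1) * y = 1 \<and> y * (h - c *\<^sub>C 1) = 1"
        using y by (intro exI[of _ "-y"]) (simp only: minus_mult_minus)
    qed
    then have "Re (\<tau> h) \<le> s" using bnd[of h] complex_Re_le_cmod[of "\<tau> h"] by linarith
    moreover have "\<tau> h + \<tau> a = of_real s" by (simp add: add[symmetric] h_def scal one)
    then have "Re (\<tau> h) + Re (\<tau> a) = s" by (metis Re_complex_of_real plus_complex.simps(1))
    ultimately show ?thesis by simp
  qed
  ultimately show ?thesis by (simp add: complex_nonneg_Reals_iff)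
qed

text \<open>The norm bound is imposed at every point, so that the values lie in fixed discs, whereas the algebraic conditions
  are tested on finite sets.  All of them are closed conditions for pointwise convergence.\<close>

definition approximate_trace ::
  "'a::unital_cstar_algebra set \<Rightarrow> complex set \<Rightarrow> real \<Rightarrow> ('a \<Rightarrow> complex) \<Rightarrow> bool" where
  "approximate_trace F G \<epsilon> \<sigma> \<longleftrightarrow>
     (\<forall>x. cmod (\<sigma> x) \<le> norm x + \<epsilon>) \<and> cmod (\<sigma> 1 - 1) \<le> \<epsilon> \<and>
     (\<forall>x\<in>F. \<forall>y\<in>F. cmod (\<sigma> (x + y) - (\<sigma> x + \<sigma> y)) \<le> \<epsilon>) \<and>
     (\<forall>x\<in>F. \<forall>y\<in>F. cmod (\<sigma> (x * y) - \<sigma> (y * x)) \<le> \<epsilon>) \<and>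
     (\<forall>c\<in>G. \<forall>x\<in>F. cmod (\<sigma> (c *\<^sub>C x) - c * \<sigma> x) \<le> \<epsilon>)"

lemma approximate_trace_mono:
  assumes "approximate_trace F' G' \<epsilon>' \<sigma>" "F \<subseteq> F'" "G \<subseteq> G'" "\<epsilon>' \<le> \<epsilon>"
  shows "approximate_trace F G \<epsilon> \<sigma>"
  unfolding approximate_trace_def
proof (intro conjI allI ballI)
  note A = assms(1)[unfolded approximate_trace_def]
  show "cmod (\<sigma> x) \<le> norm x + \<epsilon>" for x
    using A assms(4) by (meson add_left_mono order_trans)
  show "cmod (\<sigma> 1 - 1) \<le> \<epsilon>" using A assms(4) by linarith
  show "cmod (\<sigma> (x + y) - (\<sigma> x + \<sigma> y)) \<le> \<epsilon>" if "x \<in> F" "y \<in> F" for x y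
    using A assms that by (meson order_trans subsetD)
  show "cmod (\<sigma> (x * y) - \<sigma> (y * x)) \<le> \<epsilon>" if "x \<in> F" "y \<in> F" for x y
    using A assms that by (meson order_trans subsetD)
  show "cmod (\<sigma> (c *\<^sub>C x) - c * \<sigma> x) \<le> \<epsilon>" if "c \<in> G" "x \<in> F" for c x
    using A assms that by (meson order_trans subsetD)
qed

lemma closed_Collect_ball:
  assumes "\<And>x. x \<in> A \<Longrightarrow> closed {\<sigma>. P x \<sigma>}"
  shows "closed {\<sigma>. \<forall>x\<in>A. P x \<sigma>}"
  unfolding Collect_ball_eq using assms by (intro closed_INT) auto

text \<open>By Tychonoff's theorem the functions with \<open>\<sigma> x\<close> in the disc of radius \<open>\<parallel>x\<parallel> + 1\<close> form a compact space.  The closed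
  sets of approximate traces have the finite intersection property, because the requirements of finitely many of
  them can be merged into one, and a common point is an exact trace.\<close>

lemma tracial_state_from_approximate_traces:
  fixes p q :: "'a::unital_cstar_algebra"
  assumes ex: "\<And>F G \<epsilon>. finite F \<Longrightarrow> finite G \<Longrightarrow> \<epsilon> > 0 \<Longrightarrow>
    \<exists>\<sigma>. approximate_trace F G \<epsilon> \<sigma> \<and> Re (\<sigma> q) \<le> Re (\<sigma> p) + \<epsilon>"
  obtains \<tau> where "tracial_state \<tau>" "\<And>x. cmod (\<tau> x) \<le> norm x" "Re (\<tau> q) \<le> Re (\<tau> p)"
proof -
  define S where "S = {\<sigma> :: 'a \<Rightarrow> complex. \<forall>x. \<sigma> x \<in> cball 0 (norm x + 1)}"
  define I where "I = {(F::'a set, G::complex set, \<epsilon>::real). finite F \<and> finite G \<and> \<epsilon> > 0}"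
  define C where "C = (\<lambda>(F, G, \<epsilon>). {\<sigma>. approximate_trace F G \<epsilon> \<sigma> \<and> Re (\<sigma> q) \<le> Re (\<sigma> p) + \<epsilon>})"
  have "compactin (product_topology (\<lambda>_. euclidean) UNIV) (PiE UNIV (\<lambda>x::'a. cball (0::complex) (norm x + 1)))"
    unfolding compactin_PiE by auto
  then have "compact S"
    by (simp add: euclidean_product_topology compactin_euclidean_iff S_def PiE_UNIV_domain Pi_def)
  have ev: "continuous_on UNIV (\<lambda>\<sigma>::'a \<Rightarrow> complex. \<sigma> x)" for x
    by (rule continuous_on_product_coordinates)
  have "S \<inter> (\<Inter>i\<in>I. C i) \<noteq> {}"
  proof (rule compact_imp_fip_image[OF \<open>compact S\<close>])
    fix i assume "i \<in> I"
    then obtain F G \<epsilon> where i: "i = (F, G, \<epsilon>)" by (cases i)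
    show "closed (C i)"
      unfolding C_def i approximate_trace_def prod.case
      by (intro closed_Collect_conj closed_Collect_ball closed_Collect_all closed_Collect_le
          continuous_intros ev)
  next
    fix I' assume I': "finite I'" "I' \<subseteq> I"
    define F where "F = (\<Union>i\<in>I'. fst i)"
    define G where "G = (\<Union>i\<in>I'. fst (snd i))"
    define \<epsilon> where "\<epsilon> = Min (insert 1 ((\<lambda>i. snd (snd i)) ` I'))"
    have fin: "finite F" "finite G" using I' by (auto simp: F_def G_def I_def)
    have e: "\<epsilon> > 0" "\<epsilon> \<le> 1" using I' by (auto simp: \<epsilon>_def I_def)
    obtain \<sigma> where s: "approximate_trace F G \<epsilon> \<sigma>" "Re (\<sigma> q) \<le> Re (\<sigma> p) + \<epsilon>"
      using ex[OF fin e(1)] by blast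
    have "\<sigma> \<in> C i" if "i \<in> I'" for i
    proof -
      obtain F1 G1 e1 where i: "i = (F1, G1, e1)" by (cases i)
      have le: "\<epsilon> \<le> e1" unfolding \<epsilon>_def using I'(1) that i by (intro Min_le) (auto simp: rev_image_eqI)
      moreover have "F1 \<subseteq> F" "G1 \<subseteq> G" using that i by (auto simp: F_def G_def intro: rev_bexI)
      ultimately have "approximate_trace F1 G1 e1 \<sigma>" using approximate_trace_mono[OF s(1)] by blast
      then show ?thesis using s(2) le by (simp add: C_def i)
    qed
    moreover have "\<sigma> \<in> S"
    proof -
      have "cmod (\<sigma> x) \<le> norm x + 1" for x
        using s(1) e(2) unfolding approximate_trace_def by (meson add_left_mono order_trans)
      then show ?thesis by (simp add: S_def)
    qed
    ultimately show "S \<inter> (\<Inter>i\<in>I'. C i) \<noteq> {}" by blast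
  qed
  then obtain \<tau> where "\<And>i. i \<in> I \<Longrightarrow> \<tau> \<in> C i" by blast
  then have \<tau>: "approximate_trace F G \<epsilon> \<tau>" "Re (\<tau> q) \<le> Re (\<tau> p) + \<epsilon>"
    if "finite F" "finite G" "\<epsilon> > 0" for F G \<epsilon>
    using that by (force simp: I_def C_def)+
  have exact: "z = w" if "\<And>\<epsilon>. \<epsilon> > 0 \<Longrightarrow> cmod (z - w) \<le> \<epsilon>" for z w
    using field_le_epsilon[of "cmod (z - w)" 0] that by simp
  have add: "\<tau> (x + y) = \<tau> x + \<tau> y" for x y
    by (rule exact) (use \<tau>(1)[of "{x,y}" "{}"] in \<open>simp add: approximate_trace_def\<close>)
  have comm: "\<tau> (x * y) = \<tau> (y * x)" for x y
    by (rule exact) (use \<tau>(1)[of "{x,y}" "{}"] in \<open>simp add: approximate_trace_def\<close>)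
  have scal: "\<tau> (c *\<^sub>C x) = c * \<tau> x" for c x
    by (rule exact) (use \<tau>(1)[of "{x}" "{c}"] in \<open>simp add: approximate_trace_def\<close>)
  have one: "\<tau> 1 = 1"
    by (rule exact) (use \<tau>(1)[of "{}" "{}"] in \<open>simp add: approximate_trace_def\<close>)
  have bnd: "cmod (\<tau> x) \<le> norm x" for x
    by (rule field_le_epsilon) (use \<tau>(1)[of "{}" "{}"] in \<open>simp add: approximate_trace_def\<close>)
  have "Re (\<tau> q) \<le> Re (\<tau> p)"
    by (rule field_le_epsilon) (use \<tau>(2)[of "{}" "{}"] in simp)
  moreover have "tracial_state \<tau>"
    unfolding tracial_state_def
    using add scal comm one contractive_functional_nonneg[OF add scal bnd one] by blast
  ultimately show ?thesis using that bnd by blast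
qed

section \<open>Comparison of projections\<close>

lemma projectionD:
  assumes "projection (p::'a::unital_cstar_algebra)"
  shows "star p = p" "p * p = p" "p * (p * x) = p * x"
  using assms by (auto simp: projection_def mult.assoc[symmetric])

lemma isometry_source:
  fixes v :: "'a::unital_cstar_algebra"
  assumes "projection p" "star v * v = p"
  shows "v * p = v"
proof -
  have "star (v * p - v) * (v * p - v) = p * (star v * v) * p - p * (star v * v) - (star v * v) * p + star v * v"
    by (simp add: star_diff star_mult projectionD[OF assms(1)] algebra_simps)
  also have "\<dots> = 0" by (simp add: assms(2) projectionD[OF assms(1)])
  finally show ?thesis using star_mult_self_eq_0 by fastforce
qed

lemma range_projection:
  fixes v :: "'a::unital_cstar_algebra"
  assumes "projection p" "star v * v = p"
  shows "projection (v * star v)"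
  using isometry_source[OF assms]
  by (simp add: projection_def star_mult star_star) (metis assms(2) mult.assoc)

lemma range_projection_mult:
  fixes v :: "'a::unital_cstar_algebra"
  assumes "v * star v = r" "projection r"
  shows "r * v = v"
proof -
  have "star v * r = star v"
    using isometry_source[of r "star v"] assms by (simp add: star_star)
  then have "star (star v * r) = star (star v)" by simp
  then show ?thesis by (simp add: star_mult star_star projectionD[OF assms(2)])
qed

lemma corner_iff:
  fixes q :: "'a::unital_cstar_algebra"
  assumes "projection q"
  shows "r \<in> corner q \<longleftrightarrow> q * r = r \<and> r * q = r"
proof
  assume "q * r = r \<and> r * q = r"
  then show "r \<in> corner q" unfolding corner_def by (intro CollectI exI[of _ r]) simp
next
  assume "r \<in> corner q"
  then obtain x where "r = q * x * q" unfolding corner_def by blast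
  then show "q * r = r \<and> r * q = r"
    by (simp add: mult.assoc projectionD[OF assms])
qed

text \<open>The range projection of \<open>v\<close> is the subprojection of \<open>q\<close> that subequivalence asks for; working with \<open>v\<close> itself keeps
  it out of all later computations.\<close>

lemma proj_le_iff:
  fixes p q :: "'a::unital_cstar_algebra"
  assumes p: "projection p" and q: "projection q"
  shows "proj_le p q \<longleftrightarrow> (\<exists>v. star v * v = p \<and> q * v = v)"
proof
  assume "proj_le p q"
  then obtain r v where r: "r \<in> corner q" "projection r" "star v * v = p" "v * star v = r"
    by (auto simp: proj_le_def mvn_equiv_def)
  have "r * v = v" using r by (intro range_projection_mult) auto
  then have "q * v = v" using r(1) corner_iff[OF q] by (metis mult.assoc)
  then show "\<exists>v. star v * v = p \<and> q * v = v" using r by blast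
next
  assume "\<exists>v. star v * v = p \<and> q * v = v"
  then obtain v where v: "star v * v = p" "q * v = v" by blast
  have "star (q * v) = star v" by (simp add: v)
  then have "star v * q = star v" by (simp add: star_mult projectionD[OF q])
  then have "v * star v \<in> corner q"
    using v by (simp add: corner_iff[OF q] mult.assoc) (simp add: mult.assoc[symmetric])
  then show "proj_le p q"
    unfolding proj_le_def mvn_equiv_def using range_projection[OF p v(1)] v(1) by blast
qed

lemma proj_le_refl: "projection (p::'a::unital_cstar_algebra) \<Longrightarrow> proj_le p p"
  by (auto simp: proj_le_iff intro!: exI[of _ p] simp: projection_def)

lemma proj_le_trans:
  fixes p q r :: "'a::unital_cstar_algebra"
  assumes pqr: "projection p" "projection q" "projection r" and le: "proj_le p q" "proj_le q r"
  shows "proj_le p r"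
proof -
  obtain v w where v: "star v * v = p" "q * v = v" and w: "star w * w = q" "r * w = w"
    using le by (auto simp: proj_le_iff pqr)
  have "star (w * v) * (w * v) = star v * ((star w * w) * v)" by (simp add: star_mult mult.assoc)
  then have "star (w * v) * (w * v) = p" by (simp add: v w)
  moreover have "r * (w * v) = w * v" by (simp add: w mult.assoc[symmetric])
  ultimately show ?thesis using pqr by (auto simp: proj_le_iff)
qed

text \<open>The elements \<open>(1 + k)(1 - u)\<close> and \<open>(1 - u)(1 + k)\<close> are a right and a left inverse of \<open>1 + k\<close>, so they agree.\<close>

lemma inverse_sqrt_conjugate:
  fixes u :: "'a::unital_cstar_algebra"
  assumes "star u = u" "star k = k" "(1 + k) * (1 + k) * (1 - u) = 1"
  shows "(1 + k) * (1 - u) * (1 + k) = 1" "(1 - u) * (1 + k) * (1 + k) = 1"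
proof -
  have "star ((1 + k) * (1 + k) * (1 - u)) = 1" by (simp add: assms(3))
  then show 1: "(1 - u) * (1 + k) * (1 + k) = 1"
    by (simp add: star_mult star_add star_diff assms mult.assoc)
  have "(1 + k) * ((1 + k) * (1 - u)) = 1" using assms(3) by (simp only: mult.assoc)
  from left_right_inverse_unique[OF 1 this]
  have "(1 - u) * (1 + k) = (1 + k) * (1 - u)" .
  then have "(1 + k) * (1 - u) * (1 + k) = (1 - u) * (1 + k) * (1 + k)" by simp
  with 1 show "(1 + k) * (1 - u) * (1 + k) = 1" by simp
qed

text \<open>This is polar decomposition: \<open>star x * x = p (1 - u)\<close> with \<open>u\<close> small, and \<open>x\<close> times the inverse square root of
  \<open>1 - u\<close> is a partial isometry with source \<open>p\<close>.\<close>

lemma proj_le_if_almost_isometry: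
  fixes p q x :: "'a::unital_cstar_algebra"
  assumes p: "projection p" and q: "projection q"
    and x: "x * p = x" "q * x = x" "norm (p - star x * x) \<le> 3/4"
  shows "proj_le p q"
proof -
  define u where "u = p - star x * x"
  have "star (x * p) = star x" using x by simp
  then have px: "p * star x = star x" by (simp add: star_mult projectionD[OF p])
  have su: "star u = u" by (simp add: u_def star_diff star_mult star_star projectionD[OF p])
  have up: "u * p = u" by (simp add: u_def left_diff_distrib mult.assoc x projectionD[OF p])
  have pu: "p * u = u" by (simp add: u_def right_diff_distrib mult.assoc[symmetric] px projectionD[OF p])
  obtain k where k: "star k = k" "k * p = p * k" "(1 + k) * (1 + k) * (1 - u) = 1"
    using inverse_sqrt_near_one[OF cstar_subalgebra_UNIV, of u p] su up pu x(3) by (auto simp: u_def)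
  have "star (x * (1 + k)) * (x * (1 + k)) = (1 + k) * (star x * x) * (1 + k)"
    by (simp add: star_mult star_add k mult.assoc)
  also have "star x * x = p * (1 - u)" using pu by (simp add: right_diff_distrib) (simp add: u_def)
  also have "(1 + k) * (p * (1 - u)) * (1 + k) = ((1 + k) * p) * ((1 - u) * (1 + k))"
    by (simp only: mult.assoc)
  also have "(1 + k) * p = p * (1 + k)" by (simp add: algebra_simps k)
  also have "p * (1 + k) * ((1 - u) * (1 + k)) = p * ((1 + k) * (1 - u) * (1 + k))"
    by (simp only: mult.assoc)
  also have "\<dots> = p" using inverse_sqrt_conjugate(1)[OF su k(1,3)] by simp
  finally have "star (x * (1 + k)) * (x * (1 + k)) = p" .
  moreover have "q * (x * (1 + k)) = x * (1 + k)" by (simp add: x mult.assoc[symmetric])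
  ultimately show ?thesis using p q by (auto simp: proj_le_iff)
qed

lemma proj_le_if_close:
  fixes p q :: "'a::unital_cstar_algebra"
  assumes p: "projection p" and q: "projection q" and "norm (p - q) \<le> 3/4"
  shows "proj_le p q"
proof (rule proj_le_if_almost_isometry[OF p q, of "q * p"])
  have eq: "p - star (q * p) * (q * p) = p * (p - q) * p"
    by (simp add: star_mult algebra_simps projectionD[OF p] projectionD[OF q])
  show "norm (p - star (q * p) * (q * p)) \<le> 3/4"
    unfolding eq using norm_mult_le_right[OF norm_projection_le[OF p], of "p * (p - q)"]
      norm_mult_le_left[OF norm_projection_le[OF p], of "p - q"] assms(3) by linarith
qed (simp_all add: projectionD[OF p] projectionD[OF q] mult.assoc)

lemma unit_is_projection:
  fixes e :: "'a::unital_cstar_algebra"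
  assumes B: "cstar_subalgebra B" and e: "is_unit_of e B"
  shows "projection e"
proof -
  have eB: "e \<in> B" "star e \<in> B" using e cstar_subalgebraD(6)[OF B] by (auto simp: is_unit_of_def)
  then have 1: "e * star e = star e" "star e * e = star e" "e * e = e"
    using e by (auto simp: is_unit_of_def)
  have "star (e * star e) = star (star e)" using 1 by simp
  then have "e * star e = e" by (simp add: star_mult star_star)
  then show ?thesis using 1 by (simp add: projection_def)
qed

text \<open>The element \<open>w = 2x - e\<close> is almost a symmetry: \<open>w\<^sup>2 = e (1 - u)\<close> with \<open>u\<close> small.  Normalizing it to a
  symmetry \<open>s\<close> with \<open>s\<^sup>2 = e\<close> gives the projection \<open>(e + s) / 2\<close>.\<close>

lemma projection_near_almost_projection:
  fixes x :: "'a::unital_cstar_algebra"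
  assumes B: "cstar_subalgebra B" and e: "is_unit_of e B" and x: "x \<in> B" "star x = x"
    and nx: "norm x \<le> 2" and d: "norm (x * x - x) \<le> 3/16"
  obtains r where "r \<in> B" "projection r" "norm (r - x) \<le> 20 * norm (x * x - x)"
proof -
  note BD = cstar_subalgebraD[OF B]
  have pe: "projection e" by (rule unit_is_projection[OF B e])
  have eB: "e \<in> B" and ex: "\<And>y. y \<in> B \<Longrightarrow> e * y = y" "\<And>y. y \<in> B \<Longrightarrow> y * e = y"
    using e by (auto simp: is_unit_of_def)
  note ex' = ex[OF x(1)]
  define w u where "w = 2 *\<^sub>R x - e" and "u = (-4) *\<^sub>R (x * x - x)"
  have wB: "w \<in> B" and uB: "u \<in> B" unfolding w_def u_def by (intro BD x eB)+
  have sw: "star w = w" by (simp add: w_def star_diff star_scaleR x projectionD[OF pe])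
  have su: "star u = u" by (simp add: u_def star_diff star_scaleR star_mult x star_minus)
  have nu: "norm u = 4 * norm (x * x - x)" by (simp add: u_def)
  have xw: "x * w = w * x" by (simp add: w_def left_diff_distrib right_diff_distrib ex')
  have "x * x * w = x * (x * w)" by (rule mult.assoc)
  also have "\<dots> = x * (w * x)" by (simp only: xw)
  also have "\<dots> = (x * w) * x" by (simp only: mult.assoc)
  also have "\<dots> = w * x * x" by (simp only: xw)
  also have "\<dots> = w * (x * x)" by (simp only: mult.assoc)
  finally have uw: "u * w = w * u"
    by (simp add: u_def left_diff_distrib right_diff_distrib xw)
  have "w * w = 4 *\<^sub>R (x * x) - 2 *\<^sub>R x - (2 *\<^sub>R x - e)"
    by (simp add: w_def left_diff_distrib right_diff_distrib scaleR_diff_right ex' projectionD[OF pe])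
  also have "\<dots> = 4 *\<^sub>R (x * x) - (2 *\<^sub>R x + 2 *\<^sub>R x) + e" by simp
  also have "2 *\<^sub>R x + 2 *\<^sub>R x = 4 *\<^sub>R x" by (simp add: scaleR_add_left[symmetric])
  also have "4 *\<^sub>R (x * x) - 4 *\<^sub>R x + e = e - u" by (simp add: u_def scaleR_diff_right)
  also have "\<dots> = e * (1 - u)" by (simp add: right_diff_distrib ex uB)
  finally have ww: "w * w = e * (1 - u)" .
  obtain k where k: "k \<in> B" "star k = k" "k * w = w * k" "norm k \<le> 2 * norm u"
    "(1 + k) * (1 + k) * (1 - u) = 1"
    using inverse_sqrt_near_one[OF B uB su _ uw] nu d by auto
  define s where "s = w * (1 + k)"
  have sB: "s \<in> B" by (simp add: s_def distrib_left BD wB k)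
  have kw: "(1 + k) * w = w * (1 + k)" by (simp add: algebra_simps k)
  have ss: "star s = s" by (simp add: s_def star_mult star_add k sw kw)
  have "s * s = w * ((1 + k) * w) * (1 + k)" by (simp add: s_def mult.assoc)
  also have "\<dots> = (w * w) * ((1 + k) * (1 + k))" unfolding kw by (simp only: mult.assoc)
  also have "\<dots> = e * ((1 - u) * (1 + k) * (1 + k))" unfolding ww by (simp only: mult.assoc)
  also have "\<dots> = e" by (simp add: inverse_sqrt_conjugate(2)[OF su k(2,5)])
  finally have s2: "s * s = e" .
  define r where "r = (1/2) *\<^sub>R (e + s)"
  have "r * r = (1/4) *\<^sub>R (e * e + e * s + s * e + s * s)" by (simp add: r_def algebra_simps)
  also have "\<dots> = (1/4) *\<^sub>R ((e + s) + (e + s))" by (simp add: s2 ex eB sB add_ac)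
  also have "\<dots> = r" by (simp add: r_def scaleR_2[symmetric])
  finally have "projection r"
    using ss by (simp add: projection_def r_def star_scaleR star_add projectionD[OF pe])
  moreover have "r \<in> B" unfolding r_def by (intro BD eB sB)
  moreover have "norm (r - x) \<le> 20 * norm (x * x - x)"
  proof -
    have "r - x = (1/2) *\<^sub>R (w * k)"
      by (simp add: r_def s_def distrib_left) (simp add: w_def scaleR_diff_right scaleR_add_right)
    then have "norm (r - x) \<le> 1/2 * (norm w * norm k)" by (simp add: norm_mult_ineq)
    also have "norm w \<le> 5"
      using norm_triangle_ineq4[of "2 *\<^sub>R x" e] nx norm_projection_le[OF pe] by (simp add: w_def)
    then have "1/2 * (norm w * norm k) \<le> 1/2 * (5 * (2 * norm u))"
      using k(4) by (intro mult_left_mono mult_mono) auto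
    finally show ?thesis by (simp add: nu)
  qed
  ultimately show ?thesis using that by blast
qed

section \<open>Complex matrices\<close>

definition mat_trace :: "complex mat \<Rightarrow> complex" where
  "mat_trace A = (\<Sum>i<dim_row A. A $$ (i, i))"

lemma mat_adjoint_carrier: "A \<in> carrier_mat m n \<Longrightarrow> mat_adjoint (A :: complex mat) \<in> carrier_mat n m"
  unfolding mat_adjoint_def by (intro carrier_matI) auto

lemma mat_adjoint_index:
  assumes "A \<in> carrier_mat m n" "i < n" "j < m"
  shows "mat_adjoint (A :: complex mat) $$ (i, j) = cnj (A $$ (j, i))"
  using assms unfolding mat_adjoint_def by (simp add: mat_of_rows_index)

lemma mat_mult_index:
  assumes "A \<in> carrier_mat m n" "B \<in> carrier_mat n l" "i < m" "j < l"
  shows "(A * B) $$ (i, j) = (\<Sum>a<n. A $$ (i, a) * B $$ (a, j))"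
  using assms by (auto simp: scalar_prod_def lessThan_atLeast0 intro!: sum.cong)

lemma mat_trace_add:
  "A \<in> carrier_mat n n \<Longrightarrow> B \<in> carrier_mat n n \<Longrightarrow> mat_trace (A + B) = mat_trace A + mat_trace B"
  by (auto simp: mat_trace_def sum.distrib)

lemma mat_trace_diff:
  "A \<in> carrier_mat n n \<Longrightarrow> B \<in> carrier_mat n n \<Longrightarrow> mat_trace (A - B) = mat_trace A - mat_trace B"
  by (auto simp: mat_trace_def sum_subtractf)

lemma mat_trace_smult: "A \<in> carrier_mat n n \<Longrightarrow> mat_trace (c \<cdot>\<^sub>m A) = c * mat_trace A"
  by (auto simp: mat_trace_def sum_distrib_left)

lemma mat_trace_one: "mat_trace (1\<^sub>m n) = of_nat n"
  by (simp add: mat_trace_def)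

lemma mat_trace_mult_commute:
  assumes "A \<in> carrier_mat m n" "B \<in> carrier_mat n m"
  shows "mat_trace (A * B) = mat_trace (B * A)"
proof -
  have "mat_trace (A * B) = (\<Sum>i<m. \<Sum>a<n. A $$ (i, a) * B $$ (a, i))"
    using assms by (auto simp: mat_trace_def mat_mult_index[OF assms] simp del: index_mult_mat(1) intro!: sum.cong)
  also have "\<dots> = (\<Sum>a<n. \<Sum>i<m. B $$ (a, i) * A $$ (i, a))"
    by (subst sum.swap) (simp add: mult.commute)
  also have "\<dots> = mat_trace (B * A)"
    using assms by (auto simp: mat_trace_def mat_mult_index[OF assms(2,1)] simp del: index_mult_mat(1) intro!: sum.cong)
  finally show ?thesis .
qed

text \<open>The trace is the sum of the eigenvalues with multiplicity, which is read off from a Schur decomposition.\<close>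

lemma mat_trace_bound:
  fixes A :: "complex mat"
  assumes A: "A \<in> carrier_mat n n"
    and ev: "\<And>c v. v \<in> carrier_vec n \<Longrightarrow> v \<noteq> 0\<^sub>v n \<Longrightarrow> A *\<^sub>v v = c \<cdot>\<^sub>v v \<Longrightarrow> cmod c \<le> r"
  shows "cmod (mat_trace A) \<le> real n * r"
proof -
  obtain es where es: "char_poly A = (\<Prod>e\<leftarrow>es. [:- e, 1:])" "length es = n"
    using char_poly_factorized[OF A] by blast
  obtain B P Q where s: "schur_decomposition A es = (B, P, Q)"
    by (cases "schur_decomposition A es") auto
  from schur_decomposition[OF A es(1) s]
  have sim: "similar_mat_wit A B P Q" and diag: "diag_mat B = es" by auto
  from similar_mat_witD2[OF A sim] have c: "B \<in> carrier_mat n n" "P \<in> carrier_mat n n" "Q \<in> carrier_mat n n"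
    and QP: "Q * P = 1\<^sub>m n" and APBQ: "A = P * B * Q" by auto
  have "mat_trace A = mat_trace (Q * (P * B))"
    unfolding APBQ using c by (intro mat_trace_mult_commute[of _ n n]) auto
  also have "Q * (P * B) = (Q * P) * B" using c by (intro assoc_mult_mat[symmetric]) auto
  also have "\<dots> = B" using c by (simp add: QP)
  also have "mat_trace B = (\<Sum>i<n. es ! i)"
    unfolding mat_trace_def using c diag by (auto simp: diag_mat_def intro!: sum.cong)
  finally have "cmod (mat_trace A) \<le> (\<Sum>i<n. cmod (es ! i))" by (simp add: norm_sum)
  also have "\<dots> \<le> (\<Sum>i<n. r)"
  proof (rule sum_mono)
    fix i assume "i \<in> {..<n}"
    then have "es ! i \<in> set es" using es by auto
    then have "poly (char_poly A) (es ! i) = 0"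
      unfolding es(1) by (simp add: poly_prod_list prod_list_zero_iff)
    then have "eigenvalue A (es ! i)" using eigenvalue_root_char_poly[OF A] by simp
    then show "cmod (es ! i) \<le> r"
      unfolding eigenvalue_def eigenvector_def using A ev by auto
  qed
  finally show ?thesis by simp
qed

lemma continuous_on_det:
  fixes M :: "real \<Rightarrow> complex mat"
  assumes "\<And>t. t \<in> S \<Longrightarrow> M t \<in> carrier_mat n n"
    and "\<And>i j. i < n \<Longrightarrow> j < n \<Longrightarrow> continuous_on S (\<lambda>t. M t $$ (i, j))"
  shows "continuous_on S (\<lambda>t. det (M t))"
proof -
  have "continuous_on S (\<lambda>t. \<Sum>p\<in>{p. p permutes {0..<n}}. signof p * (\<Prod>i = 0..<n. M t $$ (i, p i)))"
    by (intro continuous_on_sum continuous_on_mult continuous_on_const continuous_on_prod assms(2))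
      (auto dest: permutes_in_image)
  then show ?thesis
    by (rule continuous_on_eq) (simp add: det_def'[OF assms(1)])
qed

lemma continuous_on_adj_mat:
  fixes M :: "real \<Rightarrow> complex mat"
  assumes M: "\<And>t. t \<in> S \<Longrightarrow> M t \<in> carrier_mat n n"
    and cont: "\<And>i j. i < n \<Longrightarrow> j < n \<Longrightarrow> continuous_on S (\<lambda>t. M t $$ (i, j))"
    and ij: "i < n" "j < n"
  shows "continuous_on S (\<lambda>t. adj_mat (M t) $$ (i, j))"
proof -
  have "continuous_on S (\<lambda>t. det (mat_delete (M t) j i))"
  proof (rule continuous_on_det[where n = "n - 1"])
    fix a b assume ab: "a < n - 1" "b < n - 1"
    then have "insert_index j a < n" "insert_index i b < n"
      by (auto simp: insert_index_def)
    from cont[OF this] show "continuous_on S (\<lambda>t. mat_delete (M t) j i $$ (a, b))"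
    proof (rule continuous_on_eq)
      fix t assume "t \<in> S"
      from carrier_matD[OF M[OF this]]
      show "M t $$ (insert_index j a, insert_index i b) = mat_delete (M t) j i $$ (a, b)"
        using ab by (simp add: mat_delete_def insert_index_def)
    qed
  qed (use M mat_delete_carrier in blast)
  then have "continuous_on S (\<lambda>t. (-1) ^ (j + i) * det (mat_delete (M t) j i))"
    by (intro continuous_intros)
  then show ?thesis
  proof (rule continuous_on_eq)
    fix t assume "t \<in> S"
    from carrier_matD[OF M[OF this]]
    show "(-1) ^ (j + i) * det (mat_delete (M t) j i) = adj_mat (M t) $$ (i, j)"
      using ij by (simp add: adj_mat_def cofactor_def)
  qed
qed

text \<open>A kernel vector \<open>v\<close> satisfies \<open>c v = A v\<close>.  Its entry of largest modulus \<open>x\<close> gives \<open>\<bar>c\<bar> x \<le> n m x\<close>.\<close>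

lemma det_shift_nonzero:
  fixes A :: "complex mat"
  assumes A: "A \<in> carrier_mat n n" and m: "\<And>i j. i < n \<Longrightarrow> j < n \<Longrightarrow> cmod (A $$ (i, j)) \<le> m"
    and c: "cmod c > real n * m"
  shows "det (c \<cdot>\<^sub>m 1\<^sub>m n - A) \<noteq> 0"
proof
  assume "det (c \<cdot>\<^sub>m 1\<^sub>m n - A) = 0"
  then obtain v where v: "v \<in> carrier_vec n" "v \<noteq> 0\<^sub>v n" "(c \<cdot>\<^sub>m 1\<^sub>m n - A) *\<^sub>v v = 0\<^sub>v n"
    using A by (subst (asm) det_0_iff_vec_prod_zero[of _ n]) auto
  have n0: "n \<noteq> 0" using v by (auto intro: eq_vecI)
  define x where "x = Max ((\<lambda>i. cmod (vec_index v i)) ` {..<n})"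
  have le: "cmod (vec_index v i) \<le> x" if "i < n" for i unfolding x_def using that by (intro Max_ge) auto
  have "x \<in> (\<lambda>i. cmod (vec_index v i)) ` {..<n}" unfolding x_def using n0 by (intro Max_in) auto
  then obtain i where i: "i < n" "x = cmod (vec_index v i)" by auto
  have "x > 0"
  proof (rule ccontr)
    assume "\<not> x > 0"
    then have "vec_index v j = 0" if "j < n" for j using le[OF that] by (metis norm_le_zero_iff order_trans not_less)
    then have "v = 0\<^sub>v n" using v(1) by (intro eq_vecI) auto
    with v(2) show False by simp
  qed
  have "((c \<cdot>\<^sub>m 1\<^sub>m n - A) *\<^sub>v v) $ i = (\<Sum>j<n. (if i = j then c else 0) * vec_index v j - A $$ (i, j) * vec_index v j)"
    using A v(1) i(1) by (auto simp: scalar_prod_def lessThan_atLeast0 left_diff_distrib intro!: sum.cong)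
  also have "\<dots> = c * vec_index v i - (\<Sum>j<n. A $$ (i, j) * vec_index v j)"
    using i(1) by (simp add: sum_subtractf if_distrib[of "\<lambda>z. z * _"] cong: if_cong)
  finally have "c * vec_index v i = (\<Sum>j<n. A $$ (i, j) * vec_index v j)" using v(3) i(1) by simp
  then have "cmod c * x \<le> (\<Sum>j<n. cmod (A $$ (i, j) * vec_index v j))"
    by (metis i(2) norm_mult norm_sum)
  also have "\<dots> \<le> (\<Sum>j<n. m * x)"
  proof (rule sum_mono)
    fix j assume "j \<in> {..<n}"
    then have j: "j < n" by simp
    show "cmod (A $$ (i, j) * vec_index v j) \<le> m * x"
      unfolding norm_mult using m[OF i(1) j] le[OF j]
      by (intro mult_mono) (auto intro: order_trans[OF norm_ge_zero])
  qed
  finally have "cmod c * x \<le> (real n * m) * x" by simp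
  then show False using c \<open>x > 0\<close> by (simp add: mult_le_cancel_right)
qed

definition matrix_unit :: "nat \<Rightarrow> nat \<Rightarrow> nat \<Rightarrow> complex mat" where
  "matrix_unit k i j = Matrix.mat k k (\<lambda>(a, b). if a = i \<and> b = j then 1 else 0)"

lemma matrix_unit_carrier [simp]: "matrix_unit k i j \<in> carrier_mat k k"
  by (simp add: matrix_unit_def)

lemma matrix_unit_mult_left:
  assumes "X \<in> carrier_mat k k" "j < k"
  shows "matrix_unit k i j * X = Matrix.mat k k (\<lambda>(a, b). if a = i then X $$ (j, b) else 0)"
proof (rule eq_matI)
  fix a b assume "a < dim_row (Matrix.mat k k (\<lambda>(a, b). if a = i then X $$ (j, b) else 0))"
    "b < dim_col (Matrix.mat k k (\<lambda>(a, b). if a = i then X $$ (j, b) else 0))"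
  then have ab: "a < k" "b < k" by auto
  then have "(matrix_unit k i j * X) $$ (a, b) = (\<Sum>c<k. (if a = i \<and> c = j then 1 else 0) * X $$ (c, b))"
    using assms(1) by (subst mat_mult_index[OF matrix_unit_carrier assms(1)]) (auto simp: matrix_unit_def)
  also have "\<dots> = (\<Sum>c<k. if c = j then (if a = i then X $$ (j, b) else 0) else 0)"
    by (intro sum.cong) auto
  also have "\<dots> = (if a = i then X $$ (j, b) else 0)" using assms(2) by simp
  finally show "(matrix_unit k i j * X) $$ (a, b) = Matrix.mat k k (\<lambda>(a, b). if a = i then X $$ (j, b) else 0) $$ (a, b)"
    using ab by simp
qed (use assms in \<open>auto simp: matrix_unit_def\<close>)

lemma matrix_unit_mult_right:
  assumes "X \<in> carrier_mat k k" "i < k"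
  shows "X * matrix_unit k i j = Matrix.mat k k (\<lambda>(a, b). if b = j then X $$ (a, i) else 0)"
proof (rule eq_matI)
  fix a b assume "a < dim_row (Matrix.mat k k (\<lambda>(a, b). if b = j then X $$ (a, i) else 0))"
    "b < dim_col (Matrix.mat k k (\<lambda>(a, b). if b = j then X $$ (a, i) else 0))"
  then have ab: "a < k" "b < k" by auto
  then have "(X * matrix_unit k i j) $$ (a, b) = (\<Sum>c<k. X $$ (a, c) * (if c = i \<and> b = j then 1 else 0))"
    using assms(1) by (subst mat_mult_index[OF assms(1) matrix_unit_carrier]) (auto simp: matrix_unit_def)
  also have "\<dots> = (\<Sum>c<k. if c = i then (if b = j then X $$ (a, i) else 0) else 0)"
    by (intro sum.cong) auto
  also have "\<dots> = (if b = j then X $$ (a, i) else 0)" using assms(2) by simp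
  finally show "(X * matrix_unit k i j) $$ (a, b) = Matrix.mat k k (\<lambda>(a, b). if b = j then X $$ (a, i) else 0) $$ (a, b)"
    using ab by simp
qed (use assms in \<open>auto simp: matrix_unit_def\<close>)

lemma mat_adjoint_matrix_unit:
  assumes "i < k" "j < k"
  shows "mat_adjoint (matrix_unit k i j) = matrix_unit k j i"
proof (rule eq_matI)
  show "mat_adjoint (matrix_unit k i j) $$ (a, b) = matrix_unit k j i $$ (a, b)"
    if "a < dim_row (matrix_unit k j i)" "b < dim_col (matrix_unit k j i)" for a b
    using that by (subst mat_adjoint_index[OF matrix_unit_carrier]) (auto simp: matrix_unit_def)
qed (use mat_adjoint_carrier[OF matrix_unit_carrier[of k i j]] in \<open>auto simp: matrix_unit_def\<close>)

lemma projection_matrix_diagonal: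
  assumes P: "P \<in> carrier_mat k k" "mat_adjoint P = P" "P * P = P" and j: "j < k"
  shows "P $$ (j, j) = of_real (\<Sum>a<k. (cmod (P $$ (a, j)))\<^sup>2)"
proof -
  have "P $$ (j, j) = (P * P) $$ (j, j)" by (simp add: P)
  also have "\<dots> = (\<Sum>a<k. P $$ (j, a) * P $$ (a, j))" by (rule mat_mult_index[OF P(1) P(1) j j])
  also have "\<dots> = (\<Sum>a<k. of_real ((cmod (P $$ (a, j)))\<^sup>2))"
  proof (rule sum.cong[OF refl])
    fix a assume "a \<in> {..<k}"
    then have "P $$ (j, a) = cnj (P $$ (a, j))" using mat_adjoint_index[OF P(1), of j a] P(2) j by simp
    then show "P $$ (j, a) * P $$ (a, j) = of_real ((cmod (P $$ (a, j)))\<^sup>2)"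
      unfolding complex_norm_square by (simp add: mult.commute)
  qed
  finally show ?thesis by simp
qed

lemma projection_matrix_trace:
  assumes P: "P \<in> carrier_mat k k" "mat_adjoint P = P" "P * P = P"
  shows "Re (mat_trace P) \<ge> 0" "Re (mat_trace P) = 0 \<Longrightarrow> P = 0\<^sub>m k k"
    "P \<noteq> 0\<^sub>m k k \<Longrightarrow> \<exists>j<k. \<exists>r>0. P $$ (j, j) = complex_of_real r"
proof -
  have tr: "Re (mat_trace P) = (\<Sum>j<k. \<Sum>a<k. (cmod (P $$ (a, j)))\<^sup>2)"
    unfolding mat_trace_def using P(1) by (auto simp: projection_matrix_diagonal[OF P] intro!: sum.cong)
  show "Re (mat_trace P) \<ge> 0" unfolding tr by (intro sum_nonneg) auto
  have zero: "P = 0\<^sub>m k k" if "\<And>j. j < k \<Longrightarrow> (\<Sum>a<k. (cmod (P $$ (a, j)))\<^sup>2) = 0"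
  proof (rule eq_matI)
    fix a j assume "a < dim_row (0\<^sub>m k k)" "j < dim_col (0\<^sub>m k k)"
    then have aj: "a < k" "j < k" by auto
    from that[OF aj(2)] have "(cmod (P $$ (a, j)))\<^sup>2 = 0" using aj(1)
      by (subst (asm) sum_nonneg_eq_0_iff) auto
    then show "P $$ (a, j) = 0\<^sub>m k k $$ (a, j)" using aj by simp
  qed (use P in auto)
  show "P = 0\<^sub>m k k" if "Re (mat_trace P) = 0"
  proof (rule zero)
    fix j assume "j < k"
    then show "(\<Sum>a<k. (cmod (P $$ (a, j)))\<^sup>2) = 0"
      using that unfolding tr by (subst (asm) sum_nonneg_eq_0_iff) (auto intro: sum_nonneg)
  qed
  show "\<exists>j<k. \<exists>r>0. P $$ (j, j) = complex_of_real r" if "P \<noteq> 0\<^sub>m k k"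
  proof -
    have "\<not> (\<forall>j<k. (\<Sum>a<k. (cmod (P $$ (a, j)))\<^sup>2) = 0)" using that by (metis zero)
    then obtain j where j: "j < k" "(\<Sum>a<k. (cmod (P $$ (a, j)))\<^sup>2) \<noteq> 0" by blast
    moreover have "(\<Sum>a<k. (cmod (P $$ (a, j)))\<^sup>2) \<ge> 0" by (intro sum_nonneg) auto
    ultimately have "(\<Sum>a<k. (cmod (P $$ (a, j)))\<^sup>2) > 0" by linarith
    then show ?thesis using projection_matrix_diagonal[OF P j(1)] j(1) by blast
  qed
qed

section \<open>Comparison in matrix algebras\<close>

text \<open>The algebra of matrices appears in a C*-algebra in two ways, as a block \<open>M\<^sub>k\<close> and as the constant functions in
  a block \<open>M\<^sub>k(C([0,1]))\<close>.\<close>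

definition matrix_embedding :: "nat \<Rightarrow> (complex mat \<Rightarrow> 'a::unital_cstar_algebra) \<Rightarrow> bool" where
  "matrix_embedding k \<psi> \<longleftrightarrow> inj_on \<psi> (carrier_mat k k) \<and>
     (\<forall>X\<in>carrier_mat k k. \<forall>Y\<in>carrier_mat k k. \<psi> (X + Y) = \<psi> X + \<psi> Y \<and> \<psi> (X * Y) = \<psi> X * \<psi> Y) \<and>
     (\<forall>c. \<forall>X\<in>carrier_mat k k. \<psi> (c \<cdot>\<^sub>m X) = c *\<^sub>C \<psi> X) \<and>
     (\<forall>X\<in>carrier_mat k k. \<psi> (mat_adjoint X) = star (\<psi> X))"

lemma matrix_embeddingD:
  assumes "matrix_embedding k \<psi>" "X \<in> carrier_mat k k"
  shows "Y \<in> carrier_mat k k \<Longrightarrow> \<psi> (X + Y) = \<psi> X + \<psi> Y"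
    "Y \<in> carrier_mat k k \<Longrightarrow> \<psi> (X * Y) = \<psi> X * \<psi> Y"
    "\<psi> (c \<cdot>\<^sub>m X) = c *\<^sub>C \<psi> X" "\<psi> (mat_adjoint X) = star (\<psi> X)"
    "Y \<in> carrier_mat k k \<Longrightarrow> \<psi> X = \<psi> Y \<Longrightarrow> X = Y"
    "Y \<in> carrier_mat k k \<Longrightarrow> \<psi> (X - Y) = \<psi> X - \<psi> Y"
proof -
  show 1: "Y \<in> carrier_mat k k \<Longrightarrow> \<psi> (X + Y) = \<psi> X + \<psi> Y"
    "Y \<in> carrier_mat k k \<Longrightarrow> \<psi> (X * Y) = \<psi> X * \<psi> Y"
    "\<psi> (c \<cdot>\<^sub>m X) = c *\<^sub>C \<psi> X" "\<psi> (mat_adjoint X) = star (\<psi> X)"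
    "Y \<in> carrier_mat k k \<Longrightarrow> \<psi> X = \<psi> Y \<Longrightarrow> X = Y" for c Y
    using assms by (auto simp: matrix_embedding_def inj_on_def)
  show "\<psi> (X - Y) = \<psi> X - \<psi> Y" if Y: "Y \<in> carrier_mat k k"
  proof -
    have "(X - Y) + Y = X" using assms(2) Y by (intro eq_matI) auto
    moreover have "\<psi> ((X - Y) + Y) = \<psi> (X - Y) + \<psi> Y"
      using assms(1) minus_carrier_mat[OF Y, of X] Y by (simp add: matrix_embedding_def)
    ultimately show ?thesis by simp
  qed
qed

lemma matrix_embedding_projection:
  assumes \<psi>: "matrix_embedding k \<psi>" and P: "P \<in> carrier_mat k k" "projection (\<psi> P)"
  shows "mat_adjoint P = P" "P * P = P"
proof -
  note D = matrix_embeddingD[OF \<psi>]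
  show "mat_adjoint P = P"
    by (rule D(5)[OF mat_adjoint_carrier[OF P(1)] P(1)]) (simp add: D(4)[OF P(1)] projectionD[OF P(2)])
  show "P * P = P"
    by (rule D(5)[OF _ P(1)]) (use P in \<open>simp_all add: D(2) projectionD\<close>)
qed

text \<open>A nonzero projection matrix has a nonzero diagonal entry.  If these are the entries \<open>j\<close> of \<open>P\<close> and \<open>i\<close> of
  \<open>Q\<close>, then \<open>Q E\<^sub>i\<^sub>j P\<close> is a multiple of a partial isometry of rank one from a part of \<open>P\<close> to a part of \<open>Q\<close>.\<close>

lemma rank_one_partial_isometry:
  fixes \<psi> :: "complex mat \<Rightarrow> 'a::unital_cstar_algebra"
  assumes \<psi>: "matrix_embedding k \<psi>"
    and P: "P \<in> carrier_mat k k" "projection (\<psi> P)" "P \<noteq> 0\<^sub>m k k"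
    and Q: "Q \<in> carrier_mat k k" "projection (\<psi> Q)" "Q \<noteq> 0\<^sub>m k k"
  obtains U where "U \<in> carrier_mat k k" "\<psi> U * \<psi> P = \<psi> U" "\<psi> Q * \<psi> U = \<psi> U"
    "\<psi> U * star (\<psi> U) * \<psi> U = \<psi> U" "mat_trace (mat_adjoint U * U) = 1"
proof -
  note D = matrix_embeddingD[OF \<psi>]
  note PP = matrix_embedding_projection[OF \<psi> P(1,2)]
  note QQ = matrix_embedding_projection[OF \<psi> Q(1,2)]
  obtain j d where j: "j < k" and d: "d > 0" "P $$ (j, j) = complex_of_real d"
    using projection_matrix_trace(3)[OF P(1) PP P(3)] by blast
  obtain i c where i: "i < k" and c: "c > 0" "Q $$ (i, i) = complex_of_real c"
    using projection_matrix_trace(3)[OF Q(1) QQ Q(3)] by blast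
  define E E' where "E = matrix_unit k i j" and "E' = matrix_unit k j i"
  have EC: "E \<in> carrier_mat k k" "E' \<in> carrier_mat k k" by (simp_all add: E_def E'_def)
  have adE: "mat_adjoint E = E'" unfolding E_def E'_def by (rule mat_adjoint_matrix_unit[OF i j])
  \<comment> \<open>A diagonal entry of a matrix is what a matrix unit compresses it to.\<close>
  have eq1: "E * (P * E') = of_real d \<cdot>\<^sub>m (E * E')"
  proof -
    have PE: "P * E' = Matrix.mat k k (\<lambda>(a, b). if b = i then P $$ (a, j) else 0)"
      unfolding E'_def by (rule matrix_unit_mult_right[OF P(1) j])
    have "P * E' \<in> carrier_mat k k" using P EC by auto
    from matrix_unit_mult_left[OF this j] matrix_unit_mult_left[OF EC(2) j]
    have EPE: "E * (P * E') = Matrix.mat k k (\<lambda>(a, b). if a = i then (P * E') $$ (j, b) else 0)"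
      and EE: "E * E' = Matrix.mat k k (\<lambda>(a, b). if a = i then E' $$ (j, b) else 0)"
      by (simp_all only: E_def)
    show ?thesis
      unfolding EPE EE unfolding PE unfolding E'_def matrix_unit_def by (rule eq_matI) (use i j d in auto)
  qed
  have eq2: "E' * (Q * E) = of_real c \<cdot>\<^sub>m matrix_unit k j j"
  proof -
    have QE: "Q * E = Matrix.mat k k (\<lambda>(a, b). if b = j then Q $$ (a, i) else 0)"
      unfolding E_def by (rule matrix_unit_mult_right[OF Q(1) i])
    have "Q * E \<in> carrier_mat k k" using Q EC by auto
    from matrix_unit_mult_left[OF this i]
    have EQE: "E' * (Q * E) = Matrix.mat k k (\<lambda>(a, b). if a = j then (Q * E) $$ (i, b) else 0)"
      by (simp only: E'_def)
    show ?thesis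
      unfolding EQE unfolding QE matrix_unit_def by (rule eq_matI) (use i j c in auto)
  qed
  have EJ: "E * matrix_unit k j j = E"
    unfolding E_def matrix_unit_mult_right[OF matrix_unit_carrier j] using j
    by (intro eq_matI) (auto simp: matrix_unit_def)
  define p q f where "p = \<psi> P" and "q = \<psi> Q" and "f = \<psi> E"
  have fs: "star (\<psi> E) = \<psi> E'" using D(4)[OF EC(1)] by (simp add: adE)
  have C: "P * E' \<in> carrier_mat k k" "E * E' \<in> carrier_mat k k" "Q * E \<in> carrier_mat k k"
    "E' * (Q * E) \<in> carrier_mat k k" "E * P \<in> carrier_mat k k" "Q * (E * P) \<in> carrier_mat k k"
    "E' * (Q * (E * P)) \<in> carrier_mat k k" "P * (E' * (Q * (E * P))) \<in> carrier_mat k k"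
    using P Q EC by auto
  have f1: "f * (p * star f) = of_real d *\<^sub>C (f * star f)"
    using arg_cong[OF eq1, of \<psi>] C P EC by (simp add: D fs p_def f_def)
  have f2: "f * (star f * (q * f)) = of_real c *\<^sub>C f"
    using arg_cong[OF eq2, of "\<lambda>X. \<psi> (E * X)"] C Q EC
      D(2)[OF EC(1) matrix_unit_carrier, of j j] EJ
    by (simp add: D fs q_def f_def mult_scaleC_right)
  note pD = projectionD[OF P(2), folded p_def] and qD = projectionD[OF Q(2), folded q_def]
  define g where "g = q * (f * p)"
  have gP: "g = \<psi> (Q * (E * P))" using C P Q EC by (simp add: g_def D p_def q_def f_def)
  have sg: "star g = p * (star f * q)" by (simp add: g_def star_mult pD qD mult.assoc)
  have "g * star g * g = q * (f * (p * star f)) * (q * (f * p))"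
    unfolding sg unfolding g_def by (simp only: mult.assoc pD qD)
  also have "\<dots> = of_real d *\<^sub>C (q * (f * (star f * (q * f))) * p)"
    unfolding f1 by (simp only: mult.assoc mult_scaleC_left mult_scaleC_right)
  also have "\<dots> = of_real (d * c) *\<^sub>C g"
    unfolding f2 g_def by (simp add: mult.assoc mult_scaleC_left mult_scaleC_right scaleC_scaleC)
  finally have ggg: "g * star g * g = of_real (d * c) *\<^sub>C g" .
  define s where "s = 1 / sqrt (d * c)"
  have s2: "s * s * (d * c) = 1" using d c by (simp add: s_def)
  define U where "U = of_real s \<cdot>\<^sub>m (Q * (E * P))"
  have UC: "U \<in> carrier_mat k k" using C by (simp add: U_def)
  have U: "\<psi> U = of_real s *\<^sub>C g" using C by (simp add: U_def D gP)
  have "\<psi> U * \<psi> P = \<psi> U"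
    by (simp add: U p_def[symmetric] mult_scaleC_left g_def mult.assoc pD)
  moreover have "\<psi> Q * \<psi> U = \<psi> U"
    by (simp add: U q_def[symmetric] mult_scaleC_right g_def qD)
  moreover have "\<psi> U * star (\<psi> U) * \<psi> U = \<psi> U"
  proof -
    have "\<psi> U * star (\<psi> U) * \<psi> U = of_real (s * s * s) *\<^sub>C (g * star g * g)"
      by (simp add: U star_scaleC mult_scaleC_left mult_scaleC_right scaleC_scaleC mult.assoc)
    also have "\<dots> = of_real (s * (s * s * (d * c))) *\<^sub>C g"
      unfolding ggg by (simp add: scaleC_scaleC mult_ac)
    finally show ?thesis unfolding s2 by (simp add: U)
  qed
  moreover have "mat_trace (mat_adjoint U * U) = 1"
  proof -
    let ?X = "E' * (Q * (E * P))"
    have "\<psi> (mat_adjoint U * U) = star (\<psi> U) * \<psi> U"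
      using D(2)[OF mat_adjoint_carrier[OF UC] UC] D(4)[OF UC] by simp
    also have "\<dots> = of_real (s * s) *\<^sub>C (star g * g)"
      by (simp add: U star_scaleC mult_scaleC_left mult_scaleC_right scaleC_scaleC)
    also have "star g * g = p * (star f * (q * (f * p)))"
      unfolding sg unfolding g_def by (simp only: mult.assoc qD)
    also have "\<dots> = \<psi> (P * ?X)" using C P Q EC by (simp add: D fs p_def q_def f_def)
    also have "of_real (s * s) *\<^sub>C \<psi> (P * ?X) = \<psi> (of_real (s * s) \<cdot>\<^sub>m (P * ?X))"
      using D(3)[OF C(8)] by simp
    finally have "\<psi> (mat_adjoint U * U) = \<psi> (of_real (s * s) \<cdot>\<^sub>m (P * ?X))" .
    then have "mat_adjoint U * U = of_real (s * s) \<cdot>\<^sub>m (P * ?X)"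
      using UC mat_adjoint_carrier[OF UC] C by (intro D(5)) auto
    then have "mat_trace (mat_adjoint U * U) = of_real (s * s) * mat_trace (P * ?X)"
      using C(8) by (simp add: mat_trace_smult)
    also have "mat_trace (P * ?X) = mat_trace (?X * P)" by (rule mat_trace_mult_commute[OF P(1) C(7)])
    also have "?X * P = E' * (Q * (E * (P * P)))" using P Q EC C by (simp add: assoc_mult_mat[of _ k k _ k _ k])
    also have "\<dots> = (E' * (Q * E)) * P" using P Q EC C PP by (simp add: assoc_mult_mat[of _ k k _ k _ k])
    also have "\<dots> = of_real c \<cdot>\<^sub>m (matrix_unit k j j * P)"
      unfolding eq2 by (rule mult_smult_assoc_mat[OF matrix_unit_carrier P(1)])
    also have "mat_trace \<dots> = of_real c * mat_trace (matrix_unit k j j * P)"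
      by (rule mat_trace_smult[OF mult_carrier_mat[OF matrix_unit_carrier P(1)]])
    also have "mat_trace (matrix_unit k j j * P) = (\<Sum>a<k. if a = j then P $$ (j, j) else 0)"
      unfolding matrix_unit_mult_left[OF P(1) j] mat_trace_def by (auto intro!: sum.cong)
    also have "\<dots> = of_real d" using j d by simp
    finally have "mat_trace (mat_adjoint U * U) = complex_of_real (s * s * (d * c))"
      by (simp add: mult_ac)
    then show ?thesis unfolding s2 by simp
  qed
  ultimately show ?thesis using that[OF UC] by blast
qed

text \<open>Splitting off a rank one partial isometry from \<open>P\<close> to \<open>Q\<close> lowers both traces by \<open>1\<close>, until \<open>P = 0\<close>.  The trace of
  \<open>P\<close> being the smaller one, \<open>Q\<close> is not exhausted earlier.\<close>

lemma matrix_comparison: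
  fixes \<psi> :: "complex mat \<Rightarrow> 'a::unital_cstar_algebra"
  assumes \<psi>: "matrix_embedding k \<psi>"
    and "P \<in> carrier_mat k k" "projection (\<psi> P)" "Q \<in> carrier_mat k k" "projection (\<psi> Q)"
    and "Re (mat_trace P) \<le> Re (mat_trace Q)"
  shows "\<exists>v. star v * v = \<psi> P \<and> \<psi> Q * v = v"
proof -
  note D = matrix_embeddingD[OF \<psi>]
  have zero: "\<psi> (0\<^sub>m k k) = 0"
    using D(1)[of "0\<^sub>m k k" "0\<^sub>m k k"] by simp
  have "\<exists>v. star v * v = \<psi> P \<and> \<psi> Q * v = v"
    if "Re (mat_trace P) \<le> real n" and P: "P \<in> carrier_mat k k" "projection (\<psi> P)"
      and Q: "Q \<in> carrier_mat k k" "projection (\<psi> Q)" and le: "Re (mat_trace P) \<le> Re (mat_trace Q)" for n P Q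
    using that
  proof (induction n arbitrary: P Q)
    case 0
    note tr = projection_matrix_trace[OF 0(2) matrix_embedding_projection[OF \<psi> 0(2,3)]]
    have "P = 0\<^sub>m k k" using tr(1,2) 0(1) by simp
    then show ?case using zero by (intro exI[of _ 0]) simp
  next
    case (Suc n)
    note P = Suc.prems(2,3) and Q = Suc.prems(4,5)
    note trP = projection_matrix_trace[OF P(1) matrix_embedding_projection[OF \<psi> P]]
    show ?case
    proof (cases "P = 0\<^sub>m k k")
      case True
      then show ?thesis using zero by (intro exI[of _ 0]) simp
    next
      case P0: False
      then have "Re (mat_trace P) > 0" using trP by force
      then have Q0: "Q \<noteq> 0\<^sub>m k k" using Suc.prems(6) by (auto simp: mat_trace_def)
      obtain U where U: "U \<in> carrier_mat k k" "\<psi> U * \<psi> P = \<psi> U" "\<psi> Q * \<psi> U = \<psi> U"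
        "\<psi> U * star (\<psi> U) * \<psi> U = \<psi> U" "mat_trace (mat_adjoint U * U) = 1"
        using rank_one_partial_isometry[OF \<psi> P P0 Q Q0] by blast
      define p q u where "p = \<psi> P" and "q = \<psi> Q" and "u = \<psi> U"
      note pD = projectionD[OF P(2), folded p_def] and qD = projectionD[OF Q(2), folded q_def]
      note u = U(2-4)[folded p_def q_def u_def]
      define R S where "R = mat_adjoint U * U" and "S = U * mat_adjoint U"
      have AC: "mat_adjoint U \<in> carrier_mat k k" by (rule mat_adjoint_carrier[OF U(1)])
      have RS: "R \<in> carrier_mat k k" "S \<in> carrier_mat k k" using U(1) AC by (auto simp: R_def S_def)
      have trRS: "mat_trace R = 1" "mat_trace S = 1"
        using U(5) mat_trace_mult_commute[OF AC U(1)] by (simp_all add: R_def S_def)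
      define r s where "r = star u * u" and "s = u * star u"
      have \<psi>RS: "\<psi> R = r" "\<psi> S = s"
        using U(1) AC by (simp_all add: R_def S_def r_def s_def u_def D)
      have us: "star u * u * star u = star u" "p * star u = star u" "star u * q = star u"
        using arg_cong[OF u(3), of star] arg_cong[OF u(1), of star] arg_cong[OF u(2), of star]
        by (simp_all add: star_mult star_star pD qD mult.assoc)
      have sa: "star r = r" "star s = s" by (simp_all add: r_def s_def star_mult star_star)
      have rr: "r * r = r" "p * r = r" "r * p = r"
        using u us by (simp_all add: r_def mult.assoc) (simp_all add: mult.assoc[symmetric])
      have ss: "s * s = s" "q * s = s" "s * q = s"
        using u us by (simp_all add: s_def mult.assoc) (simp_all add: mult.assoc[symmetric])
      have "projection (p - r)" "projection (q - s)"
        using rr ss sa by (simp_all add: projection_def star_diff pD qD left_diff_distrib right_diff_distrib)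
      then have pr: "projection (\<psi> (P - R))" "projection (\<psi> (Q - S))"
        using P Q RS by (simp_all add: D \<psi>RS p_def q_def)
      have "\<exists>v. star v * v = \<psi> (P - R) \<and> \<psi> (Q - S) * v = v"
      proof (rule Suc.IH)
        show "P - R \<in> carrier_mat k k" "Q - S \<in> carrier_mat k k" using P Q RS by auto
        show "Re (mat_trace (P - R)) \<le> real n" "Re (mat_trace (P - R)) \<le> Re (mat_trace (Q - S))"
          using Suc.prems(1,6) P Q RS trRS by (simp_all add: mat_trace_diff)
      qed (fact pr)+
      then obtain v where v: "star v * v = p - r" "(q - s) * v = v"
        using P Q RS by (auto simp: D \<psi>RS p_def q_def)
      have "star u * v = star u * ((q - s) * v)" by (simp add: v)
      also have "\<dots> = (star u * q - star u * u * star u) * v"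
        by (simp add: s_def left_diff_distrib right_diff_distrib mult.assoc)
      also have "\<dots> = 0" by (simp add: us)
      finally have uv: "star u * v = 0" .
      then have "star (star u * v) = 0" by simp
      then have vu: "star v * u = 0" by (simp add: star_mult star_star)
      have "q * ((q - s) * v) = (q - s) * v"
        by (simp add: mult.assoc[symmetric] right_diff_distrib qD ss)
      then have qv: "q * v = v" by (simp add: v)
      have "star (v + u) * (v + u) = p"
        by (simp add: star_add distrib_left distrib_right v uv vu r_def[symmetric])
      moreover have "q * (v + u) = v + u" by (simp add: distrib_left qv u)
      ultimately show ?thesis unfolding p_def q_def by blast
    qed
  qed
  from this[of P "nat \<lceil>Re (mat_trace P)\<rceil>" Q] assms show ?thesis by (simp add: real_nat_ceiling_ge)
qed

definition normalized_trace_on :: "'a::unital_cstar_algebra set \<Rightarrow> 'a \<Rightarrow> ('a \<Rightarrow> complex) \<Rightarrow> bool" where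
  "normalized_trace_on B b \<sigma> \<longleftrightarrow>
     (\<forall>x\<in>B. \<forall>y\<in>B. \<sigma> (x + y) = \<sigma> x + \<sigma> y \<and> \<sigma> (x * y) = \<sigma> (y * x)) \<and>
     (\<forall>c. \<forall>x\<in>B. \<sigma> (c *\<^sub>C x) = c * \<sigma> x) \<and> \<sigma> b = 1 \<and> (\<forall>x\<in>B. cmod (\<sigma> x) \<le> norm x)"

text \<open>The norm bound is a bound on the eigenvalues of \<open>\<pi> x\<close>.  If \<open>c\<close> were an eigenvalue beyond \<open>\<parallel>x\<parallel>\<close>, then \<open>h = x / c\<close>
  would have a Neumann series, and an eigenvector \<open>v\<close>, fixed by \<open>\<pi> h\<close>, would satisfy
  \<open>\<pi>(l) v = v + \<pi>(l) v\<close> for \<open>l = h + h\<^sup>2 + \<dots>\<close>.\<close>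

lemma normalized_trace_of_representation:
  fixes \<pi> :: "'a::unital_cstar_algebra \<Rightarrow> complex mat"
  assumes B: "cstar_subalgebra B" and k: "k \<ge> 1"
    and carrier: "\<And>x. x \<in> B \<Longrightarrow> \<pi> x \<in> carrier_mat k k"
    and add: "\<And>x y. x \<in> B \<Longrightarrow> y \<in> B \<Longrightarrow> \<pi> (x + y) = \<pi> x + \<pi> y"
    and mult: "\<And>x y. x \<in> B \<Longrightarrow> y \<in> B \<Longrightarrow> \<pi> (x * y) = \<pi> x * \<pi> y"
    and scal: "\<And>c x. x \<in> B \<Longrightarrow> \<pi> (c *\<^sub>C x) = c \<cdot>\<^sub>m \<pi> x"
    and one: "\<pi> b = 1\<^sub>m k"
  shows "normalized_trace_on B b (\<lambda>x. mat_trace (\<pi> x) / of_nat k)"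
proof -
  note BD = cstar_subalgebraD[OF B]
  have "cmod (mat_trace (\<pi> x)) \<le> real k * norm x" if x: "x \<in> B" for x
  proof (rule mat_trace_bound[OF carrier[OF x]])
    fix c and v :: "complex Matrix.vec" assume v: "v \<in> carrier_vec k" "v \<noteq> 0\<^sub>v k" "\<pi> x *\<^sub>v v = c \<cdot>\<^sub>v v"
    show "cmod c \<le> norm x"
    proof (rule ccontr)
      assume "\<not> cmod c \<le> norm x"
      then have c: "cmod c > norm x" "c \<noteq> 0" by auto
      define h where "h = (1/c) *\<^sub>C x"
      have h: "h \<in> B" "norm h < 1" using c x by (auto simp: h_def BD norm_scaleC norm_divide)
      obtain l where l: "l \<in> B" "(1 + l) * (1 - h) = 1" using neumann[OF B h] by blast
      then have lh: "l = h + l * h" by (simp add: algebra_simps)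
      have \<pi>l: "\<pi> l = \<pi> h + \<pi> l * \<pi> h"
        by (subst (1) lh) (simp add: add mult BD h(1) l(1))
      have "\<pi> h *\<^sub>v v = (1/c) \<cdot>\<^sub>v (\<pi> x *\<^sub>v v)"
        using carrier[OF x] v(1) by (intro eq_vecI) (auto simp: h_def scal[OF x])
      then have hv: "\<pi> h *\<^sub>v v = v"
        using v c by (simp add: smult_smult_assoc)
      note C = carrier[OF h(1)] carrier[OF l(1)]
      have "\<pi> l *\<^sub>v v = (\<pi> h + \<pi> l * \<pi> h) *\<^sub>v v" by (subst (1) \<pi>l) (rule refl)
      also have "\<dots> = \<pi> h *\<^sub>v v + \<pi> l *\<^sub>v (\<pi> h *\<^sub>v v)"
        using C v(1) by (simp add: add_mult_distrib_mat_vec[of _ k k] assoc_mult_mat_vec[of _ k k _ k])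
      finally have eq: "\<pi> l *\<^sub>v v = v + \<pi> l *\<^sub>v v" by (simp only: hv)
      have "v = 0\<^sub>v k"
      proof (rule eq_vecI)
        fix i assume "i < dim_vec (0\<^sub>v k)"
        then have i: "i < k" by simp
        have "vec_index (\<pi> l *\<^sub>v v) i = vec_index (v + \<pi> l *\<^sub>v v) i"
          by (rule arg_cong[OF eq])
        also have "\<dots> = vec_index v i + vec_index (\<pi> l *\<^sub>v v) i"
          using C i by (intro index_add_vec(1)) auto
        finally show "vec_index v i = vec_index (0\<^sub>v k) i" using i by simp
      qed (use v in auto)
      with v show False by simp
    qed
  qed
  then have "cmod (mat_trace (\<pi> x) / of_nat k) \<le> norm x" if "x \<in> B" for x
    using that k by (simp add: norm_divide field_simps)
  then show ?thesis
    unfolding normalized_trace_on_def using k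
    by (auto simp: add mult scal one mat_trace_one mat_trace_add[OF carrier carrier]
        mat_trace_smult[OF carrier] add_divide_distrib mat_trace_mult_commute[OF carrier carrier])
qed

section \<open>Interval matrix blocks\<close>

locale interval_block =
  fixes B :: "'a::unital_cstar_algebra set" and \<phi> :: "'a \<Rightarrow> real \<Rightarrow> complex mat" and k :: nat
  assumes subalg: "cstar_subalgebra B"
    and iso: "star_isomorphism \<phi> B (interval_matrices k)
        (\<lambda>f g. \<lambda>t\<in>{0..1}. f t + g t) (\<lambda>f g. \<lambda>t\<in>{0..1}. f t * g t)
        (\<lambda>c f. \<lambda>t\<in>{0..1}. c \<cdot>\<^sub>m f t) (\<lambda>f. \<lambda>t\<in>{0..1}. mat_adjoint (f t))"
begin

lemmas BD = cstar_subalgebraD[OF subalg]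

lemma
  assumes "x \<in> B" "t \<in> {0..1}"
  shows carrier: "\<phi> x t \<in> carrier_mat k k"
    and phi_add: "y \<in> B \<Longrightarrow> \<phi> (x + y) t = \<phi> x t + \<phi> y t"
    and phi_mult: "y \<in> B \<Longrightarrow> \<phi> (x * y) t = \<phi> x t * \<phi> y t"
    and phi_scaleC: "\<phi> (c *\<^sub>C x) t = c \<cdot>\<^sub>m \<phi> x t"
    and phi_star: "\<phi> (star x) t = mat_adjoint (\<phi> x t)"
proof -
  have "\<phi> x \<in> interval_matrices k"
    using iso assms(1) by (auto simp: star_isomorphism_def bij_betw_def)
  then show "\<phi> x t \<in> carrier_mat k k" using assms(2) by (auto simp: interval_matrices_def)
  show "y \<in> B \<Longrightarrow> \<phi> (x + y) t = \<phi> x t + \<phi> y t" "y \<in> B \<Longrightarrow> \<phi> (x * y) t = \<phi> x t * \<phi> y t"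
    "\<phi> (c *\<^sub>C x) t = c \<cdot>\<^sub>m \<phi> x t" "\<phi> (star x) t = mat_adjoint (\<phi> x t)"
    using iso assms by (simp_all add: star_isomorphism_def)
qed

lemma phi_continuous:
  assumes "x \<in> B" "i < k" "j < k"
  shows "continuous_on {0..1} (\<lambda>t. \<phi> x t $$ (i, j))"
proof -
  have "\<phi> x \<in> interval_matrices k"
    using iso assms(1) by (auto simp: star_isomorphism_def bij_betw_def)
  then show ?thesis using assms(2,3) by (auto simp: interval_matrices_def)
qed

lemma phi_eqI:
  assumes "x \<in> B" "y \<in> B" "\<And>t. t \<in> {0..1} \<Longrightarrow> \<phi> x t = \<phi> y t"
  shows "x = y"
proof -
  have inj: "inj_on \<phi> B" and "\<phi> x \<in> interval_matrices k" "\<phi> y \<in> interval_matrices k"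
    using iso assms(1,2) by (auto simp: star_isomorphism_def bij_betw_def)
  then have "\<phi> x \<in> {0..1} \<rightarrow>\<^sub>E carrier_mat k k" "\<phi> y \<in> {0..1} \<rightarrow>\<^sub>E carrier_mat k k"
    by (simp_all add: interval_matrices_def)
  from PiE_ext[OF this assms(3)] have "\<phi> x = \<phi> y" .
  then show ?thesis using inj assms(1,2) by (auto simp: inj_on_def)
qed

definition lift :: "(real \<Rightarrow> complex mat) \<Rightarrow> 'a" where
  "lift F = inv_into B \<phi> (restrict F {0..1})"

lemma
  assumes "\<And>t. t \<in> {0..1} \<Longrightarrow> F t \<in> carrier_mat k k"
    and "\<And>i j. i < k \<Longrightarrow> j < k \<Longrightarrow> continuous_on {0..1} (\<lambda>t. F t $$ (i, j))"
  shows lift_in: "lift F \<in> B" and phi_lift: "t \<in> {0..1} \<Longrightarrow> \<phi> (lift F) t = F t"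
proof -
  have "continuous_on {0..1} (\<lambda>t. restrict F {0..1} t $$ (i, j))" if "i < k" "j < k" for i j
    by (rule continuous_on_eq[OF assms(2)[OF that]]) simp
  then have "restrict F {0..1} \<in> interval_matrices k" using assms(1) by (auto simp: interval_matrices_def)
  then have im: "restrict F {0..1} \<in> \<phi> ` B" using iso by (simp add: star_isomorphism_def bij_betw_def)
  then show "lift F \<in> B" by (simp add: lift_def inv_into_into)
  show "\<phi> (lift F) t = F t" if "t \<in> {0..1}"
    using that by (simp add: lift_def f_inv_into_f[OF im])
qed

text \<open>This is the continuity of the inverse of \<open>\<phi>\<close>.  By the formula for the norm as spectral radius it is enough to
  invert \<open>h - c\<close> when \<open>\<bar>c\<bar> > k m\<close>.  The matrices \<open>c - \<phi> h t\<close> are then invertible, their inverses \<open>R t\<close> depend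
  continuously on \<open>t\<close> by Cramer's rule, and \<open>G = c R - 1\<close>, being \<open>\<phi>(h) R\<close>, is the image of the \<open>g\<close> in \<open>B\<close> with
  \<open>(c - h) (1 + g) = c\<close>.\<close>

lemma norm_le_entries:
  assumes h: "h \<in> B" "star h = h" and m: "m \<ge> 0"
    and bound: "\<And>t i j. t \<in> {0..1} \<Longrightarrow> i < k \<Longrightarrow> j < k \<Longrightarrow> cmod (\<phi> h t $$ (i, j)) \<le> m"
  shows "norm h \<le> real k * m"
proof (rule norm_le_spectral_radius[OF h(2)])
  show "real k * m \<ge> 0" using m by simp
  fix c assume c: "cmod c > real k * m"
  have "real k * m \<ge> 0" using m by simp
  with c have c0: "c \<noteq> 0" by auto
  define M where "M t = c \<cdot>\<^sub>m 1\<^sub>m k - \<phi> h t" for t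
  define R where "R t = (1 / det (M t)) \<cdot>\<^sub>m adj_mat (M t)" for t
  define G where "G t = c \<cdot>\<^sub>m R t - 1\<^sub>m k" for t
  have MC: "M t \<in> carrier_mat k k" if "t \<in> {0..1}" for t
    unfolding M_def by (rule minus_carrier_mat[OF carrier[OF h(1) that]])
  have det: "det (M t) \<noteq> 0" if t: "t \<in> {0..1}" for t
    unfolding M_def by (rule det_shift_nonzero[OF carrier[OF h(1) t] bound[OF t] c])
  have RC: "R t \<in> carrier_mat k k" if "t \<in> {0..1}" for t
    unfolding R_def using adj_mat(1)[OF MC[OF that]] by simp
  have GC: "G t \<in> carrier_mat k k" if "t \<in> {0..1}" for t
    unfolding G_def by (rule minus_carrier_mat[OF one_carrier_mat])
  have Mcont: "continuous_on {0..1} (\<lambda>t. M t $$ (i, j))" if ij: "i < k" "j < k" for i j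
  proof -
    have "continuous_on {0..1} (\<lambda>t. c * (if i = j then 1 else 0) - \<phi> h t $$ (i, j))"
      by (intro continuous_intros phi_continuous h ij)
    then show ?thesis
    proof (rule continuous_on_eq)
      fix t :: real assume "t \<in> {0..1}"
      from carrier_matD[OF carrier[OF h(1) this]]
      show "c * (if i = j then 1 else 0) - \<phi> h t $$ (i, j) = M t $$ (i, j)"
        using ij by (simp add: M_def)
    qed
  qed
  have Gcont: "continuous_on {0..1} (\<lambda>t. G t $$ (i, j))" if ij: "i < k" "j < k" for i j
  proof -
    have "continuous_on {0..1} (\<lambda>t. c * ((1 / det (M t)) * adj_mat (M t) $$ (i, j)) - (if i = j then 1 else 0))"
      using det by (intro continuous_intros continuous_on_det[OF MC Mcont] continuous_on_adj_mat[OF MC Mcont] ij) auto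
    then show ?thesis
    proof (rule continuous_on_eq)
      fix t :: real assume "t \<in> {0..1}"
      from carrier_matD[OF adj_mat(1)[OF MC[OF this]]]
      show "c * ((1 / det (M t)) * adj_mat (M t) $$ (i, j)) - (if i = j then 1 else 0) = G t $$ (i, j)"
        using ij by (simp add: G_def R_def)
    qed
  qed
  define g where "g = lift G"
  have g: "g \<in> B" "\<And>t. t \<in> {0..1} \<Longrightarrow> \<phi> g t = G t"
    unfolding g_def by (rule lift_in[OF GC Gcont], assumption+) (rule phi_lift[OF GC Gcont], assumption+)
  have key: "\<phi> h t * G t + \<phi> h t = c \<cdot>\<^sub>m G t \<and> G t * \<phi> h t + \<phi> h t = c \<cdot>\<^sub>m G t" if t: "t \<in> {0..1}" for t
  proof -
    note C = carrier[OF h(1) t] MC[OF t] RC[OF t] GC[OF t] adj_mat(1)[OF MC[OF t]]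
    have "M t * R t = (1 / det (M t)) \<cdot>\<^sub>m (M t * adj_mat (M t))"
      unfolding R_def using C by (intro mult_smult_distrib) auto
    then have MR: "M t * R t = 1\<^sub>m k"
      unfolding adj_mat(2)[OF C(2)] using det[OF t] by (intro eq_matI) auto
    have "R t * M t = (1 / det (M t)) \<cdot>\<^sub>m (adj_mat (M t) * M t)"
      unfolding R_def using C by (intro mult_smult_assoc_mat) auto
    then have RM: "R t * M t = 1\<^sub>m k"
      unfolding adj_mat(3)[OF C(2)] using det[OF t] by (intro eq_matI) auto
    have F: "\<phi> h t = c \<cdot>\<^sub>m 1\<^sub>m k - M t" using C unfolding M_def by (intro eq_matI) auto
    have "\<phi> h t * R t = (c \<cdot>\<^sub>m 1\<^sub>m k) * R t - M t * R t"
      unfolding F using C by (intro minus_mult_distrib_mat) auto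
    also have "\<dots> = G t" unfolding MR G_def using C by (simp add: mult_smult_assoc_mat[of _ k k _ k])
    finally have FR: "\<phi> h t * R t = G t" .
    have "R t * \<phi> h t = R t * (c \<cdot>\<^sub>m 1\<^sub>m k) - R t * M t"
      unfolding F using C by (intro mult_minus_distrib_mat) auto
    also have "\<dots> = G t" unfolding RM G_def using C by (simp add: mult_smult_distrib[of _ k k _ k])
    finally have RF: "R t * \<phi> h t = G t" .
    have "\<phi> h t * G t = \<phi> h t * (c \<cdot>\<^sub>m R t) - \<phi> h t * 1\<^sub>m k"
      unfolding G_def using C by (intro mult_minus_distrib_mat) auto
    also have "\<dots> = c \<cdot>\<^sub>m G t - \<phi> h t" using C by (simp add: mult_smult_distrib[of _ k k _ k] FR)
    finally have 1: "\<phi> h t * G t = c \<cdot>\<^sub>m G t - \<phi> h t" .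
    have "G t * \<phi> h t = (c \<cdot>\<^sub>m R t) * \<phi> h t - 1\<^sub>m k * \<phi> h t"
      unfolding G_def using C by (intro minus_mult_distrib_mat) auto
    also have "\<dots> = c \<cdot>\<^sub>m G t - \<phi> h t" using C by (simp add: mult_smult_assoc_mat[of _ k k _ k] RF)
    finally have 2: "G t * \<phi> h t = c \<cdot>\<^sub>m G t - \<phi> h t" .
    show ?thesis unfolding 1 2 using C by (intro conjI eq_matI) auto
  qed
  have "h * g + h = c *\<^sub>C g" "g * h + h = c *\<^sub>C g"
    by (rule phi_eqI; use h g key in \<open>simp add: BD phi_add phi_mult phi_scaleC\<close>)+
  then have hg: "(h - c *\<^sub>C 1) * (1 + g) = - (c *\<^sub>C 1)" "(1 + g) * (h - c *\<^sub>C 1) = - (c *\<^sub>C 1)"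
    by (simp_all add: algebra_simps mult_scaleC_left mult_scaleC_right scaleC_add_right)
  have inv: "(- (1/c)) *\<^sub>C (- (c *\<^sub>C 1)) = (1::'a)"
    using c0 by (simp add: scaleC_minus_right scaleC_minus_left scaleC_scaleC)
  show "\<exists>y. (h - c *\<^sub>C 1) * y = 1 \<and> y * (h - c *\<^sub>C 1) = 1"
    by (intro exI[of _ "(- (1/c)) *\<^sub>C (1 + g)"]) (simp only: mult_scaleC_left mult_scaleC_right hg inv simp_thms)
qed

lemma matrix_embedding_constants: "matrix_embedding k (\<lambda>X. lift (\<lambda>t. X))"
proof -
  have c1: "lift (\<lambda>t. X) \<in> B" if "X \<in> carrier_mat k k" for X
    by (rule lift_in) (rule that continuous_on_const)+
  have c2: "\<phi> (lift (\<lambda>t. X)) t = X" if "X \<in> carrier_mat k k" "t \<in> {0..1}" for X t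
    by (fact phi_lift[where F = "\<lambda>t. X" and t = t, OF that(1) continuous_on_const that(2)])
  have "inj_on (\<lambda>X. lift (\<lambda>t. X)) (carrier_mat k k)"
  proof (rule inj_onI)
    fix X Y assume X: "X \<in> carrier_mat k k" and Y: "Y \<in> carrier_mat k k"
      and eq: "lift (\<lambda>t. X) = lift (\<lambda>t. Y)"
    have "0 \<in> {0..1::real}" by simp
    then have "\<phi> (lift (\<lambda>t. X)) 0 = X" "\<phi> (lift (\<lambda>t. Y)) 0 = Y" by (fact c2[OF X] c2[OF Y])+
    with eq show "X = Y" by metis
  qed
  moreover have "lift (\<lambda>t. X + Y) = lift (\<lambda>t. X) + lift (\<lambda>t. Y) \<and> lift (\<lambda>t. X * Y) = lift (\<lambda>t. X) * lift (\<lambda>t. Y)"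
    if "X \<in> carrier_mat k k" "Y \<in> carrier_mat k k" for X Y
    using that by (intro conjI phi_eqI) (simp_all add: c1 c2 BD phi_add phi_mult)
  moreover have "lift (\<lambda>t. z \<cdot>\<^sub>m X) = z *\<^sub>C lift (\<lambda>t. X)" if "X \<in> carrier_mat k k" for X z
    using that by (intro phi_eqI) (simp_all add: c1 c2 BD phi_scaleC)
  moreover have "lift (\<lambda>t. mat_adjoint X) = star (lift (\<lambda>t. X))" if "X \<in> carrier_mat k k" for X
    using that by (intro phi_eqI) (simp_all add: c1 c2 BD phi_star mat_adjoint_carrier)
  ultimately show ?thesis unfolding matrix_embedding_def by blast
qed

context
  fixes y assumes y: "y \<in> B" "projection y"
begin

text \<open>The path \<open>s \<mapsto> P(s \<cdot>)\<close> joins the constant function \<open>P 0\<close> to \<open>P = \<phi> y\<close> through projections.\<close>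

definition shrink :: "real \<Rightarrow> 'a" where "shrink s = lift (\<lambda>t. \<phi> y (s * t))"

lemma in_unit_interval: "s \<in> {0..1} \<Longrightarrow> t \<in> {0..1} \<Longrightarrow> s * t \<in> {0..1::real}"
  by (auto intro: mult_le_one)

lemma
  assumes s: "s \<in> {0..1}"
  shows shrink_in: "shrink s \<in> B" and phi_shrink: "t \<in> {0..1} \<Longrightarrow> \<phi> (shrink s) t = \<phi> y (s * t)"
proof -
  have c: "\<phi> y (s * t) \<in> carrier_mat k k" if "t \<in> {0..1}" for t
    by (rule carrier[OF y(1) in_unit_interval[OF s that]])
  have d: "continuous_on {0..1} (\<lambda>t. \<phi> y (s * t) $$ (i, j))" if "i < k" "j < k" for i j
    by (rule continuous_on_compose2[OF phi_continuous[OF y(1) that]])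
      (use in_unit_interval[OF s] in \<open>auto intro!: continuous_intros\<close>)
  show "shrink s \<in> B" unfolding shrink_def by (rule lift_in[OF c d])
  show "t \<in> {0..1} \<Longrightarrow> \<phi> (shrink s) t = \<phi> y (s * t)" unfolding shrink_def by (rule phi_lift[OF c d])
qed

lemma projection_shrink:
  assumes s: "s \<in> {0..1}"
  shows "projection (shrink s)"
proof -
  have "shrink s * shrink s = shrink s"
  proof (rule phi_eqI)
    fix t :: real assume t: "t \<in> {0..1}"
    have "\<phi> y (s * t) * \<phi> y (s * t) = \<phi> y (s * t)"
      using phi_mult[OF y(1) in_unit_interval[OF s t] y(1)] projectionD(2)[OF y(2)] by simp
    then show "\<phi> (shrink s * shrink s) t = \<phi> (shrink s) t"
      using s t by (simp add: phi_mult shrink_in phi_shrink)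
  qed (use s in \<open>simp_all add: BD shrink_in\<close>)
  moreover have "star (shrink s) = shrink s"
  proof (rule phi_eqI)
    fix t :: real assume t: "t \<in> {0..1}"
    have "mat_adjoint (\<phi> y (s * t)) = \<phi> y (s * t)"
      using phi_star[OF y(1) in_unit_interval[OF s t]] projectionD(1)[OF y(2)] by simp
    then show "\<phi> (star (shrink s)) t = \<phi> (shrink s) t"
      using s t by (simp add: phi_star shrink_in phi_shrink)
  qed (use s in \<open>simp_all add: BD shrink_in\<close>)
  ultimately show ?thesis by (simp add: projection_def)
qed

text \<open>Uniform continuity of the finitely many entries, with the tolerance \<open>m\<close> chosen so that \<open>k m \<le> 3/4\<close>.\<close>

lemma shrink_uniformly_continuous:
  "\<exists>\<delta>>0. \<forall>s\<in>{0..1}. \<forall>s'\<in>{0..1}. \<bar>s - s'\<bar> < \<delta> \<longrightarrow> norm (shrink s - shrink s') \<le> 3/4"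
proof -
  define m where "m = 1 / (2 * (real k + 1))"
  have m: "m > 0" "real k * m \<le> 3/4" by (simp_all add: m_def field_simps)
  have "\<forall>a\<in>{..<k} \<times> {..<k}. \<exists>d>0. \<forall>x\<in>{0..1}. \<forall>x'\<in>{0..1}. \<bar>x' - x\<bar> < d \<longrightarrow>
      cmod (\<phi> y x' $$ a - \<phi> y x $$ a) < m"
  proof
    fix a assume "a \<in> {..<k} \<times> {..<k}"
    then obtain i j where a: "a = (i, j)" "i < k" "j < k" by auto
    have "uniformly_continuous_on {0..1} (\<lambda>t. \<phi> y t $$ (i, j))"
      by (rule compact_uniformly_continuous[OF phi_continuous[OF y(1) a(2,3)]]) simp
    then show "\<exists>d>0. \<forall>x\<in>{0..1}. \<forall>x'\<in>{0..1}. \<bar>x' - x\<bar> < d \<longrightarrow> cmod (\<phi> y x' $$ a - \<phi> y x $$ a) < m"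
      using m(1) unfolding uniformly_continuous_on_def a dist_norm by auto
  qed
  then obtain d where d: "\<And>a. a \<in> {..<k} \<times> {..<k} \<Longrightarrow> d a > 0 \<and> (\<forall>x\<in>{0..1}. \<forall>x'\<in>{0..1}. \<bar>x' - x\<bar> < d a \<longrightarrow>
      cmod (\<phi> y x' $$ a - \<phi> y x $$ a) < m)"
    by metis
  define \<delta> where "\<delta> = Min (insert 1 (d ` ({..<k} \<times> {..<k})))"
  have "\<delta> > 0" using d by (auto simp: \<delta>_def)
  moreover have "norm (shrink s - shrink s') \<le> 3/4" if s: "s \<in> {0..1}" "s' \<in> {0..1}" "\<bar>s - s'\<bar> < \<delta>" for s s'
  proof -
    have "norm (shrink s - shrink s') \<le> real k * m"
    proof (rule norm_le_entries)
      show "shrink s - shrink s' \<in> B" by (intro BD shrink_in s)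
      show "star (shrink s - shrink s') = shrink s - shrink s'"
        using projection_shrink s by (simp add: star_diff projectionD)
      fix t :: real and i j assume t: "t \<in> {0..1}" and ij: "i < k" "j < k"
      have eq: "shrink s - shrink s' = shrink s + (-1) *\<^sub>C shrink s'" by (simp add: scaleC_minus_left)
      have "\<phi> (shrink s - shrink s') t $$ (i, j) = \<phi> y (s * t) $$ (i, j) - \<phi> y (s' * t) $$ (i, j)"
        unfolding eq using s t ij carrier_matD[OF carrier[OF y(1) in_unit_interval[OF s(1) t]]]
          carrier_matD[OF carrier[OF y(1) in_unit_interval[OF s(2) t]]]
        by (simp add: phi_add phi_scaleC shrink_in phi_shrink BD)
      moreover have "\<bar>s * t - s' * t\<bar> < d (i, j)"
      proof -
        have "\<bar>s * t - s' * t\<bar> = \<bar>s - s'\<bar> * t"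
          using t by (simp add: left_diff_distrib[symmetric] abs_mult)
        also have "\<dots> \<le> \<bar>s - s'\<bar>" using t by (simp add: mult_left_le)
        also have "\<dots> < \<delta>" by (rule s(3))
        also have "\<delta> \<le> d (i, j)" unfolding \<delta>_def using ij by (intro Min_le) auto
        finally show ?thesis .
      qed
      ultimately show "cmod (\<phi> (shrink s - shrink s') t $$ (i, j)) \<le> m"
        using d[of "(i, j)"] ij in_unit_interval[OF s(1) t] in_unit_interval[OF s(2) t] by fastforce
    qed (use m in simp)
    with m show ?thesis by simp
  qed
  ultimately show ?thesis by blast
qed

text \<open>The path is cut into steps so small that consecutive projections are close, hence subequivalent to each
  other.\<close>

lemma proj_le_constant:
  "proj_le y (lift (\<lambda>t. \<phi> y 0))" "proj_le (lift (\<lambda>t. \<phi> y 0)) y" "projection (lift (\<lambda>t. \<phi> y 0))"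
proof -
  obtain \<delta> where \<delta>: "\<delta> > 0" "\<And>s s'. s \<in> {0..1} \<Longrightarrow> s' \<in> {0..1} \<Longrightarrow> \<bar>s - s'\<bar> < \<delta> \<Longrightarrow>
      norm (shrink s - shrink s') \<le> 3/4"
    using shrink_uniformly_continuous by blast
  obtain N where N: "N \<noteq> 0" "inverse (real N) < \<delta>" using \<delta>(1) real_arch_inverse by auto
  define x where "x j = shrink (real j / real N)" for j
  have px: "projection (x j)" if "j \<le> N" for j
    unfolding x_def using that N by (intro projection_shrink) auto
  have close: "norm (x j - x (Suc j)) \<le> 3/4" "norm (x (Suc j) - x j) \<le> 3/4" if "Suc j \<le> N" for j
  proof -
    have "\<bar>real j / real N - real (Suc j) / real N\<bar> = inverse (real N)"
      by (simp add: add_divide_distrib inverse_eq_divide)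
    then show "norm (x j - x (Suc j)) \<le> 3/4"
      unfolding x_def using that N by (intro \<delta>) auto
    then show "norm (x (Suc j) - x j) \<le> 3/4" by (simp add: norm_minus_commute)
  qed
  have "proj_le (x j) (x 0) \<and> proj_le (x 0) (x j)" if "j \<le> N" for j
    using that
  proof (induction j)
    case 0
    then show ?case using px by (simp add: proj_le_refl)
  next
    case (Suc j)
    then have IH: "proj_le (x j) (x 0)" "proj_le (x 0) (x j)" by auto
    have p: "projection (x j)" "projection (x (Suc j))" "projection (x 0)" using Suc.prems by (auto intro: px)
    have "proj_le (x j) (x (Suc j))" "proj_le (x (Suc j)) (x j)"
      using close[OF Suc.prems] p by (auto intro: proj_le_if_close)
    then show ?case using IH p proj_le_trans by blast
  qed
  from this[of N] have le: "proj_le (x N) (x 0)" "proj_le (x 0) (x N)" by auto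
  have "x N = y"
    using N by (intro phi_eqI) (auto simp: x_def shrink_in phi_shrink y)
  moreover have x0: "x 0 = lift (\<lambda>t. \<phi> y 0)" by (simp add: x_def shrink_def)
  ultimately show "proj_le y (lift (\<lambda>t. \<phi> y 0))" "proj_le (lift (\<lambda>t. \<phi> y 0)) y" using le by auto
  show "projection (lift (\<lambda>t. \<phi> y 0))" using px[of 0] x0 by simp
qed

end

lemma interval_block_comparison:
  assumes y: "y \<in> B" "projection y" and z: "z \<in> B" "projection z"
    and le: "Re (mat_trace (\<phi> y 0)) \<le> Re (mat_trace (\<phi> z 0))"
  shows "proj_le y z"
proof -
  have "\<phi> y 0 \<in> carrier_mat k k" "\<phi> z 0 \<in> carrier_mat k k" using carrier y z by auto
  then have "proj_le (lift (\<lambda>t. \<phi> y 0)) (lift (\<lambda>t. \<phi> z 0))"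
    using matrix_comparison[OF matrix_embedding_constants _ _ _ _ le] proj_le_constant(3)[OF y] proj_le_constant(3)[OF z]
    by (simp add: proj_le_iff)
  then show ?thesis
    using proj_le_constant[OF y] proj_le_constant[OF z] proj_le_trans y(2) z(2) by blast
qed

end

section \<open>Traces and comparison in interval algebras\<close>

text \<open>In a block of functions the trace at the point \<open>0\<close> suffices, since every projection there is equivalent to its value
  at \<open>0\<close>.\<close>

lemma building_block_comparison:
  fixes B :: "'a::unital_cstar_algebra set"
  assumes B: "cstar_subalgebra B" and b: "is_unit_of b B" and k: "k \<ge> 1"
    and iso: "iso_matrices B k \<or> iso_interval_matrices B k"
  obtains \<sigma> where "normalized_trace_on B b \<sigma>"
    "\<And>y z. y \<in> B \<Longrightarrow> z \<in> B \<Longrightarrow> projection y \<Longrightarrow> projection z \<Longrightarrow> Re (\<sigma> y) \<le> Re (\<sigma> z) \<Longrightarrow> proj_le y z"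
proof -
  note BD = cstar_subalgebraD[OF B]
  have bB: "b \<in> B" and bx: "\<And>x. x \<in> B \<Longrightarrow> b * x = x" using b by (auto simp: is_unit_of_def)
  have div: "Re (z / of_nat k) = Re z / real k" for z by simp
  from iso show ?thesis
  proof
    assume "iso_matrices B k"
    then obtain \<phi> where \<phi>: "star_isomorphism \<phi> B (carrier_mat k k) (+) (*) (\<cdot>\<^sub>m) mat_adjoint"
      by (auto simp: iso_matrices_def)
    have bij: "bij_betw \<phi> B (carrier_mat k k)" using \<phi> by (simp add: star_isomorphism_def)
    have C: "\<phi> x \<in> carrier_mat k k" if "x \<in> B" for x using bij that by (auto simp: bij_betw_def)
    have hom: "\<phi> (x + y) = \<phi> x + \<phi> y" "\<phi> (x * y) = \<phi> x * \<phi> y" if "x \<in> B" "y \<in> B" for x y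
      using \<phi> that by (auto simp: star_isomorphism_def)
    have hom': "\<phi> (c *\<^sub>C x) = c \<cdot>\<^sub>m \<phi> x" "\<phi> (star x) = mat_adjoint (\<phi> x)" if "x \<in> B" for c x
      using \<phi> that by (auto simp: star_isomorphism_def)
    define \<psi> where "\<psi> = inv_into B \<phi>"
    have \<psi>: "\<psi> X \<in> B" "\<phi> (\<psi> X) = X" if "X \<in> carrier_mat k k" for X
      using bij that unfolding \<psi>_def bij_betw_def by (auto intro: inv_into_into f_inv_into_f)
    have \<psi>\<phi>: "\<psi> (\<phi> x) = x" if "x \<in> B" for x
      using bij that unfolding \<psi>_def bij_betw_def by (auto intro: inv_into_f_f)
    have emb: "matrix_embedding k \<psi>"
      unfolding matrix_embedding_def
    proof (intro conjI ballI allI)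
      show "inj_on \<psi> (carrier_mat k k)" by (rule inj_on_inverseI[where g = \<phi>]) (rule \<psi>)
    next
      fix X Y :: "complex mat" assume "X \<in> carrier_mat k k" "Y \<in> carrier_mat k k"
      note X = \<psi>[OF this(1)] and Y = \<psi>[OF this(2)]
      show "\<psi> (X + Y) = \<psi> X + \<psi> Y"
        using \<psi>\<phi>[OF BD(2)[OF X(1) Y(1)]] by (simp add: hom X Y)
      show "\<psi> (X * Y) = \<psi> X * \<psi> Y"
        using \<psi>\<phi>[OF BD(5)[OF X(1) Y(1)]] by (simp add: hom X Y)
    next
      fix c and X :: "complex mat" assume "X \<in> carrier_mat k k"
      note X = \<psi>[OF this]
      show "\<psi> (c \<cdot>\<^sub>m X) = c *\<^sub>C \<psi> X"
        using \<psi>\<phi>[OF BD(3)[OF X(1)]] by (simp add: hom' X)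
    next
      fix X :: "complex mat" assume "X \<in> carrier_mat k k"
      note X = \<psi>[OF this]
      show "\<psi> (mat_adjoint X) = star (\<psi> X)"
        using \<psi>\<phi>[OF BD(6)[OF X(1)]] by (simp add: hom' X)
    qed
    have one: "\<phi> b = 1\<^sub>m k"
    proof -
      note o = \<psi>[OF one_carrier_mat]
      have "\<phi> (b * \<psi> (1\<^sub>m k)) = \<phi> b" using C[OF bB] by (simp add: hom bB o)
      then show ?thesis by (simp add: bx o)
    qed
    show ?thesis
    proof (rule that)
      show "normalized_trace_on B b (\<lambda>x. mat_trace (\<phi> x) / of_nat k)"
        by (rule normalized_trace_of_representation[OF B k]) (simp_all add: C hom hom' one)
      fix y z assume y: "y \<in> B" "projection y" and z: "z \<in> B" "projection z"
        and "Re (mat_trace (\<phi> y) / of_nat k) \<le> Re (mat_trace (\<phi> z) / of_nat k)"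
      then have "Re (mat_trace (\<phi> y)) \<le> Re (mat_trace (\<phi> z))"
        using k unfolding div by (simp add: divide_le_cancel)
      from matrix_comparison[OF emb C[OF y(1)] _ C[OF z(1)] _ this]
      show "proj_le y z" using y z by (simp add: \<psi>\<phi> proj_le_iff)
    qed
  next
    assume "iso_interval_matrices B k"
    then obtain \<phi> where "interval_block B \<phi> k"
      using B by (auto simp: iso_interval_matrices_def interval_block_def)
    then interpret interval_block B \<phi> k .
    have 0: "0 \<in> {0..1::real}" by simp
    have one: "\<phi> b 0 = 1\<^sub>m k"
    proof -
      have o: "lift (\<lambda>t. 1\<^sub>m k) \<in> B" "\<phi> (lift (\<lambda>t. 1\<^sub>m k)) 0 = 1\<^sub>m k"
        by (rule lift_in[OF one_carrier_mat continuous_on_const])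
          (rule phi_lift[where F = "\<lambda>t. 1\<^sub>m k", OF one_carrier_mat continuous_on_const 0])
      have "\<phi> (b * lift (\<lambda>t. 1\<^sub>m k)) 0 = \<phi> b 0" using carrier[OF bB 0] by (simp add: phi_mult bB o)
      then show ?thesis by (simp add: bx o)
    qed
    show ?thesis
    proof (rule that)
      show "normalized_trace_on B b (\<lambda>x. mat_trace (\<phi> x 0) / of_nat k)"
        by (rule normalized_trace_of_representation[OF B k])
          (simp_all add: carrier phi_add phi_mult phi_scaleC one)
      fix y z assume y: "y \<in> B" "projection y" and z: "z \<in> B" "projection z"
        and "Re (mat_trace (\<phi> y 0) / of_nat k) \<le> Re (mat_trace (\<phi> z 0) / of_nat k)"
      then have "Re (mat_trace (\<phi> y 0)) \<le> Re (mat_trace (\<phi> z 0))"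
        using k unfolding div by (simp add: divide_le_cancel)
      from interval_block_comparison[OF y z this] show "proj_le y z" .
    qed
  qed
qed

text \<open>\<open>T\<close> has one trace for each summand.  Multiplication by the unit \<open>\<epsilon> i\<close> of a summand is the projection onto it, and
  partial isometries in the summands add up because the summands are orthogonal.\<close>

lemma interval_algebra_comparison:
  fixes D :: "'a::unital_cstar_algebra set"
  assumes D: "interval_algebra D" and e: "is_unit_of e D"
  obtains T where "\<And>\<sigma>. \<sigma> \<in> T \<Longrightarrow> normalized_trace_on D e \<sigma>"
    "\<And>y z. y \<in> D \<Longrightarrow> z \<in> D \<Longrightarrow> projection y \<Longrightarrow> projection z \<Longrightarrow>
      (\<And>\<sigma>. \<sigma> \<in> T \<Longrightarrow> Re (\<sigma> y) \<le> Re (\<sigma> z)) \<Longrightarrow> proj_le y z"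
proof -
  obtain n B where Dsub: "cstar_subalgebra D" and sum: "direct_sum_of D n B"
    and block: "\<And>i. i < n \<Longrightarrow> \<exists>k\<ge>1. iso_matrices (B i) k \<or> iso_interval_matrices (B i) k"
    using D by (auto simp: interval_algebra_def)
  have Bsub: "cstar_subalgebra (B i)" if "i < n" for i using sum that by (simp add: direct_sum_of_def)
  have orth: "x * y = 0" if "i < n" "j < n" "i \<noteq> j" "x \<in> B i" "y \<in> B j" for i j x y
    using sum that by (auto simp: direct_sum_of_def)
  have DB: "D = {\<Sum>i<n. b i | b. \<forall>i<n. b i \<in> B i}" using sum by (simp add: direct_sum_of_def)
  have single: "(\<Sum>j<n. f j) = f i" if "i < n" "\<And>j. j < n \<Longrightarrow> j \<noteq> i \<Longrightarrow> f j = 0" for i and f :: "nat \<Rightarrow> 'a"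
    using that by (subst sum.remove[of _ i]) auto
  have sub: "x \<in> D" if "i < n" "x \<in> B i" for i x
    unfolding DB using that cstar_subalgebraD(1)[OF Bsub]
    by (intro CollectI exI[of _ "\<lambda>j. if j = i then x else 0"]) (auto simp: single[of i])
  have eD: "e \<in> D" and ex: "\<And>x. x \<in> D \<Longrightarrow> e * x = x" "\<And>x. x \<in> D \<Longrightarrow> x * e = x"
    using e by (auto simp: is_unit_of_def)
  obtain \<epsilon> where \<epsilon>: "e = (\<Sum>i<n. \<epsilon> i)" "\<And>i. i < n \<Longrightarrow> \<epsilon> i \<in> B i" using eD unfolding DB by blast
  have unit: "is_unit_of (\<epsilon> i) (B i)" if i: "i < n" for i
    unfolding is_unit_of_def
  proof (intro conjI ballI \<epsilon>(2) i)
    fix x assume x: "x \<in> B i"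
    have "e * x = \<epsilon> i * x"
      unfolding \<epsilon>(1) sum_distrib_right by (rule single[OF i]) (use orth \<epsilon>(2) i x in auto)
    then show "\<epsilon> i * x = x" using ex sub[OF i x] by simp
    have "x * e = x * \<epsilon> i"
      unfolding \<epsilon>(1) sum_distrib_left by (rule single[OF i]) (use orth \<epsilon>(2) i x in auto)
    then show "x * \<epsilon> i = x" using ex sub[OF i x] by simp
  qed
  have comp: "y * \<epsilon> i \<in> B i \<and> \<epsilon> i * y = y * \<epsilon> i" if y: "y \<in> D" and i: "i < n" for y i
  proof -
    obtain b where b: "y = (\<Sum>i<n. b i)" "\<And>i. i < n \<Longrightarrow> b i \<in> B i" using y unfolding DB by blast
    have "y * \<epsilon> i = b i * \<epsilon> i"
      unfolding b(1) sum_distrib_right by (rule single[OF i]) (use orth \<epsilon>(2) b(2) i in auto)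
    moreover have "\<epsilon> i * y = \<epsilon> i * b i"
      unfolding b(1) sum_distrib_left by (rule single[OF i]) (use orth \<epsilon>(2) b(2) i in auto)
    ultimately show ?thesis using unit[OF i] b(2)[OF i] by (simp add: is_unit_of_def)
  qed
  have p\<epsilon>: "projection (\<epsilon> i)" if "i < n" for i by (rule unit_is_projection[OF Bsub[OF that] unit[OF that]])
  have mult: "(y * \<epsilon> i) * (z * \<epsilon> i) = y * z * \<epsilon> i" if "y \<in> D" "z \<in> D" "i < n" for y z i
  proof -
    have "(y * \<epsilon> i) * (z * \<epsilon> i) = y * ((\<epsilon> i * z) * \<epsilon> i)" by (simp only: mult.assoc)
    also have "\<dots> = y * (z * (\<epsilon> i * \<epsilon> i))" using comp that by (simp add: mult.assoc)
    finally show ?thesis using projectionD(2)[OF p\<epsilon>[OF that(3)]] by (simp add: mult.assoc)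
  qed
  have "\<exists>\<sigma>. normalized_trace_on (B i) (\<epsilon> i) \<sigma> \<and> (\<forall>y z. y \<in> B i \<longrightarrow> z \<in> B i \<longrightarrow> projection y \<longrightarrow>
      projection z \<longrightarrow> Re (\<sigma> y) \<le> Re (\<sigma> z) \<longrightarrow> proj_le y z)" if i: "i < n" for i
  proof -
    obtain k where k: "k \<ge> 1" "iso_matrices (B i) k \<or> iso_interval_matrices (B i) k"
      using block[OF i] by blast
    from building_block_comparison[OF Bsub[OF i] unit[OF i] k] show ?thesis by metis
  qed
  then obtain s where s: "\<And>i. i < n \<Longrightarrow> normalized_trace_on (B i) (\<epsilon> i) (s i)"
    "\<And>i y z. i < n \<Longrightarrow> y \<in> B i \<Longrightarrow> z \<in> B i \<Longrightarrow> projection y \<Longrightarrow> projection z \<Longrightarrow>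
      Re (s i y) \<le> Re (s i z) \<Longrightarrow> proj_le y z"
    by metis
  define T where "T = (\<lambda>i y. s i (y * \<epsilon> i)) ` {..<n}"
  show ?thesis
  proof (rule that[of T])
    fix \<sigma> assume "\<sigma> \<in> T"
    then obtain i where i: "i < n" and \<sigma>: "\<sigma> = (\<lambda>y. s i (y * \<epsilon> i))" by (auto simp: T_def)
    note si = s(1)[OF i, unfolded normalized_trace_on_def]
    have c: "y * \<epsilon> i \<in> B i" if "y \<in> D" for y using comp[OF that i] by simp
    show "normalized_trace_on D e \<sigma>"
      unfolding normalized_trace_on_def \<sigma>
    proof (intro conjI ballI allI)
      fix x y assume x: "x \<in> D" and y: "y \<in> D"
      show "s i ((x + y) * \<epsilon> i) = s i (x * \<epsilon> i) + s i (y * \<epsilon> i)"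
        using si c[OF x] c[OF y] by (simp add: distrib_right)
      show "s i (x * y * \<epsilon> i) = s i (y * x * \<epsilon> i)"
        unfolding mult[OF x y i, symmetric] mult[OF y x i, symmetric] using si c[OF x] c[OF y] by blast
    next
      fix z x assume x: "x \<in> D"
      show "s i ((z *\<^sub>C x) * \<epsilon> i) = z * s i (x * \<epsilon> i)"
        using si c[OF x] by (simp add: mult_scaleC_left)
    next
      show "s i (e * \<epsilon> i) = 1" using si ex(1)[OF sub[OF i \<epsilon>(2)[OF i]]] by simp
    next
      fix x assume x: "x \<in> D"
      have "cmod (s i (x * \<epsilon> i)) \<le> norm (x * \<epsilon> i)" using si c[OF x] by blast
      also have "\<dots> \<le> norm x" by (rule norm_mult_le_right[OF norm_projection_le[OF p\<epsilon>[OF i]]])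
      finally show "cmod (s i (x * \<epsilon> i)) \<le> norm x" .
    qed
  next
    fix y z assume y: "y \<in> D" "projection y" and z: "z \<in> D" "projection z"
      and le: "\<And>\<sigma>. \<sigma> \<in> T \<Longrightarrow> Re (\<sigma> y) \<le> Re (\<sigma> z)"
    have proj: "projection (x * \<epsilon> i)" if "x \<in> D" "projection x" "i < n" for x i
      using comp[OF that(1,3)] mult[OF that(1,1,3)]
      by (simp add: projection_def star_mult projectionD[OF that(2)] projectionD[OF p\<epsilon>[OF that(3)]])
    have "\<exists>v. star v * v = y * \<epsilon> i \<and> (z * \<epsilon> i) * v = v" if i: "i < n" for i
    proof -
      have "(\<lambda>y. s i (y * \<epsilon> i)) \<in> T" using i by (simp add: T_def)
      from le[OF this] have "proj_le (y * \<epsilon> i) (z * \<epsilon> i)"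
        using comp y z i by (intro s(2)[OF i] proj) auto
      then show ?thesis using proj_le_iff[OF proj[OF y i] proj[OF z i]] by simp
    qed
    then obtain v where v: "\<And>i. i < n \<Longrightarrow> star (v i) * v i = y * \<epsilon> i"
      "\<And>i. i < n \<Longrightarrow> (z * \<epsilon> i) * v i = v i" by metis
    have sv: "star (v i) * v j = 0" if ij: "i < n" "j < n" "j \<noteq> i" for i j
    proof -
      have "star ((z * \<epsilon> i) * v i) = star (v i)" using v(2)[OF ij(1)] by simp
      then have "star (v i) = star (v i) * (z * \<epsilon> i)"
        using projectionD(1)[OF proj[OF z ij(1)]] by (simp add: star_mult)
      then have "star (v i) * v j = star (v i) * (z * \<epsilon> i) * ((z * \<epsilon> j) * v j)"
        using v(2)[OF ij(2)] by simp
      also have "\<dots> = star (v i) * ((z * \<epsilon> i) * (z * \<epsilon> j)) * v j" by (simp only: mult.assoc)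
      also have "(z * \<epsilon> i) * (z * \<epsilon> j) = 0" using comp z ij by (intro orth[of i j]) auto
      finally show ?thesis by simp
    qed
    define V where "V = (\<Sum>i<n. v i)"
    have "star V * V = (\<Sum>i<n. \<Sum>j<n. star (v i) * v j)"
      by (simp add: V_def star_sum sum_product)
    also have "\<dots> = (\<Sum>i<n. star (v i) * v i)"
      by (intro sum.cong[OF refl] single) (use sv in auto)
    also have "\<dots> = (\<Sum>i<n. y * \<epsilon> i)" using v(1) by (intro sum.cong) auto
    also have "\<dots> = y" using ex(2)[OF y(1)] by (simp add: \<epsilon>(1) sum_distrib_left)
    finally have "star V * V = y" .
    moreover have "z * V = V"
      unfolding V_def sum_distrib_left
    proof (intro sum.cong refl)
      fix i assume "i \<in> {..<n}"
      then have i: "i < n" by simp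
      have "z * v i = z * ((z * \<epsilon> i) * v i)" using v(2)[OF i] by simp
      also have "\<dots> = (z * \<epsilon> i) * v i" by (simp add: mult.assoc projectionD[OF z(2)])
      finally show "z * v i = v i" using v(2)[OF i] by simp
    qed
    ultimately show "proj_le y z" using y z by (auto simp: proj_le_iff)
  qed
qed

section \<open>Traces of corners as approximate traces\<close>

lemma normalized_trace_onD:
  assumes "normalized_trace_on D e \<sigma>" "cstar_subalgebra D" "x \<in> D" "y \<in> D"
  shows "\<sigma> (x + y) = \<sigma> x + \<sigma> y" "\<sigma> (x * y) = \<sigma> (y * x)" "\<sigma> (c *\<^sub>C x) = c * \<sigma> x" "\<sigma> e = 1"
    "cmod (\<sigma> x) \<le> norm x" "cmod (\<sigma> x - \<sigma> y) \<le> norm (x - y)"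
proof -
  show 1: "\<sigma> (x + y) = \<sigma> x + \<sigma> y" "\<sigma> (x * y) = \<sigma> (y * x)" "\<sigma> (c *\<^sub>C x) = c * \<sigma> x" "\<sigma> e = 1"
    "cmod (\<sigma> x) \<le> norm x"
    using assms by (auto simp: normalized_trace_on_def)
  have D: "x - y \<in> D" using cstar_subalgebraD(8)[OF assms(2-4)] .
  have "\<sigma> ((x - y) + y) = \<sigma> (x - y) + \<sigma> y"
    using assms D by (auto simp only: normalized_trace_on_def)
  then have "\<sigma> x - \<sigma> y = \<sigma> (x - y)" by simp
  moreover have "cmod (\<sigma> (x - y)) \<le> norm (x - y)" using assms(1) D by (auto simp only: normalized_trace_on_def)
  ultimately show "cmod (\<sigma> x - \<sigma> y) \<le> norm (x - y)" by simp
qed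

lemma norm_compress_le:
  assumes "projection (e::'a::unital_cstar_algebra)"
  shows "norm (e * x * e) \<le> norm x"
  using norm_mult_le_right[OF norm_projection_le[OF assms], of "e * x"]
    norm_mult_le_left[OF norm_projection_le[OF assms], of x] by linarith

text \<open>Compression by \<open>e\<close> is almost multiplicative on elements that almost commute with \<open>e\<close>.\<close>

lemma norm_compress_mult:
  assumes e: "projection (e::'a::unital_cstar_algebra)"
  shows "norm (e * (x * y) * e - (e * x * e) * (e * y * e)) \<le> norm x * norm (y * e - e * y)"
proof -
  note eD = projectionD[OF e]
  have eq: "e * (x * y) * e - (e * x * e) * (e * y * e) = e * (x * ((y * e - e * y) * e))"
    by (simp add: left_diff_distrib right_diff_distrib mult.assoc eD)
  have "norm (e * (x * ((y * e - e * y) * e))) \<le> norm (x * ((y * e - e * y) * e))"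
    by (rule norm_mult_le_left[OF norm_projection_le[OF e]])
  also have "\<dots> \<le> norm x * norm ((y * e - e * y) * e)" by (rule norm_mult_ineq)
  also have "\<dots> \<le> norm x * norm (y * e - e * y)"
    by (intro mult_left_mono norm_mult_le_right[OF norm_projection_le[OF e]]) auto
  finally show ?thesis unfolding eq .
qed

text \<open>Choose \<open>a x\<close> in \<open>D\<close> near \<open>e x e\<close> and put \<open>s x = \<sigma>(a x)\<close>.  As compression is almost a homomorphism, the trace
  identities of \<open>\<sigma>\<close> carry over with errors controlled by \<open>\<eta>\<close>.  The set \<open>F'\<close> contains all elements at which these
  identities evaluate \<open>s\<close>.  The constant \<open>4 + 6 M + N\<close> exceeds the errors for sums (\<open>3\<close>), for products
  (\<open>4 + 6 M\<close>, twice the bound for one product), and for multiples by scalars (\<open>1 + N\<close>).\<close>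

lemma approximate_trace_of_corner:
  fixes D :: "'a::unital_cstar_algebra set"
  assumes D: "cstar_subalgebra D" and eu: "is_unit_of e D" and \<sigma>: "normalized_trace_on D e \<sigma>"
    and \<eta>: "\<eta> > 0" "\<eta> \<le> 1" "\<eta> * (4 + 6 * M + N) \<le> \<epsilon>"
    and F: "\<And>x. x \<in> F \<Longrightarrow> norm x \<le> M" and G: "\<And>c. c \<in> G \<Longrightarrow> cmod c \<le> N" and MN: "M \<ge> 0" "N \<ge> 0"
    and sub: "1 \<in> F'" "F \<subseteq> F'" "\<And>x y. x \<in> F \<Longrightarrow> y \<in> F \<Longrightarrow> x + y \<in> F' \<and> x * y \<in> F'"
      "\<And>c x. c \<in> G \<Longrightarrow> x \<in> F \<Longrightarrow> c *\<^sub>C x \<in> F'"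
    and comm: "\<And>x. x \<in> F' \<Longrightarrow> norm (x * e - e * x) < \<eta>"
    and app: "\<And>x. x \<in> F' \<Longrightarrow> \<exists>y\<in>D. norm (e * x * e - y) < \<eta>"
  obtains s where "approximate_trace F G \<epsilon> s"
    "\<forall>x\<in>F'. \<forall>z\<in>D. cmod (s x - \<sigma> z) \<le> \<eta> + norm (e * x * e - z)"
proof -
  note BD = cstar_subalgebraD[OF D]
  note S = normalized_trace_onD[OF \<sigma> D]
  have e: "projection e" by (rule unit_is_projection[OF D eu])
  have eD: "e \<in> D" using eu by (simp add: is_unit_of_def)
  define good where "good x \<longleftrightarrow> (\<exists>y\<in>D. norm (e * x * e - y) < \<eta>)" for x
  have "\<exists>a. \<forall>x. good x \<longrightarrow> a x \<in> D \<and> norm (e * x * e - a x) < \<eta>"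
    by (rule choice) (auto simp: good_def)
  then obtain a where a: "\<And>x. good x \<Longrightarrow> a x \<in> D \<and> norm (e * x * e - a x) < \<eta>" by blast
  have g: "a x \<in> D" "norm (e * x * e - a x) < \<eta>" if "x \<in> F'" for x
    using a app[OF that] by (auto simp: good_def)
  define s where "s x = (if good x then \<sigma> (a x) else 0)" for x
  have near: "cmod (s x - \<sigma> z) \<le> \<eta> + norm (e * x * e - z)" if x: "x \<in> F'" and z: "z \<in> D" for x z
  proof -
    have "cmod (s x - \<sigma> z) \<le> norm (a x - z)"
      using app[OF x] S(6)[OF g(1)[OF x] z] by (simp add: s_def good_def)
    also have "\<dots> \<le> norm (a x - e * x * e) + norm (e * x * e - z)"
      using norm_triangle_ineq[of "a x - e * x * e" "e * x * e - z"] by simp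
    finally show ?thesis using g(2)[OF x] by (simp add: norm_minus_commute)
  qed
  have \<epsilon>1: "\<eta> \<le> \<epsilon>"
  proof -
    have "\<eta> * 1 \<le> \<eta> * (4 + 6 * M + N)" using \<eta> MN by (intro mult_left_mono) auto
    then show ?thesis using \<eta>(3) by (simp only: mult_1_right)
  qed
  have bound: "cmod (s x) \<le> norm x + \<epsilon>" for x
  proof (cases "good x")
    case True
    then have "cmod (s x) \<le> norm (a x)" using S(5)[of "a x" e] a eD by (simp add: s_def)
    also have "\<dots> \<le> norm (e * x * e) + \<eta>"
      using a[OF True] norm_triangle_sub[of "a x" "e * x * e"] by (simp add: norm_minus_commute)
    finally show ?thesis using norm_compress_le[OF e, of x] \<epsilon>1 by linarith
  qed (use \<epsilon>1 \<eta> in \<open>simp add: s_def add_nonneg_nonneg\<close>)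
  have one: "cmod (s 1 - 1) \<le> \<epsilon>"
    using near[OF sub(1) eD] S(4)[OF eD eD] projectionD(2)[OF e] \<epsilon>1 by simp
  have add: "cmod (s (x + y) - (s x + s y)) \<le> \<epsilon>" if x: "x \<in> F" and y: "y \<in> F" for x y
  proof -
    have F': "x \<in> F'" "y \<in> F'" "x + y \<in> F'" using sub x y by auto
    have "s x = \<sigma> (a x)" "s y = \<sigma> (a y)" using app F' by (auto simp: s_def good_def)
    then have eq: "s x + s y = \<sigma> (a x + a y)" using S(1)[OF g(1)[OF F'(1)] g(1)[OF F'(2)]] by simp
    have eq': "e * (x + y) * e - (a x + a y) = (e * x * e - a x) + (e * y * e - a y)"
      by (simp add: distrib_left distrib_right)
    have "norm (e * (x + y) * e - (a x + a y)) \<le> 2 * \<eta>"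
      unfolding eq' using norm_triangle_ineq[of "e * x * e - a x" "e * y * e - a y"] g(2)[OF F'(1)] g(2)[OF F'(2)] by simp
    then have "cmod (s (x + y) - (s x + s y)) \<le> \<eta> * 3"
      unfolding eq using near[OF F'(3) BD(2)[OF g(1)[OF F'(1)] g(1)[OF F'(2)]]] by linarith
    also have "\<dots> \<le> \<eta> * (4 + 6 * M + N)" using \<eta> MN by (intro mult_left_mono) auto
    finally show ?thesis using \<eta>(3) by linarith
  qed
  have prod: "cmod (s (x * y) - \<sigma> (a x * a y)) \<le> \<eta> * (2 + 3 * M)" if x: "x \<in> F" and y: "y \<in> F" for x y
  proof -
    have F': "x \<in> F'" "y \<in> F'" "x * y \<in> F'" using sub x y by auto
    let ?x = "e * x * e" and ?y = "e * y * e"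
    have "norm (e * (x * y) * e - ?x * ?y) \<le> norm x * norm (y * e - e * y)" by (rule norm_compress_mult[OF e])
    also have "\<dots> \<le> M * \<eta>" using F[OF x] comm[OF F'(2)] MN by (intro mult_mono) auto
    finally have 1: "norm (e * (x * y) * e - ?x * ?y) \<le> M * \<eta>" .
    have "norm (?x * (?y - a y)) \<le> norm ?x * norm (?y - a y)" by (rule norm_mult_ineq)
    also have "\<dots> \<le> M * \<eta>"
      using norm_compress_le[OF e, of x] F[OF x] g(2)[OF F'(2)] MN by (intro mult_mono) auto
    finally have 2: "norm (?x * (?y - a y)) \<le> M * \<eta>" .
    have "norm (a y) \<le> M + 1"
      using norm_triangle_sub[of "a y" ?y] g(2)[OF F'(2)] norm_compress_le[OF e, of y] F[OF y] \<eta>(2)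
      by (simp add: norm_minus_commute)
    then have "norm (?x - a x) * norm (a y) \<le> \<eta> * (M + 1)"
      using g(2)[OF F'(1)] \<eta> by (intro mult_mono) auto
    then have 3: "norm ((?x - a x) * a y) \<le> \<eta> * (M + 1)" using norm_mult_ineq order_trans by blast
    have "e * (x * y) * e - a x * a y = (e * (x * y) * e - ?x * ?y) + (?x * (?y - a y) + (?x - a x) * a y)"
      by (simp add: left_diff_distrib right_diff_distrib)
    then have "norm (e * (x * y) * e - a x * a y) \<le> M * \<eta> + (M * \<eta> + \<eta> * (M + 1))"
      using 1 2 3 by (metis add_mono norm_triangle_mono)
    then have "cmod (s (x * y) - \<sigma> (a x * a y)) \<le> \<eta> + (M * \<eta> + (M * \<eta> + \<eta> * (M + 1)))"
      using near[OF F'(3) BD(5)[OF g(1)[OF F'(1)] g(1)[OF F'(2)]]] by linarith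
    then show ?thesis by (simp add: algebra_simps)
  qed
  have tracial: "cmod (s (x * y) - s (y * x)) \<le> \<epsilon>" if x: "x \<in> F" and y: "y \<in> F" for x y
  proof -
    have F': "x \<in> F'" "y \<in> F'" using sub x y by auto
    have "\<sigma> (a x * a y) = \<sigma> (a y * a x)" by (rule S(2)) (use g F' in auto)
    then have "cmod (s (x * y) - s (y * x)) \<le> \<eta> * (2 + 3 * M) + \<eta> * (2 + 3 * M)"
      using prod[OF x y] prod[OF y x]
        norm_triangle_ineq4[of "s (x * y) - \<sigma> (a x * a y)" "s (y * x) - \<sigma> (a y * a x)"] by simp
    also have "\<dots> = \<eta> * (4 + 6 * M)" by (simp add: algebra_simps)
    also have "\<dots> \<le> \<eta> * (4 + 6 * M + N)" using \<eta> MN by (intro mult_left_mono) auto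
    finally show ?thesis using \<eta>(3) by linarith
  qed
  have scal: "cmod (s (c *\<^sub>C x) - c * s x) \<le> \<epsilon>" if c: "c \<in> G" and x: "x \<in> F" for c x
  proof -
    have F': "x \<in> F'" "c *\<^sub>C x \<in> F'" using sub c x by auto
    have "s x = \<sigma> (a x)" using app F' by (auto simp: s_def good_def)
    then have eq: "c * s x = \<sigma> (c *\<^sub>C a x)" using S(3)[OF g(1)[OF F'(1)] g(1)[OF F'(1)]] by simp
    have "e * (c *\<^sub>C x) * e - c *\<^sub>C a x = c *\<^sub>C (e * x * e - a x)"
      by (simp add: mult_scaleC_left mult_scaleC_right scaleC_diff_right)
    then have "norm (e * (c *\<^sub>C x) * e - c *\<^sub>C a x) = cmod c * norm (e * x * e - a x)"
      by (simp add: norm_scaleC)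
    also have "\<dots> \<le> N * \<eta>" using G[OF c] g(2)[OF F'(1)] MN by (intro mult_mono) auto
    finally have "cmod (s (c *\<^sub>C x) - c * s x) \<le> \<eta> * (1 + N)"
      unfolding eq using near[OF F'(2) BD(3)[OF g(1)[OF F'(1)], of c]] by (simp add: algebra_simps)
    also have "\<dots> \<le> \<eta> * (4 + 6 * M + N)" using \<eta> MN by (intro mult_left_mono) auto
    finally show ?thesis using \<eta>(3) by linarith
  qed
  have "approximate_trace F G \<epsilon> s"
    unfolding approximate_trace_def using bound one add tracial scal by blast
  then show ?thesis using near that by blast
qed

text \<open>If \<open>p'\<close> is not subequivalent to \<open>q'\<close> in the algebra, then some normalized trace \<open>\<sigma>\<close> of \<open>D\<close> has
  \<open>\<sigma> q' < \<sigma> p'\<close>, and it yields an approximate trace on the whole algebra.  The factor \<open>101\<close> is the distance that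
  \<open>compression_near_projection\<close> achieves.\<close>

lemma tracial_state_from_corners:
  fixes p q :: "'a::unital_cstar_algebra"
  assumes ex: "\<And>F \<eta>. finite F \<Longrightarrow> \<eta> > 0 \<Longrightarrow> \<eta> \<le> 1/400 \<Longrightarrow> \<exists>e D p' q'.
      interval_algebra D \<and> is_unit_of e D \<and> (\<forall>x\<in>F. norm (x * e - e * x) < \<eta>) \<and>
      (\<forall>x\<in>F. \<exists>y\<in>D. norm (e * x * e - y) < \<eta>) \<and>
      p' \<in> D \<and> q' \<in> D \<and> projection p' \<and> projection q' \<and> \<not> proj_le p' q' \<and>
      norm (e * p * e - p') \<le> 101 * \<eta> \<and> norm (e * q * e - q') \<le> 101 * \<eta>"
  obtains \<tau> where "tracial_state \<tau>" "\<And>x. cmod (\<tau> x) \<le> norm x" "Re (\<tau> q) \<le> Re (\<tau> p)"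
proof (rule tracial_state_from_approximate_traces)
  fix F :: "'a set" and G :: "complex set" and \<epsilon> :: real
  assume fin: "finite F" "finite G" and \<epsilon>: "\<epsilon> > 0"
  define M N where "M = (\<Sum>x\<in>F. norm x)" and "N = (\<Sum>c\<in>G. cmod c)"
  have MN: "M \<ge> 0" "N \<ge> 0" by (auto simp: M_def N_def intro: sum_nonneg)
  have FM: "norm x \<le> M" if "x \<in> F" for x unfolding M_def using fin that by (intro member_le_sum) auto
  have GN: "cmod c \<le> N" if "c \<in> G" for c unfolding N_def using fin that by (intro member_le_sum) auto
  \<comment> \<open>\<open>204 = 2 (1 + 101)\<close> is the loss in replacing \<open>p'\<close> and \<open>q'\<close> by \<open>p\<close> and \<open>q\<close>.\<close>
  define K where "K = 4 + 6 * M + N + 204"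
  have K: "K > 0" using MN by (simp add: K_def)
  define \<eta> where "\<eta> = min (1/400) (\<epsilon> / K)"
  have "\<eta> > 0" using \<epsilon> K by (simp add: \<eta>_def)
  moreover have "\<eta> \<le> 1/400" unfolding \<eta>_def by (rule min.cobounded1)
  ultimately have \<eta>: "\<eta> > 0" "\<eta> \<le> 1/400" .
  have "\<eta> \<le> \<epsilon> / K" unfolding \<eta>_def by (rule min.cobounded2)
  then have \<eta>K: "\<eta> * K \<le> \<epsilon>" using K by (simp add: pos_le_divide_eq)
  have "0 \<le> \<eta> * (4 + 6 * M + N)" "0 \<le> \<eta> * 204" using \<eta> MN by auto
  with \<eta>K have \<eta>1: "\<eta> * (4 + 6 * M + N) \<le> \<epsilon>" "204 * \<eta> \<le> \<epsilon>" by (simp_all add: K_def distrib_left)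
  define F' where "F' = {1, p, q} \<union> F \<union> (\<lambda>(x, y). x + y) ` (F \<times> F) \<union> (\<lambda>(x, y). x * y) ` (F \<times> F)
    \<union> (\<lambda>(c, x). c *\<^sub>C x) ` (G \<times> F)"
  have "finite F'" using fin by (simp add: F'_def)
  from ex[OF this \<eta>] obtain e D p' q' where eD: "interval_algebra D" "is_unit_of e D"
    "\<forall>x\<in>F'. norm (x * e - e * x) < \<eta>" "\<forall>x\<in>F'. \<exists>y\<in>D. norm (e * x * e - y) < \<eta>"
    and pq: "p' \<in> D" "q' \<in> D" "projection p'" "projection q'" "\<not> proj_le p' q'"
      "norm (e * p * e - p') \<le> 101 * \<eta>" "norm (e * q * e - q') \<le> 101 * \<eta>"
    by blast
  have D: "cstar_subalgebra D" using eD(1) by (simp add: interval_algebra_def)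
  obtain \<sigma> where \<sigma>: "normalized_trace_on D e \<sigma>" "\<not> Re (\<sigma> p') \<le> Re (\<sigma> q')"
    using interval_algebra_comparison[OF eD(1,2)] pq by metis
  have sub: "1 \<in> F'" "F \<subseteq> F'" "p \<in> F'" "q \<in> F'" by (auto simp: F'_def)
  have sub2: "x + y \<in> F' \<and> x * y \<in> F'" if "x \<in> F" "y \<in> F" for x y
    using that unfolding F'_def by (auto intro: rev_image_eqI)
  have sub3: "c *\<^sub>C x \<in> F'" if "c \<in> G" "x \<in> F" for c x
    using that unfolding F'_def by (auto intro: rev_image_eqI)
  have \<eta>le1: "\<eta> \<le> 1" using \<eta>(2) by simp
  obtain s where s: "approximate_trace F G \<epsilon> s"
    "\<forall>x\<in>F'. \<forall>z\<in>D. cmod (s x - \<sigma> z) \<le> \<eta> + norm (e * x * e - z)"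
    by (rule approximate_trace_of_corner[OF D eD(2) \<sigma>(1) \<eta>(1) \<eta>le1 \<eta>1(1) FM GN MN sub(1,2) sub2 sub3
        eD(3)[rule_format] eD(4)[rule_format]])
  have "\<bar>Re (s p) - Re (\<sigma> p')\<bar> \<le> 102 * \<eta>"
    using s(2)[rule_format, OF sub(3) pq(1)] pq(6) abs_Re_le_cmod[of "s p - \<sigma> p'"] by simp
  moreover have "\<bar>Re (s q) - Re (\<sigma> q')\<bar> \<le> 102 * \<eta>"
    using s(2)[rule_format, OF sub(4) pq(2)] pq(7) abs_Re_le_cmod[of "s q - \<sigma> q'"] by simp
  ultimately have "Re (s q) \<le> Re (s p) + \<epsilon>" using \<sigma>(2) \<eta>1(2) by linarith
  then show "\<exists>s. approximate_trace F G \<epsilon> s \<and> Re (s q) \<le> Re (s p) + \<epsilon>" using s(1) by blast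
qed (use that in blast)

section \<open>Comparison through a corner\<close>

text \<open>The element \<open>e p e\<close> almost lies in \<open>D\<close> and is almost idempotent.  A self-adjoint \<open>x\<close> in \<open>D\<close> within \<open>\<eta>\<close> of it
  satisfies \<open>\<parallel>x\<^sup>2 - x\<parallel> \<le> 5 \<eta>\<close>, which puts a projection within \<open>20 \<cdot> 5 \<eta>\<close> of \<open>x\<close>.\<close>

lemma compression_near_projection:
  fixes p e :: "'a::unital_cstar_algebra"
  assumes D: "cstar_subalgebra D" and eu: "is_unit_of e D" and p: "projection p"
    and comm: "norm (p * e - e * p) < \<eta>" and y: "y \<in> D" "norm (e * p * e - y) < \<eta>" and \<eta>: "\<eta> \<le> 1/400"
  obtains r where "r \<in> D" "projection r" "norm (e * p * e - r) \<le> 101 * \<eta>"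
proof -
  note BD = cstar_subalgebraD[OF D]
  have e: "projection e" by (rule unit_is_projection[OF D eu])
  note eD = projectionD[OF e] and pD = projectionD[OF p]
  define c where "c = e * p * e"
  define x where "x = (1/2) *\<^sub>R (y + star y)"
  have sc: "star c = c" by (simp add: c_def star_mult eD pD mult.assoc)
  have nc: "norm c \<le> 1" using norm_compress_le[OF e, of p] norm_projection_le[OF p] by (simp add: c_def)
  have xD: "x \<in> D" unfolding x_def by (intro BD y)
  have sx: "star x = x" by (simp add: x_def star_scaleR star_add star_star add.commute)
  have "x - c = (1/2) *\<^sub>R ((y - c) + star (y - c))"
  proof -
    have "(1/2) *\<^sub>R ((y - c) + star (y - c)) = x - (1/2) *\<^sub>R (c + c)"
      by (simp add: x_def star_diff sc scaleR_add_right scaleR_diff_right)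
    also have "(1/2) *\<^sub>R (c + c) = c" by (simp add: scaleR_2[symmetric])
    finally show ?thesis by simp
  qed
  then have "norm (x - c) \<le> 1/2 * (norm (y - c) + norm (star (y - c)))"
    using norm_triangle_ineq[of "y - c" "star (y - c)"] by simp
  then have xc: "norm (x - c) \<le> \<eta>" using y(2) by (simp add: c_def norm_minus_commute)
  then have nx: "norm x \<le> 2" using norm_triangle_sub[of x c] nc \<eta> by linarith
  have cc: "norm (c * c - c) \<le> \<eta>"
  proof -
    have "norm (c * c - c) \<le> norm p * norm (p * e - e * p)"
      using norm_compress_mult[OF e, of p p] by (simp add: c_def pD norm_minus_commute)
    also have "\<dots> \<le> 1 * \<eta>" using norm_projection_le[OF p] comm by (intro mult_mono) auto
    finally show ?thesis by simp
  qed
  have "norm (x * (x - c)) \<le> 2 * \<eta>"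
    using order_trans[OF norm_mult_ineq mult_mono[OF nx xc]] by simp
  moreover have "norm ((x - c) * c) \<le> \<eta>" using norm_mult_le_right[OF nc, of "x - c"] xc by linarith
  moreover have "x * x - x = (c * c - c) + ((x * (x - c) + (x - c) * c) - (x - c))"
    by (simp add: left_diff_distrib right_diff_distrib)
  then have "norm (x * x - x) \<le> norm (c * c - c) + ((norm (x * (x - c)) + norm ((x - c) * c)) + norm (x - c))"
    by (metis norm_triangle_mono norm_triangle_le_diff norm_triangle_ineq add_mono order_refl)
  ultimately have xx: "norm (x * x - x) \<le> 5 * \<eta>" using cc xc by linarith
  obtain r where r: "r \<in> D" "projection r" "norm (r - x) \<le> 20 * norm (x * x - x)"
    using projection_near_almost_projection[OF D eu xD sx nx] xx \<eta> by auto
  have "norm (c - r) \<le> norm (c - x) + norm (x - r)" using norm_triangle_ineq[of "c - x" "x - r"] by simp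
  then have "norm (c - r) \<le> 101 * \<eta>" using r(3) xx xc by (simp add: norm_minus_commute)
  then show ?thesis using that r(1,2) by (simp add: c_def)
qed

text \<open>Let \<open>w\<close> carry \<open>p\<^sub>1\<close> into \<open>q\<^sub>1\<close>, and let \<open>v\<close> carry \<open>1 - e\<close> into a part of \<open>q\<close> orthogonal to \<open>q'\<close>.  As \<open>q\<^sub>1\<close> is almost
  under \<open>q'\<close>, the element \<open>x = (q' w + v) p\<close> is almost a partial isometry from \<open>p\<close> into \<open>q\<close>: up to multiples of
  \<open>\<eta>\<close>, \<open>star x * x\<close> is \<open>p (p\<^sub>1 + (1 - e)) p\<close>, hence \<open>p (e p e + (1 - e)) p\<close>, hence \<open>p\<close>.\<close>

lemma proj_le_via_corner:
  fixes p q q' e p1 q1 v :: "'a::unital_cstar_algebra"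
  assumes proj: "projection p" "projection q" "projection q'" "projection e" "projection p1" "projection q1"
    and q': "q * q' = q'" and v: "star v * v = 1 - e" "q * v = v" "star v * q' = 0"
    and comm: "norm (p * e - e * p) < \<eta>" "norm (q' * e - e * q') < \<eta>" and \<eta>: "\<eta> \<le> 1/400"
    and near: "norm (e * p * e - p1) \<le> 101 * \<eta>" "norm (e * q' * e - q1) \<le> 101 * \<eta>"
    and le: "proj_le p1 q1"
  shows "proj_le p q"
proof -
  note pD = projectionD[OF proj(1)] and eD = projectionD[OF proj(4)] and q'D = projectionD[OF proj(3)]
    and q1D = projectionD[OF proj(6)]
  obtain w where w: "star w * w = p1" "q1 * w = w" using le proj_le_iff[OF proj(5,6)] by blast
  have np: "norm p \<le> 1" "norm e \<le> 1" "norm (1 - q') \<le> 1" "norm q1 \<le> 1"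
    using norm_projection_le proj projection_one_minus by auto
  have nw: "norm w \<le> 1" using norm_isometry_le[of w] w(1) norm_projection_le[OF proj(5)] by simp
  have "star (star v * q') = 0" by (simp add: v)
  then have q'v: "q' * v = 0" by (simp add: star_mult star_star q'D)
  define x where "x = (q' * w + v) * p"
  have "star x * x = p * (star w * (q' * w) + 1 - e) * p"
  proof -
    have "star x * x = p * ((star w * q' + star v) * (q' * w + v)) * p"
      by (simp add: x_def star_mult star_add pD q'D mult.assoc)
    also have "(star w * q' + star v) * (q' * w + v) =
        star w * (q' * (q' * w)) + (star v * q') * w + (star w * (q' * v) + star v * v)"
      by (simp only: distrib_left distrib_right mult.assoc)
    finally show ?thesis by (simp add: q'v v q'D add_diff_eq)
  qed
  then have eq: "p - star x * x = p * ((e - p1) + (p1 - star w * (q' * w))) * p"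
    by (simp add: left_diff_distrib right_diff_distrib distrib_left distrib_right pD)
  have "norm (p1 - star w * (q' * w)) \<le> 102 * \<eta>"
  proof -
    have sw: "star w * q1 = star w" using arg_cong[OF w(2), of star] by (simp add: star_mult q1D)
    have "star w * (((1 - q') * q1) * w) = star w * w - star w * (q' * w)"
      by (simp add: mult.assoc w left_diff_distrib right_diff_distrib)
    then have "p1 - star w * (q' * w) = star w * (((1 - q') * q1) * w)" using w(1) by simp
    then have "norm (p1 - star w * (q' * w)) \<le> norm ((1 - q') * q1)"
      using norm_mult_le_left[of "star w" "((1 - q') * q1) * w"] norm_mult_le_right[OF nw, of "(1 - q') * q1"] nw by simp
    also have "(1 - q') * q1 = - ((1 - q') * (e * q' * e - q1)) + (1 - q') * (- (q' * e - e * q') * e)"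
      by (simp add: left_diff_distrib right_diff_distrib mult.assoc) (simp add: mult.assoc[symmetric] q'D)
    also have "norm \<dots> \<le> norm ((1 - q') * (e * q' * e - q1)) + norm ((1 - q') * (- (q' * e - e * q') * e))"
      by (rule order_trans[OF norm_triangle_ineq]) simp
    also have "\<dots> \<le> norm (e * q' * e - q1) + norm (q' * e - e * q')"
      using norm_mult_le_left[OF np(3), of "e * q' * e - q1"]
        norm_mult_le_left[OF np(3), of "- (q' * e - e * q') * e"]
        norm_mult_le_right[OF np(2), of "- (q' * e - e * q')"]
      by (simp add: norm_minus_commute[of "e * q'"])
    finally show ?thesis using near(2) comm(2) by simp
  qed
  then have 1: "norm (p * (p1 - star w * (q' * w)) * p) \<le> 102 * \<eta>"
    using norm_compress_le[OF proj(1)] order_trans by blast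
  have "p * (e - p1) * p = p * e * (e * p - p * e) * p + p * (e * p * e - p1) * p"
    by (simp add: left_diff_distrib right_diff_distrib mult.assoc eD pD)
  moreover have "norm (p * e * (e * p - p * e) * p) \<le> \<eta>"
    using norm_mult_le_right[OF np(1), of "p * e * (e * p - p * e)"]
      norm_mult_le_left[OF np(1), of "e * (e * p - p * e)"] norm_mult_le_left[OF np(2), of "e * p - p * e"]
      comm(1) by (simp add: norm_minus_commute mult.assoc)
  moreover have "norm (p * (e * p * e - p1) * p) \<le> 101 * \<eta>"
    using norm_compress_le[OF proj(1)] near(1) order_trans by blast
  ultimately have 2: "norm (p * (e - p1) * p) \<le> 102 * \<eta>"
    using norm_triangle_ineq[of "p * e * (e * p - p * e) * p" "p * (e * p * e - p1) * p"] by simp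
  have "norm (p - star x * x) \<le> norm (p * (e - p1) * p) + norm (p * (p1 - star w * (q' * w)) * p)"
    unfolding eq distrib_left distrib_right by (rule norm_triangle_ineq)
  then have "norm (p - star x * x) \<le> 3/4" using 1 2 \<eta> by linarith
  moreover have "x * p = x" by (simp add: x_def mult.assoc pD)
  moreover have "q * x = x" by (simp add: x_def mult.assoc[symmetric] distrib_left q' v)
  ultimately show ?thesis by (intro proj_le_if_almost_isometry[OF proj(1,2)])
qed

section \<open>Fundamental comparability\<close>

lemma tracially_AI_corner:
  fixes a :: "'a::unital_cstar_algebra"
  assumes "tracially_AI TYPE('a)" "finite F" "\<eta> > 0" "n > 0"
    and "positive_elt a" "full_elt a"
  obtains e D where "projection e" "e \<noteq> 0" "interval_algebra D" "is_unit_of e D"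
    "\<forall>x\<in>F. norm (x * e - e * x) < \<eta>" "\<forall>x\<in>F. \<exists>y\<in>D. norm (e * x * e - y) < \<eta>"
    "multiple_le n (1 - e) e" "proj_le_elt (1 - e) a"
proof -
  have "finite (insert 1 F) \<and> 1 \<in> insert 1 F \<and> (1::'a) \<noteq> 0 \<and> \<eta> > 0 \<and> n > 0 \<and> positive_elt a \<and> full_elt a"
    using assms by simp
  from assms(1)[unfolded tracially_AI_def, rule_format, OF this] show ?thesis
    using that by blast
qed

text \<open>The hypothesis on \<open>v\<close> provides room for \<open>1 - e\<close> under \<open>q\<close> and orthogonal to \<open>q'\<close>.  Given that room, subequivalence of
  the projections near \<open>e p e\<close> and \<open>e q' e\<close> would make \<open>p\<close> subequivalent to \<open>q\<close>.\<close>

lemma tracial_state_if_not_proj_le: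
  fixes p q q' a :: "'a::unital_cstar_algebra"
  assumes TAI: "tracially_AI TYPE('a)" and proj: "projection p" "projection q" "projection q'"
    and q': "q * q' = q'" and nle: "\<not> proj_le p q" and a: "positive_elt a" "full_elt a" and n: "n > 0"
    and v: "\<And>e. projection e \<Longrightarrow> multiple_le n (1 - e) e \<Longrightarrow> proj_le_elt (1 - e) a \<Longrightarrow>
      \<exists>v. star v * v = 1 - e \<and> q * v = v \<and> star v * q' = 0"
  obtains \<tau> where "tracial_state \<tau>" "\<And>x. cmod (\<tau> x) \<le> norm x" "Re (\<tau> q') \<le> Re (\<tau> p)"
proof (rule tracial_state_from_corners[of p q'])
  fix F :: "'a set" and \<eta> :: real
  assume F: "finite F" and \<eta>: "\<eta> > 0" "\<eta> \<le> 1/400"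
  have "finite ({p, q'} \<union> F)" using F by simp
  from tracially_AI_corner[OF TAI this \<eta>(1) n a] obtain e D where e: "projection e"
    and D: "interval_algebra D" "is_unit_of e D"
    and c: "\<forall>x\<in>{p, q'} \<union> F. norm (x * e - e * x) < \<eta>" "\<forall>x\<in>{p, q'} \<union> F. \<exists>y\<in>D. norm (e * x * e - y) < \<eta>"
    and m: "multiple_le n (1 - e) e" "proj_le_elt (1 - e) a"
    by metis
  have Ds: "cstar_subalgebra D" using D(1) by (simp add: interval_algebra_def)
  have cpq: "norm (p * e - e * p) < \<eta>" "norm (q' * e - e * q') < \<eta>" using c(1) by auto
  obtain p1 where p1: "p1 \<in> D" "projection p1" "norm (e * p * e - p1) \<le> 101 * \<eta>"
    using compression_near_projection[OF Ds D(2) proj(1) cpq(1) _ _ \<eta>(2)] c(2) by (metis Un_iff insert_iff)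
  obtain q1 where q1: "q1 \<in> D" "projection q1" "norm (e * q' * e - q1) \<le> 101 * \<eta>"
    using compression_near_projection[OF Ds D(2) proj(3) cpq(2) _ _ \<eta>(2)] c(2) by (metis Un_iff insert_iff)
  obtain v where v: "star v * v = 1 - e" "q * v = v" "star v * q' = 0" using v[OF e m] by blast
  have "\<not> proj_le p1 q1"
    using proj_le_via_corner[OF proj e p1(2) q1(2) q' v cpq \<eta>(2) p1(3) q1(3)] nle by blast
  then show "\<exists>e D p' q''. interval_algebra D \<and> is_unit_of e D \<and> (\<forall>x\<in>F. norm (x * e - e * x) < \<eta>) \<and>
      (\<forall>x\<in>F. \<exists>y\<in>D. norm (e * x * e - y) < \<eta>) \<and>
      p' \<in> D \<and> q'' \<in> D \<and> projection p' \<and> projection q'' \<and> \<not> proj_le p' q'' \<and>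
      norm (e * p * e - p') \<le> 101 * \<eta> \<and> norm (e * q' * e - q'') \<le> 101 * \<eta>"
    using D c p1 q1 by (intro exI[of _ e] exI[of _ D] exI[of _ p1] exI[of _ q1]) auto
qed (use that in blast)

lemma projection_positive:
  fixes p :: "'a::unital_cstar_algebra"
  assumes p: "projection p"
  shows "positive_elt p"
proof -
  have "c = 0 \<or> c = 1" if c: "c \<in> cstar_spectrum p" for c
  proof (rule ccontr)
    assume n: "\<not> (c = 0 \<or> c = 1)"
    define y where "y = (1 / (1 - c)) *\<^sub>C p - (1 / c) *\<^sub>C (1 - p)"
    have l: "(p - c *\<^sub>C 1) * p = (1 - c) *\<^sub>C p" "(p - c *\<^sub>C 1) * (1 - p) = (- c) *\<^sub>C (1 - p)"
      by (simp_all add: left_diff_distrib right_diff_distrib projectionD[OF p] mult_scaleC_left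
          scaleC_diff_left scaleC_diff_right scaleC_minus_left)
    have r: "p * (p - c *\<^sub>C 1) = (1 - c) *\<^sub>C p" "(1 - p) * (p - c *\<^sub>C 1) = (- c) *\<^sub>C (1 - p)"
      by (simp_all add: left_diff_distrib right_diff_distrib projectionD[OF p] mult_scaleC_right
          scaleC_diff_left scaleC_diff_right scaleC_minus_left)
    have one: "(1 / (1 - c)) *\<^sub>C (1 - c) *\<^sub>C p - (1 / c) *\<^sub>C (- c) *\<^sub>C (1 - p) = 1"
      using n by (simp add: scaleC_scaleC scaleC_minus_left scaleC_minus_right)
    have "(p - c *\<^sub>C 1) * y = 1"
      unfolding y_def right_diff_distrib[of "p - c *\<^sub>C 1" "(1 / (1 - c)) *\<^sub>C p"] mult_scaleC_right l
      by (rule one)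
    moreover have "y * (p - c *\<^sub>C 1) = 1"
      unfolding y_def left_diff_distrib[of "(1 / (1 - c)) *\<^sub>C p" _ "p - c *\<^sub>C 1"] mult_scaleC_left r
      by (rule one)
    ultimately have "(p - c *\<^sub>C 1) * y = 1" "y * (p - c *\<^sub>C 1) = 1" .
    then show False using c by (auto simp: cstar_spectrum_def)
  qed
  then have "cstar_spectrum p \<subseteq> {0, 1}" by blast
  then have "cstar_spectrum p \<subseteq> \<real>\<^sub>\<ge>\<^sub>0" by (force simp: complex_nonneg_Reals_iff)
  then show ?thesis by (simp add: positive_elt_def projectionD[OF p])
qed

lemma simple_full:
  fixes a :: "'a::unital_cstar_algebra"
  assumes "simple_cstar TYPE('a)" "a \<noteq> 0"
  shows "full_elt a"
  using assms unfolding full_elt_def simple_cstar_def by blast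

lemma proj_le_elt_projection:
  fixes q r :: "'a::unital_cstar_algebra"
  assumes q: "projection q" and r: "projection r" and le: "proj_le_elt r q"
  obtains v where "star v * v = r" "q * v = v"
proof -
  obtain s where s: "s \<in> closure {q * x * q | x. True}" "projection s" "proj_le r s"
    using le by (auto simp: proj_le_elt_def)
  have "closed {y. q * y = y}" by (intro closed_Collect_eq continuous_intros)
  moreover have "{q * x * q | x. True} \<subseteq> {y. q * y = y}" by (auto simp: mult.assoc projectionD[OF q])
  ultimately have qs: "q * s = s" using closure_minimal s(1) by blast
  obtain v where v: "star v * v = r" "s * v = v" using s(3) proj_le_iff[OF r s(2)] by blast
  have "q * v = v" using v(2) qs by (metis mult.assoc)
  then show ?thesis using that v(1) by blast
qed

text \<open>The unit \<open>e\<close> of an approximating interval algebra is nonzero, so it is not subequivalent to \<open>0\<close>; this is the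
  situation of \<open>tracial_state_from_corners\<close> for \<open>p = 1\<close> and \<open>q = 0\<close>.\<close>

lemma exists_tracial_state:
  assumes simple: "simple_cstar TYPE('a::unital_cstar_algebra)" and TAI: "tracially_AI TYPE('a)"
  shows "\<exists>\<tau> :: 'a \<Rightarrow> complex. tracial_state \<tau>"
proof (rule tracial_state_from_corners[of 1 "0::'a"])
  fix F :: "'a set" and \<eta> :: real
  assume F: "finite F" and \<eta>: "\<eta> > 0" "\<eta> \<le> 1/400"
  have "projection (1::'a)" by (simp add: projection_def)
  then have pos: "positive_elt (1::'a)" by (rule projection_positive)
  have full: "full_elt (1::'a)" by (rule simple_full[OF simple]) simp
  have "(0::nat) < 1" by simp
  from tracially_AI_corner[OF TAI F \<eta>(1) this pos full]
  obtain e D where e: "projection (e::'a)" "e \<noteq> 0" and D: "interval_algebra D" "is_unit_of e D"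
    and c: "\<forall>x\<in>F. norm (x * e - e * x) < \<eta>" "\<forall>x\<in>F. \<exists>y\<in>D. norm (e * x * e - y) < \<eta>"
    by metis
  have "cstar_subalgebra D" using D(1) by (simp add: interval_algebra_def)
  then have eD: "e \<in> D" "0 \<in> D" "projection (0::'a)"
    using D(2) by (simp_all add: is_unit_of_def projection_def cstar_subalgebraD(1))
  have "\<not> proj_le e 0" using e by (auto simp: proj_le_iff[OF e(1) eD(3)])
  then show "\<exists>e D p' q'. interval_algebra D \<and> is_unit_of e D \<and> (\<forall>x\<in>F. norm (x * e - e * x) < \<eta>) \<and>
      (\<forall>x\<in>F. \<exists>y\<in>D. norm (e * x * e - y) < \<eta>) \<and>
      p' \<in> D \<and> q' \<in> D \<and> projection p' \<and> projection q' \<and> \<not> proj_le p' q' \<and>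
      norm (e * 1 * e - p') \<le> 101 * \<eta> \<and> norm (e * 0 * e - q') \<le> 101 * \<eta>"
    using D c e eD \<eta> by (intro exI[of _ e] exI[of _ D] exI[of _ e] exI[of _ 0]) (auto simp: projectionD)
qed blast

text \<open>The \<open>n\<close> orthogonal copies of \<open>r\<close> have the same trace, and their sum is a projection, of norm at most \<open>1\<close>.\<close>

lemma trace_of_multiple:
  fixes \<tau> :: "'a::unital_cstar_algebra \<Rightarrow> complex"
  assumes \<tau>: "tracial_state \<tau>" "\<And>x. cmod (\<tau> x) \<le> norm x" and m: "multiple_le n r 1"
  shows "real n * Re (\<tau> r) \<le> 1"
proof -
  obtain s where s: "\<And>i. i < n \<Longrightarrow> projection (s i) \<and> mvn_equiv r (s i)"
    "\<And>i j. i < n \<Longrightarrow> j < n \<Longrightarrow> i \<noteq> j \<Longrightarrow> s i * s j = 0"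
    using m unfolding multiple_le_def by metis
  have eq: "\<tau> (s i) = \<tau> r" if "i < n" for i
    using s(1)[OF that] \<tau>(1) unfolding mvn_equiv_def tracial_state_def by metis
  have add: "\<tau> (x + y) = \<tau> x + \<tau> y" for x y using \<tau>(1) by (simp add: tracial_state_def)
  have "\<tau> 0 = 0" using add[of 0 0] by simp
  then have "\<tau> (\<Sum>i\<in>A. s i) = (\<Sum>i\<in>A. \<tau> (s i))" for A :: "nat set"
    by (induction A rule: infinite_finite_induct) (simp_all add: add)
  then have "\<tau> (\<Sum>i<n. s i) = of_nat n * \<tau> r" using eq by simp
  moreover have "projection (\<Sum>i<n. s i)"
    unfolding projection_def
  proof
    show "star (\<Sum>i<n. s i) = (\<Sum>i<n. s i)"
      using s(1) by (auto simp: star_sum projectionD intro!: sum.cong)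
    have "(\<Sum>i<n. s i) * (\<Sum>i<n. s i) = (\<Sum>i<n. \<Sum>j<n. s i * s j)" by (rule sum_product)
    also have "\<dots> = (\<Sum>i<n. s i)"
    proof (rule sum.cong[OF refl])
      fix i assume "i \<in> {..<n}"
      then have i: "i < n" by simp
      have "(\<Sum>j<n. s i * s j) = (\<Sum>j<n. if j = i then s i else 0)"
        using s i by (intro sum.cong) (auto simp: projectionD)
      then show "(\<Sum>j<n. s i * s j) = s i" using i by simp
    qed
    finally show "(\<Sum>i<n. s i) * (\<Sum>i<n. s i) = (\<Sum>i<n. s i)" .
  qed
  ultimately have "cmod (of_nat n * \<tau> r) \<le> 1"
    using \<tau>(2)[of "\<Sum>i<n. s i"] norm_projection_le by fastforce
  then show ?thesis using complex_Re_le_cmod[of "of_nat n * \<tau> r"] by simp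
qed

text \<open>This is the case distinction that makes room for \<open>1 - e\<close>: either a projection \<open>q\<^sub>0\<close> of trace at most \<open>1 / n\<close> is set
  aside for it, or no such \<open>q\<^sub>0\<close> exists and \<open>1 - e\<close>, being equivalent to a projection under \<open>q\<close> with \<open>n\<close> orthogonal
  copies, vanishes.\<close>

lemma almost_violating_trace:
  fixes p q :: "'a::unital_cstar_algebra"
  assumes simple: "simple_cstar TYPE('a)" and TAI: "tracially_AI TYPE('a)"
    and p: "projection p" and q: "projection q" "q \<noteq> 0" and nle: "\<not> proj_le p q" and n: "n > 0"
  obtains \<tau> where "tracial_state \<tau>" "\<And>x. cmod (\<tau> x) \<le> norm x" "Re (\<tau> q) \<le> Re (\<tau> p) + 1 / real n"
proof (cases "\<exists>q0. projection q0 \<and> q0 \<noteq> 0 \<and> q * q0 = q0 \<and> multiple_le n q0 1")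
  case True
  then obtain q0 where q0: "projection q0" "q0 \<noteq> 0" "q * q0 = q0" "multiple_le n q0 1" by blast
  have "star (q * q0) = star q0" by (simp add: q0)
  then have q0q: "q0 * q = q0" by (simp add: star_mult projectionD[OF q(1)] projectionD[OF q0(1)])
  have q': "projection (q - q0)" "q * (q - q0) = q - q0" "q0 * (q - q0) = 0"
    by (simp_all add: projection_def star_diff projectionD[OF q(1)] projectionD[OF q0(1)]
        left_diff_distrib right_diff_distrib q0 q0q)
  obtain \<tau> where \<tau>: "tracial_state \<tau>" "\<And>x. cmod (\<tau> x) \<le> norm x" "Re (\<tau> (q - q0)) \<le> Re (\<tau> p)"
  proof (rule tracial_state_if_not_proj_le[OF TAI p q(1) q'(1,2) nle projection_positive[OF q0(1)]
        simple_full[OF simple q0(2)] n])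
    fix e :: 'a assume e: "projection e" and le: "proj_le_elt (1 - e) q0"
    obtain v where v: "star v * v = 1 - e" "q0 * v = v"
      by (rule proj_le_elt_projection[OF q0(1) projection_one_minus[OF e] le])
    have "star (q0 * v) = star v" by (simp add: v)
    then have "star v * (q - q0) = star v * (q0 * (q - q0))"
      by (simp add: star_mult projectionD[OF q0(1)] mult.assoc[symmetric])
    moreover have "q * v = v" using q0(3) v(2) by (metis mult.assoc)
    ultimately show "\<exists>v. star v * v = 1 - e \<and> q * v = v \<and> star v * (q - q0) = 0"
      using v q' by auto
  qed blast
  have "\<tau> ((q - q0) + q0) = \<tau> (q - q0) + \<tau> q0" using \<tau>(1) unfolding tracial_state_def by blast
  then have "Re (\<tau> q) = Re (\<tau> (q - q0)) + Re (\<tau> q0)" by simp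
  moreover have "Re (\<tau> q0) \<le> 1 / real n"
    using trace_of_multiple[OF \<tau>(1,2) q0(4)] n by (simp add: field_simps)
  ultimately show ?thesis using that[OF \<tau>(1,2)] \<tau>(3) by linarith
next
  case False
  obtain \<tau> where \<tau>: "tracial_state \<tau>" "\<And>x. cmod (\<tau> x) \<le> norm x" "Re (\<tau> q) \<le> Re (\<tau> p)"
  proof (rule tracial_state_if_not_proj_le[OF TAI p q(1) q(1) projectionD(2)[OF q(1)] nle
        projection_positive[OF q(1)] simple_full[OF simple q(2)] n])
    fix e :: 'a assume e: "projection e" and m: "multiple_le n (1 - e) e" and le: "proj_le_elt (1 - e) q"
    obtain v where v: "star v * v = 1 - e" "q * v = v"
      by (rule proj_le_elt_projection[OF q(1) projection_one_minus[OF e] le])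
    have ve: "v * (1 - e) = v" by (rule isometry_source[OF projection_one_minus[OF e] v(1)])
    obtain s where s: "\<And>i. i < n \<Longrightarrow> projection (s i) \<and> mvn_equiv (1 - e) (s i)"
      "\<forall>i<n. \<forall>j<n. i \<noteq> j \<longrightarrow> s i * s j = 0"
      using m unfolding multiple_le_def by metis
    have "projection (s i) \<and> s i \<in> corner 1 \<and> mvn_equiv (v * star v) (s i)" if i: "i < n" for i
    proof -
      obtain w where w: "star w * w = 1 - e" "w * star w = s i"
        using s(1)[OF i] by (auto simp: mvn_equiv_def)
      have "star (w * star v) * (w * star v) = v * (star w * w) * star v"
        by (simp add: star_mult star_star mult.assoc)
      then have "star (w * star v) * (w * star v) = v * star v" by (simp add: w ve)
      moreover have "(w * star v) * star (w * star v) = (w * (star v * v)) * star w"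
        by (simp add: star_mult star_star mult.assoc)
      then have "(w * star v) * star (w * star v) = s i"
        using isometry_source[OF projection_one_minus[OF e] w(1)] by (simp add: v w)
      ultimately show ?thesis using s(1)[OF i] by (auto simp: mvn_equiv_def corner_def)
    qed
    then have "multiple_le n (v * star v) 1" using s(2) unfolding multiple_le_def by blast
    moreover have "projection (v * star v)" by (rule range_projection[OF projection_one_minus[OF e] v(1)])
    moreover have "q * (v * star v) = v * star v" by (simp add: mult.assoc[symmetric] v)
    ultimately have "v * star v = 0" using False by blast
    then have "star v = 0" using star_mult_self_eq_0[of "star v"] by (simp add: star_star)
    then show "\<exists>v. star v * v = 1 - e \<and> q * v = v \<and> star v * q = 0"
      using v by (intro exI[of _ v]) simp
  qed blast
  have "1 / real n \<ge> 0" by simp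
  then show ?thesis using that[OF \<tau>(1,2)] \<tau>(3) by linarith
qed

theorem theorem4p7:
  assumes "simple_cstar TYPE('a::unital_cstar_algebra)"
    and "tracially_AI TYPE('a)"
  shows "fundamental_comparability TYPE('a)"
  unfolding fundamental_comparability_def
proof (intro allI impI)
  fix p q :: 'a
  assume "projection p \<and> projection q \<and> (\<forall>\<tau>. tracial_state \<tau> \<longrightarrow> Re (\<tau> p) < Re (\<tau> q))"
  then have p: "projection p" and q: "projection q"
    and less: "\<And>\<tau>. tracial_state \<tau> \<Longrightarrow> Re (\<tau> p) < Re (\<tau> q)" by auto
  show "proj_le p q"
  proof (rule ccontr)
    assume nle: "\<not> proj_le p q"
    \<comment> \<open>For \<open>q = 0\<close> the hypothesis on traces contradicts positivity, provided that there is a tracial state at all.\<close>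
    have q0: "q \<noteq> 0"
    proof
      assume q: "q = 0"
      obtain \<tau> :: "'a \<Rightarrow> complex" where \<tau>: "tracial_state \<tau>"
        using exists_tracial_state[OF assms] by blast
      then have "\<tau> (0 *\<^sub>C 0) = 0 * \<tau> 0" unfolding tracial_state_def by blast
      then have "\<tau> 0 = 0" by simp
      moreover have "\<tau> p \<in> \<real>\<^sub>\<ge>\<^sub>0" using \<tau> projection_positive[OF p] unfolding tracial_state_def by blast
      ultimately show False using less[OF \<tau>] q by (simp add: complex_nonneg_Reals_iff)
    qed
    obtain \<tau> where \<tau>: "tracial_state \<tau>" "Re (\<tau> q) \<le> Re (\<tau> p)"
    proof (rule tracial_state_from_approximate_traces[of q p])
      fix F :: "'a set" and G :: "complex set" and \<epsilon> :: real
      assume "\<epsilon> > 0"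
      then obtain n where n: "n \<noteq> 0" "inverse (real n) < \<epsilon>" using real_arch_inverse by auto
      obtain \<tau> where \<tau>: "tracial_state \<tau>" "\<And>x. cmod (\<tau> x) \<le> norm x" "Re (\<tau> q) \<le> Re (\<tau> p) + 1 / real n"
        using almost_violating_trace[OF assms p q q0 nle, of n] n by auto
      have "approximate_trace F G \<epsilon> \<tau>"
        using \<tau>(1) \<open>\<epsilon> > 0\<close> unfolding approximate_trace_def tracial_state_def
        by (auto intro: order_trans[OF \<tau>(2)])
      then show "\<exists>\<sigma>. approximate_trace F G \<epsilon> \<sigma> \<and> Re (\<sigma> q) \<le> Re (\<sigma> p) + \<epsilon>"
        using \<tau>(3) n by (intro exI[of _ \<tau>]) (simp add: inverse_eq_divide)
    qed blast
    then show False using less[OF \<tau>(1)] by simp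
  qed
qed

end
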